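(* Let $G=\mathbb{Z}_p\times\mathbb{Z}_2\times\mathbb{Z}_2\times\mathbb{Z}_2\times\mathbb{Z}_2$ for an odd prime $p$, let $S$ be a proper subset of $G\setminus\{0\}$ that generates $G$, and let $S_0=S\cup\{0\}$. Let $0\in C\subseteq G$. Put $\mathbf{e}_1=(1,0,0,0,0)$. Then $C$ is a perfect code in $\mathrm{Cay}(G,S)$ if and only if there exist four elements $\mathbf{e}_2,\mathbf{e}_3,\mathbf{e}_4,\mathbf{e}_5$ generating $\{0\}\times\mathbb{Z}_2\times\mathbb{Z}_2\times\mathbb{Z}_2\times\mathbb{Z}_2$ and integer parameters such that $(S_0,C)$ is one of the following pairs: (1) $S_0=\{i\mathbf{e}_1+\alpha_i\mathbf{e}_2+\beta_i\mathbf{e}_3+\gamma_i\mathbf{e}_4+\delta_i\mathbf{e}_5\mid i\in[p]\}$, $C=\{i\mathbf{e}_2+j\mathbf{e}_3+k\mathbf{e}_4+l\mathbf{e}_5\mid i,j,k,l\in[2]\}$; (2) $S_0=\{i\mathbf{e}_1+j\mathbf{e}_2+\alpha_i\mathbf{e}_3+\beta_i\mathbf{e}_4+\gamma_i\mathbf{e}_5\mid i\in[p],j\in[2]\}$, $C=\{\lambda_{ijk}\mathbf{e}_2+i\mathbf{e}_3+j\mathbf{e}_4+k\mathbf{e}_5\mid i,j,k\in[2]\}$; (3) $S_0=\{i\mathbf{e}_1+\alpha_{ij}\mathbf{e}_2+j\mathbf{e}_3+\alpha_i\mathbf{e}_4+\beta_i\mathbf{e}_5\mid i\in[p],j\in[2]\}$,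 $C=\{k\mathbf{e}_2+\lambda_{ij}\mathbf{e}_3+i\mathbf{e}_4+j\mathbf{e}_5\mid i,j,k\in[2]\}$; (4) $S_0=\{i\mathbf{e}_1+\alpha_{ij}\mathbf{e}_2+\beta_{ij}\mathbf{e}_3+j\mathbf{e}_4+\alpha_i\mathbf{e}_5\mid i\in[p],j\in[2]\}$, $C=\{j\mathbf{e}_2+k\mathbf{e}_3+\lambda_i\mathbf{e}_4+i\mathbf{e}_5\mid i,j,k\in[2]\}$; (5) $S_0=\{i\mathbf{e}_1+\alpha_{ij}\mathbf{e}_2+\beta_{ij}\mathbf{e}_3+\gamma_{ij}\mathbf{e}_4+j\mathbf{e}_5\mid i\in[p],j\in[2]\}$, $C=\{i\mathbf{e}_2+j\mathbf{e}_3+k\mathbf{e}_4\mid i,j,k\in[2]\}$; (6) $S_0=\{i\mathbf{e}_1+k\mathbf{e}_2+\alpha_{ij}\mathbf{e}_3+j\mathbf{e}_4+\alpha_i\mathbf{e}_5\mid i\in[p],j,k\in[2]\}$, $C=\{\lambda_{ij}\mathbf{e}_2+j\mathbf{e}_3+\lambda_i\mathbf{e}_4+i\mathbf{e}_5\mid i,j\in[2]\}$; (7) $S_0=\{i\mathbf{e}_1+k\mathbf{e}_2+\alpha_{ij}\mathbf{e}_3+\beta_{ij}\mathbf{e}_4+j\mathbf{e}_5\mid i\in[p],j,k\in[2]\}$, $C=\{\lambda_{ij}\mathbf{e}_2+i\mathbf{e}_3+j\mathbf{e}_4\mid i,j\in[2]\}$; (8) $S_0=\{i\mathbf{e}_1+j\mathbf{e}_2+k\mathbf{e}_3+\alpha_i\mathbf{e}_4+\beta_i\mathbf{e}_5\mid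 i\in[p],j,k\in[2]\}$, $C=\{\lambda_{ij}\mathbf{e}_2+\mu_{ij}\mathbf{e}_3+i\mathbf{e}_4+j\mathbf{e}_5\mid i,j\in[2]\}$; (9) $S_0=\{i\mathbf{e}_1+\alpha_{ijk}\mathbf{e}_2+k\mathbf{e}_3+\alpha_{ij}\mathbf{e}_4+j\mathbf{e}_5\mid i\in[p],j,k\in[2]\}$, $C=\{j\mathbf{e}_2+\lambda_i\mathbf{e}_3+i\mathbf{e}_4\mid i,j\in[2]\}$; (10) $S_0=\{k\mathbf{e}_1+\alpha_{ijk}\mathbf{e}_2+\alpha_{ij}\mathbf{e}_3+i\mathbf{e}_4+j\mathbf{e}_5\mid i,j\in[2],k\in[p]\}$, $C=\{\lambda_i\mathbf{e}_1+j\mathbf{e}_2+i\mathbf{e}_3\mid i,j\in[2]\}$; (11) $S_0=\{i\mathbf{e}_1+\alpha_{ijk}\mathbf{e}_2+j\mathbf{e}_3+k\mathbf{e}_4+\alpha_i\mathbf{e}_5\mid i\in[p],j,k\in[2]\}$, $C=\{j\mathbf{e}_2+\lambda_i\mathbf{e}_3+\mu_i\mathbf{e}_4+i\mathbf{e}_5\mid i,j\in[2]\}$; (12) $S_0=\{i\mathbf{e}_1+\alpha_{ijk}\mathbf{e}_2+\beta_{ijk}\mathbf{e}_3+j\mathbf{e}_4+k\mathbf{e}_5\mid i\in[p],j,k\in[2]\}$, $C=\{i\mathbf{e}_2+j\mathbf{e}_3\mid i,j\in[2]\}$; (13) $S_0=\{\alpha_i\mathbf{e}_1+k\mathbf{e}_2+\alpha_{ij}\mathbf{e}_3+j\mathbf{e}_4+i\mathbf{e}_5\mid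 i,j,k\in[2]\}$, $C=\{i\mathbf{e}_1+\lambda_{ij}\mathbf{e}_2+j\mathbf{e}_3+\lambda_i\mathbf{e}_4\mid i\in[p],j\in[2]\}$; (14) $S_0=\{\alpha_{ij}\mathbf{e}_1+k\mathbf{e}_2+\alpha_{ij}\mathbf{e}_3+i\mathbf{e}_4+j\mathbf{e}_5\mid i,j,k\in[2]\}$, $C=\{i\mathbf{e}_1+\lambda_{ij}\mathbf{e}_2+j\mathbf{e}_3\mid i\in[p],j\in[2]\}$; (15) $S_0=\{\alpha_{ij}\mathbf{e}_1+\alpha_{ijk}\mathbf{e}_2+k\mathbf{e}_3+i\mathbf{e}_4+j\mathbf{e}_5\mid i,j,k\in[2]\}$, $C=\{i\mathbf{e}_1+j\mathbf{e}_2+\lambda_i\mathbf{e}_3\mid i\in[p],j\in[2]\}$; (16) $S_0=\{\alpha_i\mathbf{e}_1+\alpha_{ijk}\mathbf{e}_2+j\mathbf{e}_3+k\mathbf{e}_4+i\mathbf{e}_5\mid i,j,k\in[2]\}$, $C=\{i\mathbf{e}_1+j\mathbf{e}_2+\lambda_i\mathbf{e}_3+\mu_i\mathbf{e}_4\mid i\in[p],j\in[2]\}$; (17) $S_0=\{\alpha_{ijk}\mathbf{e}_1+k\mathbf{e}_2+\alpha_{ij}\mathbf{e}_3+i\mathbf{e}_4+j\mathbf{e}_5\mid i,j,k\in[2]\}$, $C=\{j\mathbf{e}_1+\lambda_i\mathbf{e}_2+i\mathbf{e}_3\mid i\in[2],j\in[p]\}$; (18) $S_0=\{\alpha_{ijk}\mathbf{e}_1+\alpha_{ijk}\mathbf{e}_2+i\mathbf{e}_3+j\mathbf{e}_4+k\mathbf{e}_5\mid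 i,j,k\in[2]\}$, $C=\{i\mathbf{e}_1+j\mathbf{e}_2\mid i\in[p],j\in[2]\}$; (19) $S_0=\{i\mathbf{e}_1+l\mathbf{e}_2+\alpha_{ijk}\mathbf{e}_3+j\mathbf{e}_4+k\mathbf{e}_5\mid i\in[p],j,k,l\in[2]\}$, $C=\{\lambda_i\mathbf{e}_2+i\mathbf{e}_3\mid i\in[2]\}$; (20) $S_0=\{l\mathbf{e}_1+\alpha_{ijk}\mathbf{e}_2+i\mathbf{e}_3+j\mathbf{e}_4+k\mathbf{e}_5\mid i,j,k\in[2],l\in[p]\}$, $C=\{\lambda_i\mathbf{e}_1+i\mathbf{e}_2\mid i\in[2]\}$; (21) $S_0=\{i\mathbf{e}_1+k\mathbf{e}_2+l\mathbf{e}_3+\alpha_{ij}\mathbf{e}_4+j\mathbf{e}_5\mid i\in[p],j,k,l\in[2]\}$, $C=\{\lambda_i\mathbf{e}_2+\mu_i\mathbf{e}_3+i\mathbf{e}_4\mid i\in[2]\}$; (22) $S_0=\{k\mathbf{e}_1+l\mathbf{e}_2+\alpha_{ij}\mathbf{e}_3+i\mathbf{e}_4+j\mathbf{e}_5\mid i,j,l\in[2],k\in[p]\}$, $C=\{\lambda_i\mathbf{e}_1+\lambda_i\mathbf{e}_2+i\mathbf{e}_3\mid i\in[2]\}$; (23) $S_0=\{i\mathbf{e}_1+j\mathbf{e}_2+k\mathbf{e}_3+l\mathbf{e}_4+\alpha_i\mathbf{e}_5\mid i\in[p],j,k,l\in[2]\}$, $C=\{\lambda_i\mathbf{e}_2+\mu_i\mathbf{e}_3+\nu_i\mathbf{e}_4+i\mathbf{e}_5\mid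 i\in[2]\}$; (24) $S_0=\{i\mathbf{e}_1+\alpha_{ijkl}\mathbf{e}_2+j\mathbf{e}_3+k\mathbf{e}_4+l\mathbf{e}_5\mid i\in[p],j,k,l\in[2]\}$, $C=\{i\mathbf{e}_2\mid i\in[2]\}$; (25) $S_0=\{\alpha_{ijk}\mathbf{e}_1+l\mathbf{e}_2+i\mathbf{e}_3+j\mathbf{e}_4+k\mathbf{e}_5\mid i,j,k,l\in[2]\}$, $C=\{i\mathbf{e}_1+\lambda_i\mathbf{e}_2\mid i\in[p]\}$; (26) $S_0=\{\alpha_{ij}\mathbf{e}_1+k\mathbf{e}_2+l\mathbf{e}_3+i\mathbf{e}_4+j\mathbf{e}_5\mid i,j,k,l\in[2]\}$, $C=\{i\mathbf{e}_1+\lambda_i\mathbf{e}_2+\mu_i\mathbf{e}_3\mid i\in[p]\}$; (27) $S_0=\{\alpha_i\mathbf{e}_1+j\mathbf{e}_2+k\mathbf{e}_3+l\mathbf{e}_4+i\mathbf{e}_5\mid i,j,k,l\in[2]\}$, $C=\{i\mathbf{e}_1+\lambda_i\mathbf{e}_2+\mu_i\mathbf{e}_3+\nu_i\mathbf{e}_4\mid i\in[p]\}$; (28) $S_0=\{\alpha_{ijkl}\mathbf{e}_1+i\mathbf{e}_2+j\mathbf{e}_3+k\mathbf{e}_4+l\mathbf{e}_5\mid i,j,k,l\in[2]\}$, $C=\{i\mathbf{e}_1\mid i\in[p]\}$.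
   Context: Groups are finite abelian, written additively; $\mathbb{Z}_n$ is the group of integers modulo $n$ and $[n]=\{0,1,\dots,n-1\}$. For $S\subseteq G\setminus\{0\}$, $\mathrm{Cay}(G,S)$ is the directed graph with vertex set $G$ and an arc from $x$ to $y$ if and only if $y-x\in S$ ($S$ is not assumed to be inverse-closed). A subset $C\subseteq G$ is a perfect code in $\mathrm{Cay}(G,S)$ if the sets $\{c\}\cup\{v:\text{there is an arc from } c \text{ to } v\}$, $c\in C$, form a partition of $G$. Greek letters with subscripts denote arbitrary integers, one for each value of the displayed indices, subject only to being $0$ when all subscripts are $0$; different letters (or index patterns) denote independent families, and an integer occurring several times in one element is the same integer each time. *)

theory Defs
  imports
    "HOL-Library.Z2"
    "HOL-Library.Product_Plus"
    "HOL-Library.Disjoint_Sets"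
    "HOL-Library.Cardinality"
    "HOL-Computational_Algebra.Group_Closure"
    "Berlekamp_Zassenhaus.Finite_Field"
    "Graph_Theory.Graph_Theory"
begin

instance bit :: finite
proof
  have "(UNIV :: bit set) = {0, 1}"
    by auto
  then show "finite (UNIV :: bit set)"
    by (metis finite.emptyI finite_insert)
qed

definition cayley_digraph :: "'a::ab_group_add set \<Rightarrow> 'a pair_pre_digraph" where
  "cayley_digraph S = \<lparr>pverts = UNIV, parcs = {(x, y). y - x \<in> S}\<rparr>"

definition closed_out_nbhd :: "('a, 'b) pre_digraph \<Rightarrow> 'a \<Rightarrow> 'a set" where
  "closed_out_nbhd D c = insert c {v. c \<rightarrow>\<^bsub>D\<^esub> v}"

text \<open>
  The partition condition concerns the family indexed by \<open>C\<close>, not the set of its members: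
  distinct code vertices must have disjoint closed out-neighbourhoods, hence in particular
  different ones.
\<close>

definition perfect_code :: "('a, 'b) pre_digraph \<Rightarrow> 'a set \<Rightarrow> bool" where
  "perfect_code D C \<longleftrightarrow>
     C \<subseteq> verts D \<and> disjoint_family_on (closed_out_nbhd D) C \<and>
     (\<Union>c\<in>C. closed_out_nbhd D c) = verts D"

text \<open>Integer multiples in an additive abelian group.\<close>

definition zmult :: "int \<Rightarrow> 'a::ab_group_add \<Rightarrow> 'a" (infixr \<open>\<cdot>\<close> 75) where
  "n \<cdot> x = (if 0 \<le> n then ((+) x ^^ nat n) 0 else - ((+) x ^^ nat (- n)) 0)"

text \<open>
  The possible pairs \<open>(S\<^sub>0, C)\<close>, relative to \<open>e1, \<dots>, e5\<close>. All indices and parameters are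
  integers, and \<open>[n]\<close> is \<open>{0..<n}\<close>. The digit in the name of a parameter family is the number
  of its subscripts: \<open>\<alpha>2 i j\<close> is \<open>\<alpha>\<^sub>i\<^sub>j\<close>, and \<open>\<alpha>1\<close>, \<open>\<alpha>2\<close> are unrelated families. The letter
  \<open>\<Lambda>\<close> replaces the reserved symbol for lower-case lambda.
\<close>

inductive listed_pair ::
  "int \<Rightarrow> 'a::ab_group_add \<Rightarrow> 'a \<Rightarrow> 'a \<Rightarrow> 'a \<Rightarrow> 'a \<Rightarrow> 'a set \<Rightarrow> 'a set \<Rightarrow> bool"
  for p e1 e2 e3 e4 e5 where
  listed1: "\<lbrakk>\<alpha>1 0 = 0; \<beta>1 0 = 0; \<gamma>1 0 = 0; \<delta>1 0 = 0\<rbrakk>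
    \<Longrightarrow> listed_pair p e1 e2 e3 e4 e5
      {i \<cdot> e1 + \<alpha>1 i \<cdot> e2 + \<beta>1 i \<cdot> e3 + \<gamma>1 i \<cdot> e4 + \<delta>1 i \<cdot> e5 |i. i \<in> {0..<p}}
      {i \<cdot> e2 + j \<cdot> e3 + k \<cdot> e4 + l \<cdot> e5 |i j k l. i \<in> {0..<2} \<and> j \<in> {0..<2} \<and> k \<in> {0..<2} \<and> l \<in> {0..<2}}"
| listed2: "\<lbrakk>\<alpha>1 0 = 0; \<beta>1 0 = 0; \<gamma>1 0 = 0; \<Lambda>3 0 0 0 = 0\<rbrakk>
    \<Longrightarrow> listed_pair p e1 e2 e3 e4 e5
      {i \<cdot> e1 + j \<cdot> e2 + \<alpha>1 i \<cdot> e3 + \<beta>1 i \<cdot> e4 + \<gamma>1 i \<cdot> e5 |i j. i \<in> {0..<p} \<and> j \<in> {0..<2}}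
      {\<Lambda>3 i j k \<cdot> e2 + i \<cdot> e3 + j \<cdot> e4 + k \<cdot> e5 |i j k. i \<in> {0..<2} \<and> j \<in> {0..<2} \<and> k \<in> {0..<2}}"
| listed3: "\<lbrakk>\<alpha>2 0 0 = 0; \<alpha>1 0 = 0; \<beta>1 0 = 0; \<Lambda>2 0 0 = 0\<rbrakk>
    \<Longrightarrow> listed_pair p e1 e2 e3 e4 e5
      {i \<cdot> e1 + \<alpha>2 i j \<cdot> e2 + j \<cdot> e3 + \<alpha>1 i \<cdot> e4 + \<beta>1 i \<cdot> e5 |i j. i \<in> {0..<p} \<and> j \<in> {0..<2}}
      {k \<cdot> e2 + \<Lambda>2 i j \<cdot> e3 + i \<cdot> e4 + j \<cdot> e5 |i j k. i \<in> {0..<2} \<and> j \<in> {0..<2} \<and> k \<in> {0..<2}}"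
| listed4: "\<lbrakk>\<alpha>2 0 0 = 0; \<beta>2 0 0 = 0; \<alpha>1 0 = 0; \<Lambda>1 0 = 0\<rbrakk>
    \<Longrightarrow> listed_pair p e1 e2 e3 e4 e5
      {i \<cdot> e1 + \<alpha>2 i j \<cdot> e2 + \<beta>2 i j \<cdot> e3 + j \<cdot> e4 + \<alpha>1 i \<cdot> e5 |i j. i \<in> {0..<p} \<and> j \<in> {0..<2}}
      {j \<cdot> e2 + k \<cdot> e3 + \<Lambda>1 i \<cdot> e4 + i \<cdot> e5 |i j k. i \<in> {0..<2} \<and> j \<in> {0..<2} \<and> k \<in> {0..<2}}"
| listed5: "\<lbrakk>\<alpha>2 0 0 = 0; \<beta>2 0 0 = 0; \<gamma>2 0 0 = 0\<rbrakk>
    \<Longrightarrow> listed_pair p e1 e2 e3 e4 e5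
      {i \<cdot> e1 + \<alpha>2 i j \<cdot> e2 + \<beta>2 i j \<cdot> e3 + \<gamma>2 i j \<cdot> e4 + j \<cdot> e5 |i j. i \<in> {0..<p} \<and> j \<in> {0..<2}}
      {i \<cdot> e2 + j \<cdot> e3 + k \<cdot> e4 |i j k. i \<in> {0..<2} \<and> j \<in> {0..<2} \<and> k \<in> {0..<2}}"
| listed6: "\<lbrakk>\<alpha>2 0 0 = 0; \<alpha>1 0 = 0; \<Lambda>2 0 0 = 0; \<Lambda>1 0 = 0\<rbrakk>
    \<Longrightarrow> listed_pair p e1 e2 e3 e4 e5
      {i \<cdot> e1 + k \<cdot> e2 + \<alpha>2 i j \<cdot> e3 + j \<cdot> e4 + \<alpha>1 i \<cdot> e5 |i j k. i \<in> {0..<p} \<and> j \<in> {0..<2} \<and> k \<in> {0..<2}}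
      {\<Lambda>2 i j \<cdot> e2 + j \<cdot> e3 + \<Lambda>1 i \<cdot> e4 + i \<cdot> e5 |i j. i \<in> {0..<2} \<and> j \<in> {0..<2}}"
| listed7: "\<lbrakk>\<alpha>2 0 0 = 0; \<beta>2 0 0 = 0; \<Lambda>2 0 0 = 0\<rbrakk>
    \<Longrightarrow> listed_pair p e1 e2 e3 e4 e5
      {i \<cdot> e1 + k \<cdot> e2 + \<alpha>2 i j \<cdot> e3 + \<beta>2 i j \<cdot> e4 + j \<cdot> e5 |i j k. i \<in> {0..<p} \<and> j \<in> {0..<2} \<and> k \<in> {0..<2}}
      {\<Lambda>2 i j \<cdot> e2 + i \<cdot> e3 + j \<cdot> e4 |i j. i \<in> {0..<2} \<and> j \<in> {0..<2}}"
| listed8: "\<lbrakk>\<alpha>1 0 = 0; \<beta>1 0 = 0; \<Lambda>2 0 0 = 0; \<mu>2 0 0 = 0\<rbrakk>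
    \<Longrightarrow> listed_pair p e1 e2 e3 e4 e5
      {i \<cdot> e1 + j \<cdot> e2 + k \<cdot> e3 + \<alpha>1 i \<cdot> e4 + \<beta>1 i \<cdot> e5 |i j k. i \<in> {0..<p} \<and> j \<in> {0..<2} \<and> k \<in> {0..<2}}
      {\<Lambda>2 i j \<cdot> e2 + \<mu>2 i j \<cdot> e3 + i \<cdot> e4 + j \<cdot> e5 |i j. i \<in> {0..<2} \<and> j \<in> {0..<2}}"
| listed9: "\<lbrakk>\<alpha>3 0 0 0 = 0; \<alpha>2 0 0 = 0; \<Lambda>1 0 = 0\<rbrakk>
    \<Longrightarrow> listed_pair p e1 e2 e3 e4 e5
      {i \<cdot> e1 + \<alpha>3 i j k \<cdot> e2 + k \<cdot> e3 + \<alpha>2 i j \<cdot> e4 + j \<cdot> e5 |i j k. i \<in> {0..<p} \<and> j \<in> {0..<2} \<and> k \<in> {0..<2}}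
      {j \<cdot> e2 + \<Lambda>1 i \<cdot> e3 + i \<cdot> e4 |i j. i \<in> {0..<2} \<and> j \<in> {0..<2}}"
| listed10: "\<lbrakk>\<alpha>3 0 0 0 = 0; \<alpha>2 0 0 = 0; \<Lambda>1 0 = 0\<rbrakk>
    \<Longrightarrow> listed_pair p e1 e2 e3 e4 e5
      {k \<cdot> e1 + \<alpha>3 i j k \<cdot> e2 + \<alpha>2 i j \<cdot> e3 + i \<cdot> e4 + j \<cdot> e5 |i j k. i \<in> {0..<2} \<and> j \<in> {0..<2} \<and> k \<in> {0..<p}}
      {\<Lambda>1 i \<cdot> e1 + j \<cdot> e2 + i \<cdot> e3 |i j. i \<in> {0..<2} \<and> j \<in> {0..<2}}"
| listed11: "\<lbrakk>\<alpha>3 0 0 0 = 0; \<alpha>1 0 = 0; \<Lambda>1 0 = 0; \<mu>1 0 = 0\<rbrakk>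
    \<Longrightarrow> listed_pair p e1 e2 e3 e4 e5
      {i \<cdot> e1 + \<alpha>3 i j k \<cdot> e2 + j \<cdot> e3 + k \<cdot> e4 + \<alpha>1 i \<cdot> e5 |i j k. i \<in> {0..<p} \<and> j \<in> {0..<2} \<and> k \<in> {0..<2}}
      {j \<cdot> e2 + \<Lambda>1 i \<cdot> e3 + \<mu>1 i \<cdot> e4 + i \<cdot> e5 |i j. i \<in> {0..<2} \<and> j \<in> {0..<2}}"
| listed12: "\<lbrakk>\<alpha>3 0 0 0 = 0; \<beta>3 0 0 0 = 0\<rbrakk>
    \<Longrightarrow> listed_pair p e1 e2 e3 e4 e5
      {i \<cdot> e1 + \<alpha>3 i j k \<cdot> e2 + \<beta>3 i j k \<cdot> e3 + j \<cdot> e4 + k \<cdot> e5 |i j k. i \<in> {0..<p} \<and> j \<in> {0..<2} \<and> k \<in> {0..<2}}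
      {i \<cdot> e2 + j \<cdot> e3 |i j. i \<in> {0..<2} \<and> j \<in> {0..<2}}"
| listed13: "\<lbrakk>\<alpha>1 0 = 0; \<alpha>2 0 0 = 0; \<Lambda>2 0 0 = 0; \<Lambda>1 0 = 0\<rbrakk>
    \<Longrightarrow> listed_pair p e1 e2 e3 e4 e5
      {\<alpha>1 i \<cdot> e1 + k \<cdot> e2 + \<alpha>2 i j \<cdot> e3 + j \<cdot> e4 + i \<cdot> e5 |i j k. i \<in> {0..<2} \<and> j \<in> {0..<2} \<and> k \<in> {0..<2}}
      {i \<cdot> e1 + \<Lambda>2 i j \<cdot> e2 + j \<cdot> e3 + \<Lambda>1 i \<cdot> e4 |i j. i \<in> {0..<p} \<and> j \<in> {0..<2}}"
| listed14: "\<lbrakk>\<alpha>2 0 0 = 0; \<Lambda>2 0 0 = 0\<rbrakk>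
    \<Longrightarrow> listed_pair p e1 e2 e3 e4 e5
      {\<alpha>2 i j \<cdot> e1 + k \<cdot> e2 + \<alpha>2 i j \<cdot> e3 + i \<cdot> e4 + j \<cdot> e5 |i j k. i \<in> {0..<2} \<and> j \<in> {0..<2} \<and> k \<in> {0..<2}}
      {i \<cdot> e1 + \<Lambda>2 i j \<cdot> e2 + j \<cdot> e3 |i j. i \<in> {0..<p} \<and> j \<in> {0..<2}}"
| listed15: "\<lbrakk>\<alpha>2 0 0 = 0; \<alpha>3 0 0 0 = 0; \<Lambda>1 0 = 0\<rbrakk>
    \<Longrightarrow> listed_pair p e1 e2 e3 e4 e5
      {\<alpha>2 i j \<cdot> e1 + \<alpha>3 i j k \<cdot> e2 + k \<cdot> e3 + i \<cdot> e4 + j \<cdot> e5 |i j k. i \<in> {0..<2} \<and> j \<in> {0..<2} \<and> k \<in> {0..<2}}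
      {i \<cdot> e1 + j \<cdot> e2 + \<Lambda>1 i \<cdot> e3 |i j. i \<in> {0..<p} \<and> j \<in> {0..<2}}"
| listed16: "\<lbrakk>\<alpha>1 0 = 0; \<alpha>3 0 0 0 = 0; \<Lambda>1 0 = 0; \<mu>1 0 = 0\<rbrakk>
    \<Longrightarrow> listed_pair p e1 e2 e3 e4 e5
      {\<alpha>1 i \<cdot> e1 + \<alpha>3 i j k \<cdot> e2 + j \<cdot> e3 + k \<cdot> e4 + i \<cdot> e5 |i j k. i \<in> {0..<2} \<and> j \<in> {0..<2} \<and> k \<in> {0..<2}}
      {i \<cdot> e1 + j \<cdot> e2 + \<Lambda>1 i \<cdot> e3 + \<mu>1 i \<cdot> e4 |i j. i \<in> {0..<p} \<and> j \<in> {0..<2}}"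
| listed17: "\<lbrakk>\<alpha>3 0 0 0 = 0; \<alpha>2 0 0 = 0; \<Lambda>1 0 = 0\<rbrakk>
    \<Longrightarrow> listed_pair p e1 e2 e3 e4 e5
      {\<alpha>3 i j k \<cdot> e1 + k \<cdot> e2 + \<alpha>2 i j \<cdot> e3 + i \<cdot> e4 + j \<cdot> e5 |i j k. i \<in> {0..<2} \<and> j \<in> {0..<2} \<and> k \<in> {0..<2}}
      {j \<cdot> e1 + \<Lambda>1 i \<cdot> e2 + i \<cdot> e3 |i j. i \<in> {0..<2} \<and> j \<in> {0..<p}}"
| listed18: "\<alpha>3 0 0 0 = 0
    \<Longrightarrow> listed_pair p e1 e2 e3 e4 e5
      {\<alpha>3 i j k \<cdot> e1 + \<alpha>3 i j k \<cdot> e2 + i \<cdot> e3 + j \<cdot> e4 + k \<cdot> e5 |i j k. i \<in> {0..<2} \<and> j \<in> {0..<2} \<and> k \<in> {0..<2}}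
      {i \<cdot> e1 + j \<cdot> e2 |i j. i \<in> {0..<p} \<and> j \<in> {0..<2}}"
| listed19: "\<lbrakk>\<alpha>3 0 0 0 = 0; \<Lambda>1 0 = 0\<rbrakk>
    \<Longrightarrow> listed_pair p e1 e2 e3 e4 e5
      {i \<cdot> e1 + l \<cdot> e2 + \<alpha>3 i j k \<cdot> e3 + j \<cdot> e4 + k \<cdot> e5 |i j k l. i \<in> {0..<p} \<and> j \<in> {0..<2} \<and> k \<in> {0..<2} \<and> l \<in> {0..<2}}
      {\<Lambda>1 i \<cdot> e2 + i \<cdot> e3 |i. i \<in> {0..<2}}"
| listed20: "\<lbrakk>\<alpha>3 0 0 0 = 0; \<Lambda>1 0 = 0\<rbrakk>
    \<Longrightarrow> listed_pair p e1 e2 e3 e4 e5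
      {l \<cdot> e1 + \<alpha>3 i j k \<cdot> e2 + i \<cdot> e3 + j \<cdot> e4 + k \<cdot> e5 |i j k l. i \<in> {0..<2} \<and> j \<in> {0..<2} \<and> k \<in> {0..<2} \<and> l \<in> {0..<p}}
      {\<Lambda>1 i \<cdot> e1 + i \<cdot> e2 |i. i \<in> {0..<2}}"
| listed21: "\<lbrakk>\<alpha>2 0 0 = 0; \<Lambda>1 0 = 0; \<mu>1 0 = 0\<rbrakk>
    \<Longrightarrow> listed_pair p e1 e2 e3 e4 e5
      {i \<cdot> e1 + k \<cdot> e2 + l \<cdot> e3 + \<alpha>2 i j \<cdot> e4 + j \<cdot> e5 |i j k l. i \<in> {0..<p} \<and> j \<in> {0..<2} \<and> k \<in> {0..<2} \<and> l \<in> {0..<2}}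
      {\<Lambda>1 i \<cdot> e2 + \<mu>1 i \<cdot> e3 + i \<cdot> e4 |i. i \<in> {0..<2}}"
| listed22: "\<lbrakk>\<alpha>2 0 0 = 0; \<Lambda>1 0 = 0\<rbrakk>
    \<Longrightarrow> listed_pair p e1 e2 e3 e4 e5
      {k \<cdot> e1 + l \<cdot> e2 + \<alpha>2 i j \<cdot> e3 + i \<cdot> e4 + j \<cdot> e5 |i j k l. i \<in> {0..<2} \<and> j \<in> {0..<2} \<and> k \<in> {0..<p} \<and> l \<in> {0..<2}}
      {\<Lambda>1 i \<cdot> e1 + \<Lambda>1 i \<cdot> e2 + i \<cdot> e3 |i. i \<in> {0..<2}}"
| listed23: "\<lbrakk>\<alpha>1 0 = 0; \<Lambda>1 0 = 0; \<mu>1 0 = 0; \<nu>1 0 = 0\<rbrakk>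
    \<Longrightarrow> listed_pair p e1 e2 e3 e4 e5
      {i \<cdot> e1 + j \<cdot> e2 + k \<cdot> e3 + l \<cdot> e4 + \<alpha>1 i \<cdot> e5 |i j k l. i \<in> {0..<p} \<and> j \<in> {0..<2} \<and> k \<in> {0..<2} \<and> l \<in> {0..<2}}
      {\<Lambda>1 i \<cdot> e2 + \<mu>1 i \<cdot> e3 + \<nu>1 i \<cdot> e4 + i \<cdot> e5 |i. i \<in> {0..<2}}"
| listed24: "\<alpha>4 0 0 0 0 = 0
    \<Longrightarrow> listed_pair p e1 e2 e3 e4 e5
      {i \<cdot> e1 + \<alpha>4 i j k l \<cdot> e2 + j \<cdot> e3 + k \<cdot> e4 + l \<cdot> e5 |i j k l. i \<in> {0..<p} \<and> j \<in> {0..<2} \<and> k \<in> {0..<2} \<and> l \<in> {0..<2}}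
      {i \<cdot> e2 |i. i \<in> {0..<2}}"
| listed25: "\<lbrakk>\<alpha>3 0 0 0 = 0; \<Lambda>1 0 = 0\<rbrakk>
    \<Longrightarrow> listed_pair p e1 e2 e3 e4 e5
      {\<alpha>3 i j k \<cdot> e1 + l \<cdot> e2 + i \<cdot> e3 + j \<cdot> e4 + k \<cdot> e5 |i j k l. i \<in> {0..<2} \<and> j \<in> {0..<2} \<and> k \<in> {0..<2} \<and> l \<in> {0..<2}}
      {i \<cdot> e1 + \<Lambda>1 i \<cdot> e2 |i. i \<in> {0..<p}}"
| listed26: "\<lbrakk>\<alpha>2 0 0 = 0; \<Lambda>1 0 = 0; \<mu>1 0 = 0\<rbrakk>
    \<Longrightarrow> listed_pair p e1 e2 e3 e4 e5
      {\<alpha>2 i j \<cdot> e1 + k \<cdot> e2 + l \<cdot> e3 + i \<cdot> e4 + j \<cdot> e5 |i j k l. i \<in> {0..<2} \<and> j \<in> {0..<2} \<and> k \<in> {0..<2} \<and> l \<in> {0..<2}}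
      {i \<cdot> e1 + \<Lambda>1 i \<cdot> e2 + \<mu>1 i \<cdot> e3 |i. i \<in> {0..<p}}"
| listed27: "\<lbrakk>\<alpha>1 0 = 0; \<Lambda>1 0 = 0; \<mu>1 0 = 0; \<nu>1 0 = 0\<rbrakk>
    \<Longrightarrow> listed_pair p e1 e2 e3 e4 e5
      {\<alpha>1 i \<cdot> e1 + j \<cdot> e2 + k \<cdot> e3 + l \<cdot> e4 + i \<cdot> e5 |i j k l. i \<in> {0..<2} \<and> j \<in> {0..<2} \<and> k \<in> {0..<2} \<and> l \<in> {0..<2}}
      {i \<cdot> e1 + \<Lambda>1 i \<cdot> e2 + \<mu>1 i \<cdot> e3 + \<nu>1 i \<cdot> e4 |i. i \<in> {0..<p}}"
| listed28: "\<alpha>4 0 0 0 0 = 0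
    \<Longrightarrow> listed_pair p e1 e2 e3 e4 e5
      {\<alpha>4 i j k l \<cdot> e1 + i \<cdot> e2 + j \<cdot> e3 + k \<cdot> e4 + l \<cdot> e5 |i j k l. i \<in> {0..<2} \<and> j \<in> {0..<2} \<and> k \<in> {0..<2} \<and> l \<in> {0..<2}}
      {i \<cdot> e1 |i. i \<in> {0..<p}}"

end

theory Submission
  imports Defs "HOL-Library.Poly_Mapping"
begin

text \<open>
  Write \<open>G = \<int>\<^sub>p \<times> V\<close> with \<open>V = \<int>\<^sub>2\<^sup>4\<close>. The set \<open>C\<close> is a perfect code exactly if every element of \<open>G\<close> is a
  sum of an element of \<open>S\<^sub>0\<close> and an element of \<open>C\<close> in exactly one way, that is, if \<open>(S\<^sub>0, C)\<close> is a
  factorization of \<open>G\<close>. The orders of the two factors multiply to \<open>16p\<close>, so one factor \<open>B\<close> has order a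
  power of two; the other one is called \<open>A\<close>.

  A factor may be replaced by its multiple \<open>kB\<close> if \<open>k\<close> is coprime to its order
  (\<open>factorization_coprime_multiple\<close>, which is Frobenius in the group ring modulo a prime). An odd \<open>k\<close>
  acts on \<open>G\<close> as \<open>(x, v) \<mapsto> (kx, v)\<close>, and \<open>k\<close> can be any residue modulo \<open>p\<close>, including zero. All these
  factorizations together say that \<open>B = {(F q, q) | q \<in> Q}\<close> for some \<open>Q \<subseteq> V\<close>, that every slice
  \<open>{v | (s, v) \<in> A}\<close> together with \<open>Q\<close> factorizes \<open>V\<close>, and that \<open>F\<close> extends to a function on \<open>V\<close> with
  \<open>F (a + q) = F q\<close> for \<open>q \<in> Q\<close> and \<open>a\<close> in any slice (\<open>ex_normal_form\<close>). What remains is a question about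
  subsets of a vector space of dimension four over the field with two elements.

  The order of \<open>Q\<close> is 1, 2, 4, 8 or 16. If it is 8 or 16, a slice has at most two elements, and all
  slices lie in the group \<open>M\<close> of periods of \<open>F\<close>. If \<open>A\<close> is the generating factor, this forces \<open>M = V\<close> and
  \<open>F = 0\<close>; if \<open>B\<close> is, then \<open>F \<noteq> 0\<close> and \<open>M \<noteq> V\<close>. For order 8 the periods \<open>K\<close> of \<open>Q\<close> inside \<open>M\<close> matter as well:
  the slices are pairs whose differences lie in a single coset \<open>h + K\<close>. A basis of \<open>V\<close> adapted to the
  chain \<open>K \<subseteq> \<langle>h\<rangle> + K \<subseteq> M \<subseteq> V\<close> puts the factorization into the form of a listed pair, and the
  dimensions of \<open>K\<close> and \<open>M\<close> tell which one. If \<open>Q\<close> has at most four elements, \<open>B\<close> cannot generate \<open>G\<close>,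
  because three elements span a proper subgroup of \<open>V\<close>; so \<open>A\<close> generates, and the fibres of \<open>F\<close> on \<open>Q\<close> are
  examined one by one.

  Conversely, for a listed pair the coefficients of a sum can be recovered from its coordinates
  one after the other in a suitable order, and the numbers of indices multiply to the order of \<open>G\<close>,
  so the pair is a factorization (\<open>factorization_if_listed_pair\<close>). This helps in the other direction
  too: two factorizations of which one is contained in the other are equal, so a factorization is
  already listed if it contains a listed pair (\<open>listed_pair_if_contains\<close>).
\<close>

section \<open>Factorizations and perfect codes\<close>

definition factorization :: "'a::ab_group_add set \<Rightarrow> 'a set \<Rightarrow> bool" where
  "factorization A B \<longleftrightarrow> bij_betw (\<lambda>(a, b). a + b) (A \<times> B) UNIV"

lemma factorization_iff:
  "factorization A B \<longleftrightarrow>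
     (\<forall>g. \<exists>a\<in>A. \<exists>b\<in>B. g = a + b) \<and>
     (\<forall>a\<in>A. \<forall>b\<in>B. \<forall>a'\<in>A. \<forall>b'\<in>B. a + b = a' + b' \<longrightarrow> a = a' \<and> b = b')"
proof -
  have "(\<lambda>(a, b). a + b) ` (A \<times> B) = UNIV \<longleftrightarrow> (\<forall>g. \<exists>a\<in>A. \<exists>b\<in>B. g = a + b)"
    by (simp add: set_eq_iff image_iff)
  moreover have "inj_on (\<lambda>(a, b). a + b) (A \<times> B) \<longleftrightarrow>
      (\<forall>a\<in>A. \<forall>b\<in>B. \<forall>a'\<in>A. \<forall>b'\<in>B. a + b = a' + b' \<longrightarrow> a = a' \<and> b = b')"
    unfolding inj_on_def by auto
  ultimately show ?thesis
    unfolding factorization_def bij_betw_def by blast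
qed

lemma factorization_commute: "factorization A B \<longleftrightarrow> factorization B A"
proof -
  have "factorization B A" if "factorization A B" for A B :: "'a set"
    using that unfolding factorization_iff by (metis add.commute)
  then show ?thesis by blast
qed

lemma factorization_uniqueD:
  assumes "factorization A B" "a \<in> A" "b \<in> B" "a' \<in> A" "b' \<in> B" "a + b = a' + b'"
  shows "a = a'" "b = b'"
  using assms unfolding factorization_iff by blast+

lemma factorization_coverE:
  assumes "factorization A B"
  obtains a b where "a \<in> A" "b \<in> B" "g = a + b"
  using assms unfolding factorization_iff by blast

lemma factorization_card:
  fixes A B :: "'a::{finite,ab_group_add} set"
  assumes "factorization A B"
  shows "card A * card B = CARD('a)"
  using bij_betw_same_card[OF assms[unfolded factorization_def]] by (simp add: card_cartesian_product)

text \<open>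
  In a finite group a surjective sum map between sets of equal size is injective, so existence of
  the representations suffices.
\<close>

lemma factorizationI_cover:
  fixes A B :: "'a::{finite,ab_group_add} set"
  assumes "card A * card B \<le> CARD('a)" and "\<And>g. \<exists>a\<in>A. \<exists>b\<in>B. g = a + b"
  shows "factorization A B"
proof -
  let ?f = "\<lambda>(a, b). a + b :: 'a"
  have im: "?f ` (A \<times> B) = UNIV"
    using assms(2) by (force simp: image_iff)
  have "card (A \<times> B) \<le> card (?f ` (A \<times> B))"
    using assms(1) by (simp add: im card_cartesian_product)
  then have "inj_on ?f (A \<times> B)"
    by (intro eq_card_imp_inj_on antisym card_image_le) simp_all
  with im show ?thesis
    by (simp add: factorization_def bij_betw_def)
qed

text \<open>
  The orders of the factors have the same product in both pairs, so neither inclusion can be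
  proper.
\<close>

lemma factorization_eq_if_subset:
  fixes A B X Y :: "'a::{finite,ab_group_add} set"
  assumes "factorization X Y" "factorization A B" "X \<subseteq> A" "Y \<subseteq> B"
  shows "X = A" "Y = B"
proof -
  have c: "card X * card Y = card A * card B"
    using assms factorization_card by metis
  have ne: "card A > 0" "card B > 0"
    using factorization_card[OF assms(2)] by (auto intro: Nat.gr0I)
  have le: "card X \<le> card A" "card Y \<le> card B"
    using assms by (auto intro: card_mono)
  have "card X = card A"
  proof (rule ccontr)
    assume "card X \<noteq> card A"
    then have "card X * card Y < card A * card B"
      using le ne
      by (metis c le_neq_implies_less less_eq_nat.simps(1) mult.commute mult_le_mono2 mult_less_mono1 order.strict_trans1)
    then show False using c by simp
  qed
  moreover from this have "card Y = card B" using c ne by (metis mult_left_cancel not_less0)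
  ultimately show "X = A" "Y = B"
    using assms by (simp_all add: card_subset_eq)
qed

text \<open>
  The closed out-neighbourhood of \<open>c\<close> is the translate \<open>S\<^sub>0 + c\<close>; disjointness of the translates is
  uniqueness of the representation, and covering is existence.
\<close>

lemma perfect_code_iff_factorization:
  "perfect_code (cayley_digraph S) C \<longleftrightarrow> factorization (insert 0 S) C"
proof -
  let ?D = "cayley_digraph S"
  have nb: "v \<in> closed_out_nbhd ?D c \<longleftrightarrow> v - c \<in> insert 0 S" for v c
    by (auto simp: closed_out_nbhd_def cayley_digraph_def arcs_ends_def arc_to_ends_def)
  have V: "verts ?D = UNIV"
    by (simp add: cayley_digraph_def)
  have "(\<Union>c\<in>C. closed_out_nbhd ?D c) = UNIV \<longleftrightarrow> (\<forall>g. \<exists>a\<in>insert 0 S. \<exists>b\<in>C. g = a + b)"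
    unfolding set_eq_iff UN_iff nb by (metis UNIV_I diff_add_cancel add_diff_cancel_right')
  moreover have "disjoint_family_on (closed_out_nbhd ?D) C \<longleftrightarrow>
    (\<forall>a\<in>insert 0 S. \<forall>b\<in>C. \<forall>a'\<in>insert 0 S. \<forall>b'\<in>C. a + b = a' + b' \<longrightarrow> a = a' \<and> b = b')" (is "?l \<longleftrightarrow> ?r")
  proof
    assume l: ?l
    show ?r
    proof (intro ballI impI)
      fix a b a' b' assume *: "a \<in> insert 0 S" "b \<in> C" "a' \<in> insert 0 S" "b' \<in> C" "a + b = a' + b'"
      then have "a + b \<in> closed_out_nbhd ?D b" "a + b \<in> closed_out_nbhd ?D b'"
        unfolding nb by (metis add_diff_cancel_right')+
      with l * have "b = b'" unfolding disjoint_family_on_def by blast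
      with * show "a = a' \<and> b = b'" by simp
    qed
  next
    assume r: ?r
    show ?l unfolding disjoint_family_on_def
    proof (intro ballI impI)
      fix b b' assume *: "b \<in> C" "b' \<in> C" "b \<noteq> b'"
      show "closed_out_nbhd ?D b \<inter> closed_out_nbhd ?D b' = {}"
      proof (rule ccontr)
        assume "closed_out_nbhd ?D b \<inter> closed_out_nbhd ?D b' \<noteq> {}"
        then obtain v where "v \<in> closed_out_nbhd ?D b" "v \<in> closed_out_nbhd ?D b'"
          by blast
        then have "v - b \<in> insert 0 S" "v - b' \<in> insert 0 S"
          unfolding nb .
        then show False using r * by (metis diff_add_cancel)
      qed
    qed
  qed
  ultimately show ?thesis
    unfolding perfect_code_def factorization_iff V by auto
qed

section \<open>Replacing a factor by a multiple\<close>

lemma zmult_0 [simp]: "0 \<cdot> x = 0"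
  by (simp add: zmult_def)

lemma zmult_Suc [simp]: "int (Suc n) \<cdot> x = x + int n \<cdot> x"
  by (simp add: zmult_def del: of_nat_Suc)

lemma zmult_neg: "- int n \<cdot> x = - (int n \<cdot> x)"
  by (cases n) (simp_all add: zmult_def del: of_nat_Suc)

lemma zmult_1 [simp]: "1 \<cdot> x = x"
  using zmult_Suc[of 0 x] by simp

lemma zmult_nat_mult: "int (m * n) \<cdot> x = int m \<cdot> (int n \<cdot> x)"
proof -
  have add: "int (a + b) \<cdot> x = int a \<cdot> x + int b \<cdot> x" for a b
    by (induction a) (simp_all add: add.assoc del: of_nat_Suc of_nat_add)
  show ?thesis
    by (induction m) (simp_all add: add del: of_nat_Suc of_nat_add of_nat_mult)
qed

lemma dvd_freshmans_dream:
  fixes x y :: "'a::comm_ring_1"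
  assumes "prime q"
  shows "of_nat q dvd (x + y) ^ q - (x ^ q + y ^ q)"
proof -
  have q: "0 < q" using assms prime_gt_0_nat by blast
  have "(x + y) ^ q = (\<Sum>k\<le>q. of_nat (q choose k) * x ^ k * y ^ (q - k))"
    by (rule binomial_ring)
  also have "{..q} = insert 0 (insert q {0<..<q})"
    using q by auto
  also have "(\<Sum>k\<in>\<dots>. of_nat (q choose k) * x ^ k * y ^ (q - k)) =
     y ^ q + (x ^ q + (\<Sum>k\<in>{0<..<q}. of_nat (q choose k) * x ^ k * y ^ (q - k)))"
    using q by (subst sum.insert) auto
  finally have "(x + y) ^ q - (x ^ q + y ^ q) =
      (\<Sum>k\<in>{0<..<q}. of_nat (q choose k) * x ^ k * y ^ (q - k))"
    by simp
  also have "of_nat q dvd \<dots>"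
  proof (rule dvd_sum)
    fix k assume k: "k \<in> {0<..<q}"
    then have "q dvd (q choose k)"
      using assms by (intro dvd_choose_prime) auto
    then have "(of_nat q :: 'a) dvd of_nat (q choose k)"
      by (metis dvd_def of_nat_mult)
    then show "of_nat q dvd of_nat (q choose k) * x ^ k * y ^ (q - k)"
      by (simp add: mult.assoc)
  qed
  finally show ?thesis .
qed

lemma dvd_freshmans_dream_sum:
  fixes f :: "'b \<Rightarrow> 'a::comm_ring_1"
  assumes "prime q" "finite B"
  shows "of_nat q dvd (\<Sum>b\<in>B. f b) ^ q - (\<Sum>b\<in>B. f b ^ q)"
  using assms(2)
proof (induction B rule: finite_induct)
  case empty
  then show ?case using prime_gt_0_nat[OF assms(1)] by (simp add: zero_power)
next
  case (insert b B)
  have "of_nat q dvd ((f b + sum f B) ^ q - (f b ^ q + sum f B ^ q)) + (sum f B ^ q - (\<Sum>b\<in>B. f b ^ q))"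
    using dvd_freshmans_dream[OF assms(1)] insert.IH by (rule dvd_add)
  then show ?case
    using insert.hyps by (simp add: algebra_simps)
qed

text \<open>
  Sets are viewed as elements of the integral group ring, where \<open>A B\<close> is the sum \<open>T\<close> of all group
  elements, and hence \<open>A B\<^sup>q = |B|\<^bsup>q-1\<^esup> T\<close>. Modulo the prime \<open>q\<close> the power \<open>B\<^sup>q\<close> is congruent to the sum
  of the elements \<open>q b\<close>. The coefficients of \<open>A \<cdot> (q B)\<close> are therefore congruent to \<open>|B|\<^bsup>q-1\<^esup>\<close>, which is
  not divisible by \<open>q\<close>; so none of them vanishes, that is, \<open>A + q B\<close> covers the group.
\<close>

lemma factorization_prime_multiple:
  fixes A B :: "'a::{finite,ab_group_add} set"
  assumes fac: "factorization A B" and q: "prime q" "\<not> q dvd card B"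
  shows "factorization A ((\<lambda>b. int q \<cdot> b) ` B)"
proof (rule factorizationI_cover)
  show "card A * card ((\<lambda>b. int q \<cdot> b) ` B) \<le> CARD('a)"
    using factorization_card[OF fac] by (metis card_image_le finite mult_le_mono2)
next
  fix g :: 'a
  let ?x = "\<lambda>a :: 'a. Poly_Mapping.single a (1::int)"
  let ?S = "\<lambda>A. \<Sum>a\<in>A. ?x a"
  let ?T = "?S (UNIV :: 'a set)"
  have pow: "?x b ^ n = ?x (int n \<cdot> b)" for b n
    by (induction n) (simp_all add: mult_single del: of_nat_Suc flip: single_one)
  have AB: "?S A * ?S B = ?T"
  proof -
    have "?S A * ?S B = (\<Sum>(a, b)\<in>A \<times> B. ?x (a + b))"
      by (simp add: sum_product sum.cartesian_product mult_single)
    also have "\<dots> = (\<Sum>z\<in>A \<times> B. ?x ((\<lambda>(a, b). a + b) z))"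
      by (simp add: case_prod_unfold)
    also have "\<dots> = ?T"
      using fac unfolding factorization_def by (rule sum.reindex_bij_betw)
    finally show ?thesis .
  qed
  \<comment> \<open>Multiplication by a group element permutes the summands of \<open>T\<close>.\<close>
  have Tx: "?T * ?x b = ?T" for b
  proof -
    have "?T * ?x b = (\<Sum>a\<in>UNIV. ?x (a + b))"
      by (simp add: sum_distrib_right mult_single)
    also have "\<dots> = ?T"
      by (rule sum.reindex_bij_witness[of _ "\<lambda>a. a - b" "\<lambda>a. a + b"]) auto
    finally show ?thesis .
  qed
  have TB: "?T * ?S B = of_nat (card B) * ?T"
    by (simp add: sum_distrib_left Tx)
  have ABn: "?S A * ?S B ^ Suc n = of_nat (card B ^ n) * ?T" for n
  proof (induction n)
    case (Suc n)
    have "?S A * ?S B ^ Suc (Suc n) = (?S A * ?S B ^ Suc n) * ?S B"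
      by (simp add: mult_ac)
    also have "\<dots> = of_nat (card B ^ n) * (?T * ?S B)"
      by (simp only: Suc mult.assoc)
    also have "\<dots> = of_nat (card B ^ n) * (of_nat (card B) * ?T)"
      by (simp only: TB)
    finally show ?case by (simp only: power_Suc of_nat_mult mult_ac)
  qed (simp add: AB)
  obtain n where n: "q = Suc n"
    using prime_gt_0_nat[OF q(1)] gr0_implies_Suc by blast
  have "of_nat q dvd ?S A * (?S B ^ q - (\<Sum>b\<in>B. ?x b ^ q))"
    by (intro dvd_mult dvd_freshmans_dream_sum q) simp
  then obtain D where D: "?S A * (?S B ^ q - (\<Sum>b\<in>B. ?x b ^ q)) = of_nat q * D"
    by (elim dvdE)
  have "of_nat (card B ^ n) * ?T - (\<Sum>a\<in>A. \<Sum>b\<in>B. ?x (a + int q \<cdot> b)) = of_nat q * D"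
    using D unfolding right_diff_distrib ABn[of n, folded n] pow
    by (simp add: sum_product mult_single)
  then have *: "Poly_Mapping.lookup (of_nat (card B ^ n) * ?T - (\<Sum>a\<in>A. \<Sum>b\<in>B. ?x (a + int q \<cdot> b))) g =
      Poly_Mapping.lookup (of_nat q * D) g"
    by simp
  have sc: "Poly_Mapping.lookup (of_nat m * P) g = int m * Poly_Mapping.lookup P g" for m and P :: "'a \<Rightarrow>\<^sub>0 int"
    by (induction m) (simp_all add: lookup_add algebra_simps)
  have T1: "Poly_Mapping.lookup ?T g = 1"
    by (simp add: lookup_sum lookup_single when_def)
  show "\<exists>a\<in>A. \<exists>b\<in>(\<lambda>b. int q \<cdot> b) ` B. g = a + b"
  proof (rule ccontr)
    assume "\<not> ?thesis"
    then have "Poly_Mapping.lookup (\<Sum>a\<in>A. \<Sum>b\<in>B. ?x (a + int q \<cdot> b)) g = 0"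
      by (auto simp: lookup_sum lookup_single when_def intro!: sum.neutral)
    then have "int (card B ^ n) = int q * Poly_Mapping.lookup D g"
      using * by (simp only: lookup_minus sc T1 mult_1_right diff_0_right)
    then have "q dvd card B ^ n"
      by (metis dvd_triv_left int_dvd_int_iff)
    then show False
      using q prime_dvd_power_nat by blast
  qed
qed

text \<open>
  Induction over the prime factors of \<open>k\<close>: a multiple that is again a factor has the same order as
  \<open>B\<close>, so the next prime is still coprime to it.
\<close>

lemma factorization_coprime_multiple:
  fixes A B :: "'a::{finite,ab_group_add} set"
  assumes "factorization A B" "coprime k (card B)" "k > 0"
  shows "factorization A ((\<lambda>b. int k \<cdot> b) ` B)"
  using assms
proof (induction k arbitrary: B rule: prime_divisors_induct)
  case (unit k)
  then show ?case by simp
next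
  case (factor q k)
  have c: "coprime k (card B)" "\<not> q dvd card B" "k > 0"
    using factor.prems factor.hyps by (auto dest: coprime_common_divisor not_prime_unit)
  let ?B = "(\<lambda>b. int k \<cdot> b) ` B"
  have f: "factorization A ?B"
    using factor.IH factor.prems c by blast
  have "card A \<noteq> 0"
    using factorization_card[OF f] by (metis finite finite_UNIV_card_ge_0 mult_0 not_less0)
  then have "card ?B = card B"
    using factorization_card[OF f] factorization_card[OF factor.prems(1)] by (metis mult_left_cancel)
  then have "factorization A ((\<lambda>b. int q \<cdot> b) ` ?B)"
    using factorization_prime_multiple[OF f] factor.hyps c by simp
  then show ?case
    by (simp add: image_image zmult_nat_mult del: of_nat_mult)
qed simp

section \<open>Coordinates on \<open>\<int>\<^sub>2\<^sup>4\<close>\<close>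

text \<open>
  Addition of bits is to be handled by the group laws and not to be unfolded into a Boolean
  operation.
\<close>

declare add_bit_eq_xor [simp del] mult_bit_eq_and [simp del]

type_synonym bit4 = "bit \<times> bit \<times> bit \<times> bit"

lemma bit_add_self [simp]: "(b :: bit) + b = 0"
  by (cases b) (simp_all add: add_bit_eq_xor)

lemma bit4_add_self [simp]: "(x :: bit4) + x = 0"
  by (cases x) (simp add: zero_prod_def)

lemma bit4_add_left_self [simp]: "(x :: bit4) + (x + y) = y"
  by (simp flip: add.assoc)

lemma bit4_minus [simp]: "- x = (x :: bit4)"
  by (rule minus_unique) simp

lemma bit4_diff [simp]: "x - y = x + (y :: bit4)"
  using add_uminus_conv_diff[of x y] by simp

lemma bit4_add_eq_0_iff: "x + y = 0 \<longleftrightarrow> x = (y :: bit4)"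
  by (metis add_eq_0_iff bit4_minus)

lemma card_bit [simp]: "CARD(bit) = 2"
proof -
  have *: "(UNIV :: bit set) = {0, 1}" by auto
  show ?thesis unfolding * by simp
qed

lemma CARD_bit4 [simp]: "CARD(bit4) = 16"
  by simp

definition bscale :: "bit \<Rightarrow> 'v::ab_group_add \<Rightarrow> 'v" (infixr \<open>\<odot>\<close> 75) where
  "b \<odot> v = (if b = 0 then 0 else v)"

lemma bscale_simps [simp]: "0 \<odot> v = 0" "1 \<odot> v = v" "b \<odot> 0 = 0"
  by (simp_all add: bscale_def)

lemma bscale_add_left: "(a + b) \<odot> (v :: bit4) = a \<odot> v + b \<odot> v"
  by (cases a; cases b) simp_all

lemma zmult_hom:
  assumes "\<And>x y. h (x + y) = h x + h y"
  shows "h (n \<cdot> x) = n \<cdot> h x"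
proof -
  have h0: "h 0 = 0" using assms[of 0 0] by simp
  have hm: "h (- x) = - h x" for x using assms[of x "- x"] h0 by (simp add: eq_neg_iff_add_eq_0 add.commute)
  have nat: "h (int m \<cdot> x) = int m \<cdot> h x" for m
    by (induction m) (simp_all add: h0 assms del: of_nat_Suc)
  show ?thesis
    by (cases n rule: int_cases2) (simp_all add: nat zmult_neg hm)
qed

lemma zmult_Pair [simp]: "n \<cdot> (x, y) = (n \<cdot> x, n \<cdot> y)"
  using zmult_hom[of fst n "(x, y)"] zmult_hom[of snd n "(x, y)"]
  by (simp add: prod_eq_iff)

lemma zmult_zero [simp]: "n \<cdot> 0 = 0"
  using zmult_hom[of "\<lambda>_. 0" n 0] by simp

lemma zmult_ring: "n \<cdot> (x :: 'a::ring_1) = of_int n * x"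
proof -
  have nat: "int m \<cdot> x = of_nat m * x" for m
    by (induction m) (simp_all add: algebra_simps del: of_nat_Suc, simp add: algebra_simps)
  show ?thesis
    by (cases n rule: int_cases2) (simp_all add: nat zmult_neg)
qed

text \<open>
  On a group of exponent two an integer acts through its parity.
\<close>

lemma zmult_bit4: "n \<cdot> (v :: bit4) = of_int n \<odot> v"
proof -
  have "of_int n * b = of_int n \<odot> b" for b :: bit
    by (cases "of_int n :: bit") simp_all
  then show ?thesis
    by (cases v) (simp add: zmult_ring bscale_def zero_prod_def)
qed

definition lin :: "bit4 \<Rightarrow> bit4 \<Rightarrow> bit4 \<Rightarrow> bit4 \<Rightarrow> bit4 \<Rightarrow> bit4" where
  "lin v2 v3 v4 v5 = (\<lambda>(a, b, c, d). a \<odot> v2 + b \<odot> v3 + c \<odot> v4 + d \<odot> v5)"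

text \<open>
  Surjectivity is enough: \<open>lin\<close> maps a finite set to itself.
\<close>

definition basis :: "bit4 \<Rightarrow> bit4 \<Rightarrow> bit4 \<Rightarrow> bit4 \<Rightarrow> bool" where
  "basis v2 v3 v4 v5 \<longleftrightarrow> surj (lin v2 v3 v4 v5)"

lemma basis_inj: "basis v2 v3 v4 v5 \<Longrightarrow> lin v2 v3 v4 v5 x = lin v2 v3 v4 v5 y \<longleftrightarrow> x = y"
  unfolding basis_def by (metis finite finite_UNIV_surj_inj inj_eq)

lemma lin_add: "lin v2 v3 v4 v5 x + lin v2 v3 v4 v5 y = lin v2 v3 v4 v5 (x + y)"
  by (cases x; cases y) (simp add: lin_def bscale_add_left add_ac)

lemma bscale_eq_lin:
  "a \<odot> v2 = lin v2 v3 v4 v5 (a, 0, 0, 0)"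
  "a \<odot> v3 = lin v2 v3 v4 v5 (0, a, 0, 0)"
  "a \<odot> v4 = lin v2 v3 v4 v5 (0, 0, a, 0)"
  "a \<odot> v5 = lin v2 v3 v4 v5 (0, 0, 0, a)"
  "0 = lin v2 v3 v4 v5 (0, 0, 0, 0)"
  by (simp_all add: lin_def)

text \<open>
  Both sides compare the set generated by the vectors with the range of \<open>lin\<close>. An element of a
  generating set lies in the group it generates, which forces the first components to vanish.
\<close>

lemma group_closure_basis:
  fixes e2 e3 e4 e5 :: "'a::ab_group_add \<times> bit4"
  shows "group_closure {e2, e3, e4, e5} = {0} \<times> UNIV \<longleftrightarrow>
    (\<exists>v2 v3 v4 v5. e2 = (0, v2) \<and> e3 = (0, v3) \<and> e4 = (0, v4) \<and> e5 = (0, v5) \<and> basis v2 v3 v4 v5)"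
proof -
  have sub: "group_closure {(0, v2), (0, v3), (0, v4), (0, v5)} = range (\<lambda>t. (0 :: 'a, lin v2 v3 v4 v5 t))"
    (is "?L = ?R") for v2 v3 v4 v5
  proof
    show "?L \<subseteq> ?R"
    proof
      fix x assume "x \<in> ?L"
      then show "x \<in> ?R"
      proof induction
        case (base s)
        have r: "(0, lin v2 v3 v4 v5 t) \<in> ?R" for t by blast
        have "(0, 0) \<in> ?R" "(0, v2) \<in> ?R" "(0, v3) \<in> ?R" "(0, v4) \<in> ?R" "(0, v5) \<in> ?R"
          using r[of "(0, 0, 0, 0)"] r[of "(1, 0, 0, 0)"] r[of "(0, 1, 0, 0)"] r[of "(0, 0, 1, 0)"] r[of "(0, 0, 0, 1)"]
          by (simp_all add: lin_def)
        with base show ?case unfolding zero_prod_def[where 'a = 'a and 'b = bit4] by blast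
      next
        case (diff s t)
        then obtain x y where "s = (0, lin v2 v3 v4 v5 x)" "t = (0, lin v2 v3 v4 v5 y)" by blast
        then have "s - t = (0, lin v2 v3 v4 v5 (x + y))" by (simp add: lin_add)
        then show ?case by blast
      qed
    qed
    show "?R \<subseteq> ?L"
    proof
      fix x assume "x \<in> ?R"
      then obtain a b c d where x: "x = (0, lin v2 v3 v4 v5 (a, b, c, d))" by auto
      have g: "(0, a \<odot> w) \<in> ?L" if "(0, w) \<in> {(0, v2), (0, v3), (0, v4), (0, v5)}" for a w
      proof (cases "a = 0")
        case True
        then show ?thesis using zero_in_group_closure by (simp flip: zero_prod_def)
      next
        case False
        then show ?thesis using that by (intro group_closure.base) (simp add: bscale_def)
      qed
      have "x = (0, a \<odot> v2) + (0, b \<odot> v3) + (0, c \<odot> v4) + (0, d \<odot> v5)"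
        by (simp add: x lin_def)
      also have "\<dots> \<in> ?L"
        by (intro group_closure_add g) auto
      finally show "x \<in> ?L" .
    qed
  qed
  have R: "range (\<lambda>t. (0 :: 'a, lin v2 v3 v4 v5 t)) = {0} \<times> UNIV \<longleftrightarrow> basis v2 v3 v4 v5" for v2 v3 v4 v5
  proof -
    have "range (\<lambda>t. (0 :: 'a, lin v2 v3 v4 v5 t)) = {0} \<times> range (lin v2 v3 v4 v5)"
      by blast
    then show ?thesis unfolding basis_def by blast
  qed
  show ?thesis
  proof
    assume *: "group_closure {e2, e3, e4, e5} = {0} \<times> UNIV"
    have "e \<in> {0} \<times> UNIV" if "e \<in> {e2, e3, e4, e5}" for e
      using that unfolding *[symmetric] by (intro group_closure.base) auto
    then have "\<exists>v. e = (0, v)" if "e \<in> {e2, e3, e4, e5}" for e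
      using that by blast
    then obtain v2 v3 v4 v5 where e: "e2 = (0, v2)" "e3 = (0, v3)" "e4 = (0, v4)" "e5 = (0, v5)"
      by (metis insertCI)
    show "\<exists>v2 v3 v4 v5. e2 = (0, v2) \<and> e3 = (0, v3) \<and> e4 = (0, v4) \<and> e5 = (0, v5) \<and> basis v2 v3 v4 v5"
      using * e unfolding e sub R by blast
  qed (metis sub R)
qed

lemma of_int_bit_eq_iff:
  assumes "0 \<le> i" "i < 2" "0 \<le> j" "j < 2"
  shows "(of_int i :: bit) = of_int j \<longleftrightarrow> i = j"
proof -
  have "i = 0 \<or> i = 1" "j = 0 \<or> j = 1" using assms by auto
  then show ?thesis by auto
qed

lemma of_int_mod_ring_eq_iff:
  assumes "0 \<le> i" "i < int CARD('p)" "0 \<le> j" "j < int CARD('p)"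
  shows "(of_int i :: 'p::prime_card mod_ring) = of_int j \<longleftrightarrow> i = j"
  using assms by (metis of_int_of_int_mod_ring to_int_mod_ring_of_int_mod_ring)

section \<open>Every listed pair is a factorization\<close>

text \<open>
  For sets given by a parametrization it suffices that a sum determines the parameters, if there
  are as many parameters as group elements: the sum map is then injective, hence onto. The four
  lemmas that follow are the instances for the shapes of set comprehension that occur in the list,
  where the indices are split between the two factors.
\<close>

lemma factorizationI_param:
  fixes f :: "'i \<Rightarrow> 'a::{finite,ab_group_add}"
  assumes "finite I" "finite J" "card I * card J = CARD('a)"
    and "\<And>i j i' j'. \<lbrakk>i \<in> I; j \<in> J; i' \<in> I; j' \<in> J; f i + g j = f i' + g j'\<rbrakk> \<Longrightarrow> i = i' \<and> j = j'"
  shows "factorization (f ` I) (g ` J)"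
proof -
  let ?h = "\<lambda>(i, j). f i + g j"
  have "inj_on ?h (I \<times> J)"
    using assms(4) by (auto simp: inj_on_def)
  then have "card (?h ` (I \<times> J)) = CARD('a)"
    by (simp add: card_image card_cartesian_product assms)
  then have "?h ` (I \<times> J) = UNIV"
    by (simp add: card_eq_UNIV_imp_eq_UNIV)
  then have cov: "\<exists>a\<in>f ` I. \<exists>b\<in>g ` J. x = a + b" for x
    by (force simp: set_eq_iff image_iff)
  have "card (f ` I) * card (g ` J) \<le> CARD('a)"
    unfolding assms(3)[symmetric] by (intro mult_le_mono card_image_le assms)
  then show ?thesis
    using cov by (rule factorizationI_cover)
qed

lemma factorizationI_1_4:
  fixes f :: "'i \<Rightarrow> 'a::{finite,ab_group_add}"
  assumes fin: "finite I1" "finite J1" "finite J2" "finite J3" "finite J4"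
    and card: "card I1 * (card J1 * (card J2 * (card J3 * card J4))) = CARD('a)"
    and inj: "\<And>i j k l m i' j' k' l' m'.
      \<lbrakk>i \<in> I1; j \<in> J1; k \<in> J2; l \<in> J3; m \<in> J4; i' \<in> I1; j' \<in> J1; k' \<in> J2; l' \<in> J3; m' \<in> J4;
       f i + g j k l m = f i' + g j' k' l' m'\<rbrakk> \<Longrightarrow> i = i' \<and> j = j' \<and> k = k' \<and> l = l' \<and> m = m'"
  shows "factorization {f i |i. i \<in> I1} {g j k l m |j k l m. j \<in> J1 \<and> k \<in> J2 \<and> l \<in> J3 \<and> m \<in> J4}"
proof -
  have "factorization (f ` I1) ((\<lambda>(j, k, l, m). g j k l m) ` (J1 \<times> J2 \<times> J3 \<times> J4))"
  proof (rule factorizationI_param)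
    fix i j i' j'
    assume "i \<in> I1" "j \<in> J1 \<times> J2 \<times> J3 \<times> J4" "i' \<in> I1" "j' \<in> J1 \<times> J2 \<times> J3 \<times> J4"
      "f i + (case j of (j, k, l, m) \<Rightarrow> g j k l m) = f i' + (case j' of (j, k, l, m) \<Rightarrow> g j k l m)"
    then show "i = i' \<and> j = j'"
      by (cases j; cases j') (use inj in \<open>simp, blast\<close>)
  qed (simp_all add: fin card card_cartesian_product)
  also have "f ` I1 = {f i |i. i \<in> I1}" by blast
  also have "(\<lambda>(j, k, l, m). g j k l m) ` (J1 \<times> J2 \<times> J3 \<times> J4) =
      {g j k l m |j k l m. j \<in> J1 \<and> k \<in> J2 \<and> l \<in> J3 \<and> m \<in> J4}"
    by (simp add: set_eq_iff image_iff) blast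
  finally show ?thesis .
qed

lemma factorizationI_2_3:
  fixes f :: "'i \<Rightarrow> 'j \<Rightarrow> 'a::{finite,ab_group_add}"
  assumes fin: "finite I1" "finite I2" "finite J1" "finite J2" "finite J3"
    and card: "card I1 * card I2 * (card J1 * (card J2 * card J3)) = CARD('a)"
    and inj: "\<And>i j k l m i' j' k' l' m'.
      \<lbrakk>i \<in> I1; j \<in> I2; k \<in> J1; l \<in> J2; m \<in> J3; i' \<in> I1; j' \<in> I2; k' \<in> J1; l' \<in> J2; m' \<in> J3;
       f i j + g k l m = f i' j' + g k' l' m'\<rbrakk> \<Longrightarrow> i = i' \<and> j = j' \<and> k = k' \<and> l = l' \<and> m = m'"
  shows "factorization {f i j |i j. i \<in> I1 \<and> j \<in> I2} {g k l m |k l m. k \<in> J1 \<and> l \<in> J2 \<and> m \<in> J3}"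
proof -
  have "factorization ((\<lambda>(i, j). f i j) ` (I1 \<times> I2)) ((\<lambda>(k, l, m). g k l m) ` (J1 \<times> J2 \<times> J3))"
  proof (rule factorizationI_param)
    fix i j i' j'
    assume "i \<in> I1 \<times> I2" "j \<in> J1 \<times> J2 \<times> J3" "i' \<in> I1 \<times> I2" "j' \<in> J1 \<times> J2 \<times> J3"
      "(case i of (i, j) \<Rightarrow> f i j) + (case j of (k, l, m) \<Rightarrow> g k l m) =
       (case i' of (i, j) \<Rightarrow> f i j) + (case j' of (k, l, m) \<Rightarrow> g k l m)"
    then show "i = i' \<and> j = j'"
      by (cases i; cases i'; cases j; cases j') (use inj in \<open>simp, blast\<close>)
  qed (simp_all add: fin card card_cartesian_product)
  also have "(\<lambda>(i, j). f i j) ` (I1 \<times> I2) = {f i j |i j. i \<in> I1 \<and> j \<in> I2}"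
    by (simp add: set_eq_iff image_iff) blast
  also have "(\<lambda>(k, l, m). g k l m) ` (J1 \<times> J2 \<times> J3) = {g k l m |k l m. k \<in> J1 \<and> l \<in> J2 \<and> m \<in> J3}"
    by (simp add: set_eq_iff image_iff) blast
  finally show ?thesis .
qed

lemma factorizationI_3_2:
  fixes f :: "'i \<Rightarrow> 'j \<Rightarrow> 'k \<Rightarrow> 'a::{finite,ab_group_add}"
  assumes fin: "finite I1" "finite I2" "finite I3" "finite J1" "finite J2"
    and card: "card I1 * (card I2 * card I3) * (card J1 * card J2) = CARD('a)"
    and inj: "\<And>i j k l m i' j' k' l' m'.
      \<lbrakk>i \<in> I1; j \<in> I2; k \<in> I3; l \<in> J1; m \<in> J2; i' \<in> I1; j' \<in> I2; k' \<in> I3; l' \<in> J1; m' \<in> J2;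
       f i j k + g l m = f i' j' k' + g l' m'\<rbrakk> \<Longrightarrow> i = i' \<and> j = j' \<and> k = k' \<and> l = l' \<and> m = m'"
  shows "factorization {f i j k |i j k. i \<in> I1 \<and> j \<in> I2 \<and> k \<in> I3} {g l m |l m. l \<in> J1 \<and> m \<in> J2}"
proof (subst factorization_commute, rule factorizationI_2_3)
  fix l m i j k l' m' i' j' k'
  assume "l \<in> J1" "m \<in> J2" "i \<in> I1" "j \<in> I2" "k \<in> I3" "l' \<in> J1" "m' \<in> J2" "i' \<in> I1" "j' \<in> I2" "k' \<in> I3"
    "g l m + f i j k = g l' m' + f i' j' k'"
  then show "l = l' \<and> m = m' \<and> i = i' \<and> j = j' \<and> k = k'"
    using inj[of i j k l m i' j' k' l' m'] by (simp add: add.commute)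
qed (use fin card in \<open>simp_all add: mult_ac\<close>)

lemma factorizationI_4_1:
  fixes f :: "'i \<Rightarrow> 'j \<Rightarrow> 'k \<Rightarrow> 'l \<Rightarrow> 'a::{finite,ab_group_add}"
  assumes fin: "finite I1" "finite I2" "finite I3" "finite I4" "finite J1"
    and card: "card I1 * (card I2 * (card I3 * card I4)) * card J1 = CARD('a)"
    and inj: "\<And>i j k l m i' j' k' l' m'.
      \<lbrakk>i \<in> I1; j \<in> I2; k \<in> I3; l \<in> I4; m \<in> J1; i' \<in> I1; j' \<in> I2; k' \<in> I3; l' \<in> I4; m' \<in> J1;
       f i j k l + g m = f i' j' k' l' + g m'\<rbrakk> \<Longrightarrow> i = i' \<and> j = j' \<and> k = k' \<and> l = l' \<and> m = m'"
  shows "factorization {f i j k l |i j k l. i \<in> I1 \<and> j \<in> I2 \<and> k \<in> I3 \<and> l \<in> I4} {g m |m. m \<in> J1}"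
proof (subst factorization_commute, rule factorizationI_1_4)
  fix m i j k l m' i' j' k' l'
  assume "m \<in> J1" "i \<in> I1" "j \<in> I2" "k \<in> I3" "l \<in> I4" "m' \<in> J1" "i' \<in> I1" "j' \<in> I2" "k' \<in> I3" "l' \<in> I4"
    "g m + f i j k l = g m' + f i' j' k' l'"
  then show "m = m' \<and> i = i' \<and> j = j' \<and> k = k' \<and> l = l'"
    using inj[of i j k l m i' j' k' l' m'] by (simp add: add.commute)
qed (use fin card in \<open>simp_all add: mult_ac\<close>)

lemma zmult_e1: "i \<cdot> (1, 0, 0, 0, 0) = (of_int i :: 'p::prime_card mod_ring, 0 :: bit4)"
  by (simp add: zmult_ring zero_prod_def)

lemma zmult_snd: "i \<cdot> (0, v) = (0 :: 'p::prime_card mod_ring, of_int i \<odot> (v :: bit4))"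
  by (simp add: zmult_bit4)

text \<open>
  In coordinates with respect to the basis, the equation \<open>s + c = s' + c'\<close> becomes five equations.
  In every listed pair they are triangular: some coordinate contains a single index without any
  parameter, and after each index that has been identified, the parameters that depend on it
  cancel in another coordinate. Simplification with \<open>of_int_bit_eq_iff\<close> and \<open>of_int_mod_ring_eq_iff\<close>
  therefore finds all indices.
\<close>

lemma factorization_if_listed_pair:
  fixes X Y :: "('p::prime_card mod_ring \<times> bit4) set"
  assumes b: "basis v2 v3 v4 v5"
    and l: "listed_pair (int CARD('p)) (1, 0, 0, 0, 0) (0, v2) (0, v3) (0, v4) (0, v5) X Y"
  shows "factorization X Y"
proof -
  note coords = zmult_e1 zmult_snd bscale_eq_lin(1)[of _ v2 v3 v4 v5] bscale_eq_lin(2)[of _ v3 v2 v4 v5]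
    bscale_eq_lin(3)[of _ v4 v2 v3 v5] bscale_eq_lin(4)[of _ v5 v2 v3 v4]
    lin_add basis_inj[OF b] of_int_bit_eq_iff of_int_mod_ring_eq_iff
  from l show ?thesis
    apply cases
    subgoal by (hypsubst, rule factorizationI_1_4) (auto simp: coords simp del: zmult_Pair)
    subgoal by (hypsubst, rule factorizationI_2_3) (auto simp: coords simp del: zmult_Pair)
    subgoal by (hypsubst, rule factorizationI_2_3) (auto simp: coords simp del: zmult_Pair)
    subgoal by (hypsubst, rule factorizationI_2_3) (auto simp: coords simp del: zmult_Pair)
    subgoal by (hypsubst, rule factorizationI_2_3) (auto simp: coords simp del: zmult_Pair)
    subgoal by (hypsubst, rule factorizationI_3_2) (auto simp: coords simp del: zmult_Pair)
    subgoal by (hypsubst, rule factorizationI_3_2) (auto simp: coords simp del: zmult_Pair)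
    subgoal by (hypsubst, rule factorizationI_3_2) (auto simp: coords simp del: zmult_Pair)
    subgoal by (hypsubst, rule factorizationI_3_2) (auto simp: coords simp del: zmult_Pair)
    subgoal by (hypsubst, rule factorizationI_3_2) (auto simp: coords simp del: zmult_Pair)
    subgoal by (hypsubst, rule factorizationI_3_2) (auto simp: coords simp del: zmult_Pair)
    subgoal by (hypsubst, rule factorizationI_3_2) (auto simp: coords simp del: zmult_Pair)
    subgoal by (hypsubst, rule factorizationI_3_2) (auto simp: coords simp del: zmult_Pair)
    subgoal by (hypsubst, rule factorizationI_3_2) (auto simp: coords simp del: zmult_Pair)
    subgoal by (hypsubst, rule factorizationI_3_2) (auto simp: coords simp del: zmult_Pair)
    subgoal by (hypsubst, rule factorizationI_3_2) (auto simp: coords simp del: zmult_Pair)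
    subgoal by (hypsubst, rule factorizationI_3_2) (auto simp: coords simp del: zmult_Pair)
    subgoal by (hypsubst, rule factorizationI_3_2) (auto simp: coords simp del: zmult_Pair)
    subgoal by (hypsubst, rule factorizationI_4_1) (auto simp: coords simp del: zmult_Pair)
    subgoal by (hypsubst, rule factorizationI_4_1) (auto simp: coords simp del: zmult_Pair)
    subgoal by (hypsubst, rule factorizationI_4_1) (auto simp: coords simp del: zmult_Pair)
    subgoal by (hypsubst, rule factorizationI_4_1) (auto simp: coords simp del: zmult_Pair)
    subgoal by (hypsubst, rule factorizationI_4_1) (auto simp: coords simp del: zmult_Pair)
    subgoal by (hypsubst, rule factorizationI_4_1) (auto simp: coords simp del: zmult_Pair)
    subgoal by (hypsubst, rule factorizationI_4_1) (auto simp: coords simp del: zmult_Pair)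
    subgoal by (hypsubst, rule factorizationI_4_1) (auto simp: coords simp del: zmult_Pair)
    subgoal by (hypsubst, rule factorizationI_4_1) (auto simp: coords simp del: zmult_Pair)
    subgoal by (hypsubst, rule factorizationI_4_1) (auto simp: coords simp del: zmult_Pair)
    done
qed

section \<open>Recognizing listed pairs\<close>

text \<open>
  The parameters of a listed pair are families of integers, but only their residues modulo 2 or \<open>p\<close>
  matter. The lemmas of this section accept families of residues on residues; the integers are
  representatives, with zero represented by zero because of the normalization of the list.
\<close>

definition int_of_bit :: "bit \<Rightarrow> int" where
  "int_of_bit b = (if b = 0 then 0 else 1)"

lemma int_of_bit_simps [simp]: "of_int (int_of_bit b) = b" "int_of_bit 0 = 0"
  by (simp_all add: int_of_bit_def)

lemma of_int_to_int_mod_ring [simp]: "of_int (to_int_mod_ring x) = (x :: 'p::prime_card mod_ring)"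
  by (simp add: of_int_of_int_mod_ring)

lemma of_int_CARD [simp]: "of_int (int CARD('p)) = (0 :: 'p::prime_card mod_ring)"
  by (simp add: of_nat_0_mod_ring_dvd)

definition int_lift :: "'p::prime_card mod_ring \<Rightarrow> bit \<Rightarrow> int" where
  "int_lift x b = (if x = 0 \<and> b = 0 then 0
     else if of_int (to_int_mod_ring x) = b then to_int_mod_ring x
     else to_int_mod_ring x + int CARD('p))"

lemma int_lift_0: "int_lift 0 0 = 0"
  by (simp add: int_lift_def)

text \<open>
  A parameter that occurs both as a multiple of the vector of order \<open>p\<close> and of a vector of order two
  stands for two independent residues, by the Chinese remainder theorem; since \<open>p\<close> is odd, adding \<open>p\<close>
  changes the parity only.
\<close>

lemma int_lift:
  fixes x :: "'p::prime_card mod_ring"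
  assumes "odd CARD('p)"
  shows "of_int (int_lift x b) = x" "of_int (int_lift x b) = b"
proof -
  show "of_int (int_lift x b) = x"
    using of_int_CARD[where 'p = 'p] by (simp add: int_lift_def del: of_int_of_nat_eq)
  have "(of_int (int CARD('p)) :: bit) = 1"
    using assms by (elim oddE) simp
  moreover have "c \<noteq> b \<Longrightarrow> c + 1 = b" for c :: bit
    by (cases b; cases c) simp_all
  ultimately show "of_int (int_lift x b) = b"
    by (auto simp: int_lift_def simp del: of_int_of_nat_eq)
qed

text \<open>
  To show that a factorization is listed, it is enough to find in \<open>A\<close> and \<open>B\<close> the elements that the
  listed pair has; that there are no others follows by counting.
\<close>

lemma listed_pair_if_contains:
  fixes A B :: "('p::prime_card mod_ring \<times> bit4) set"
  assumes "factorization A B" "basis v2 v3 v4 v5"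
    and "listed_pair (int CARD('p)) (1, 0, 0, 0, 0) (0, v2) (0, v3) (0, v4) (0, v5) X Y"
    and "X \<subseteq> A" "Y \<subseteq> B"
  shows "listed_pair (int CARD('p)) (1, 0, 0, 0, 0) (0, v2) (0, v3) (0, v4) (0, v5) A B"
proof -
  have "factorization X Y"
    using factorization_if_listed_pair assms by blast
  then have "X = A" "Y = B"
    using factorization_eq_if_subset assms by blast+
  with assms(3) show ?thesis by simp
qed

text \<open>
  Each of the following lemmas instantiates this principle for one kind of listed pair, and its
  number refers to the rule of \<open>listed_pair\<close> that it uses.
\<close>

lemma listed_pair1I:
  fixes a :: "'p::prime_card mod_ring \<Rightarrow> bit"
    and b :: "'p mod_ring \<Rightarrow> bit"
    and c :: "'p mod_ring \<Rightarrow> bit"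
    and d :: "'p mod_ring \<Rightarrow> bit"
  assumes f: "factorization A B" and b: "basis v2 v3 v4 v5"
    and z: "a 0 = 0" "b 0 = 0" "c 0 = 0" "d 0 = 0"
    and A: "\<And>i. (i, a i \<odot> v2 + b i \<odot> v3 + c i \<odot> v4 + d i \<odot> v5) \<in> A"
    and B: "\<And>i j k l. (0, i \<odot> v2 + j \<odot> v3 + k \<odot> v4 + l \<odot> v5) \<in> B"
  shows "listed_pair (int CARD('p)) (1, 0, 0, 0, 0) (0, v2) (0, v3) (0, v4) (0, v5) A B"
  by (rule listed_pair_if_contains[OF f b listed1[where
      ?\<alpha>1.0 = "\<lambda>i. int_of_bit (a (of_int i))"
      and ?\<beta>1.0 = "\<lambda>i. int_of_bit (b (of_int i))"
      and ?\<gamma>1.0 = "\<lambda>i. int_of_bit (c (of_int i))"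
      and ?\<delta>1.0 = "\<lambda>i. int_of_bit (d (of_int i))"]])
    (auto simp: z A B zmult_e1 zmult_snd simp del: zmult_Pair)

lemma listed_pair2I:
  fixes a :: "'p::prime_card mod_ring \<Rightarrow> bit"
    and b :: "'p mod_ring \<Rightarrow> bit"
    and c :: "'p mod_ring \<Rightarrow> bit"
    and l :: "bit \<Rightarrow> bit \<Rightarrow> bit \<Rightarrow> bit"
  assumes f: "factorization A B" and b: "basis v2 v3 v4 v5"
    and z: "a 0 = 0" "b 0 = 0" "c 0 = 0" "l 0 0 0 = 0"
    and A: "\<And>i j. (i, j \<odot> v2 + a i \<odot> v3 + b i \<odot> v4 + c i \<odot> v5) \<in> A"
    and B: "\<And>i j k. (0, l i j k \<odot> v2 + i \<odot> v3 + j \<odot> v4 + k \<odot> v5) \<in> B"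
  shows "listed_pair (int CARD('p)) (1, 0, 0, 0, 0) (0, v2) (0, v3) (0, v4) (0, v5) A B"
  by (rule listed_pair_if_contains[OF f b listed2[where
      ?\<alpha>1.0 = "\<lambda>i. int_of_bit (a (of_int i))"
      and ?\<beta>1.0 = "\<lambda>i. int_of_bit (b (of_int i))"
      and ?\<gamma>1.0 = "\<lambda>i. int_of_bit (c (of_int i))"
      and ?\<Lambda>3.0 = "\<lambda>i j k. int_of_bit (l (of_int i) (of_int j) (of_int k))"]])
    (auto simp: z A B zmult_e1 zmult_snd simp del: zmult_Pair)

lemma listed_pair3I:
  fixes a2 :: "'p::prime_card mod_ring \<Rightarrow> bit \<Rightarrow> bit"
    and a :: "'p mod_ring \<Rightarrow> bit"
    and b :: "'p mod_ring \<Rightarrow> bit"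
    and l :: "bit \<Rightarrow> bit \<Rightarrow> bit"
  assumes f: "factorization A B" and b: "basis v2 v3 v4 v5"
    and z: "a2 0 0 = 0" "a 0 = 0" "b 0 = 0" "l 0 0 = 0"
    and A: "\<And>i j. (i, a2 i j \<odot> v2 + j \<odot> v3 + a i \<odot> v4 + b i \<odot> v5) \<in> A"
    and B: "\<And>i j k. (0, k \<odot> v2 + l i j \<odot> v3 + i \<odot> v4 + j \<odot> v5) \<in> B"
  shows "listed_pair (int CARD('p)) (1, 0, 0, 0, 0) (0, v2) (0, v3) (0, v4) (0, v5) A B"
  by (rule listed_pair_if_contains[OF f b listed3[where
      ?\<alpha>2.0 = "\<lambda>i j. int_of_bit (a2 (of_int i) (of_int j))"
      and ?\<alpha>1.0 = "\<lambda>i. int_of_bit (a (of_int i))"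
      and ?\<beta>1.0 = "\<lambda>i. int_of_bit (b (of_int i))"
      and ?\<Lambda>2.0 = "\<lambda>i j. int_of_bit (l (of_int i) (of_int j))"]])
    (auto simp: z A B zmult_e1 zmult_snd simp del: zmult_Pair)

lemma listed_pair4I:
  fixes a2 :: "'p::prime_card mod_ring \<Rightarrow> bit \<Rightarrow> bit"
    and b2 :: "'p mod_ring \<Rightarrow> bit \<Rightarrow> bit"
    and a :: "'p mod_ring \<Rightarrow> bit"
    and l :: "bit \<Rightarrow> bit"
  assumes f: "factorization A B" and b: "basis v2 v3 v4 v5"
    and z: "a2 0 0 = 0" "b2 0 0 = 0" "a 0 = 0" "l 0 = 0"
    and A: "\<And>i j. (i, a2 i j \<odot> v2 + b2 i j \<odot> v3 + j \<odot> v4 + a i \<odot> v5) \<in> A"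
    and B: "\<And>i j k. (0, j \<odot> v2 + k \<odot> v3 + l i \<odot> v4 + i \<odot> v5) \<in> B"
  shows "listed_pair (int CARD('p)) (1, 0, 0, 0, 0) (0, v2) (0, v3) (0, v4) (0, v5) A B"
  by (rule listed_pair_if_contains[OF f b listed4[where
      ?\<alpha>2.0 = "\<lambda>i j. int_of_bit (a2 (of_int i) (of_int j))"
      and ?\<beta>2.0 = "\<lambda>i j. int_of_bit (b2 (of_int i) (of_int j))"
      and ?\<alpha>1.0 = "\<lambda>i. int_of_bit (a (of_int i))"
      and ?\<Lambda>1.0 = "\<lambda>i. int_of_bit (l (of_int i))"]])
    (auto simp: z A B zmult_e1 zmult_snd simp del: zmult_Pair)

lemma listed_pair5I:
  fixes a2 :: "'p::prime_card mod_ring \<Rightarrow> bit \<Rightarrow> bit"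
    and b2 :: "'p mod_ring \<Rightarrow> bit \<Rightarrow> bit"
    and c2 :: "'p mod_ring \<Rightarrow> bit \<Rightarrow> bit"
  assumes f: "factorization A B" and b: "basis v2 v3 v4 v5"
    and z: "a2 0 0 = 0" "b2 0 0 = 0" "c2 0 0 = 0"
    and A: "\<And>i j. (i, a2 i j \<odot> v2 + b2 i j \<odot> v3 + c2 i j \<odot> v4 + j \<odot> v5) \<in> A"
    and B: "\<And>i j k. (0, i \<odot> v2 + j \<odot> v3 + k \<odot> v4) \<in> B"
  shows "listed_pair (int CARD('p)) (1, 0, 0, 0, 0) (0, v2) (0, v3) (0, v4) (0, v5) A B"
  by (rule listed_pair_if_contains[OF f b listed5[where
      ?\<alpha>2.0 = "\<lambda>i j. int_of_bit (a2 (of_int i) (of_int j))"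
      and ?\<beta>2.0 = "\<lambda>i j. int_of_bit (b2 (of_int i) (of_int j))"
      and ?\<gamma>2.0 = "\<lambda>i j. int_of_bit (c2 (of_int i) (of_int j))"]])
    (auto simp: z A B zmult_e1 zmult_snd simp del: zmult_Pair)

lemma listed_pair7I:
  fixes a2 :: "'p::prime_card mod_ring \<Rightarrow> bit \<Rightarrow> bit"
    and b2 :: "'p mod_ring \<Rightarrow> bit \<Rightarrow> bit"
    and l :: "bit \<Rightarrow> bit \<Rightarrow> bit"
  assumes f: "factorization A B" and b: "basis v2 v3 v4 v5"
    and z: "a2 0 0 = 0" "b2 0 0 = 0" "l 0 0 = 0"
    and A: "\<And>i j k. (i, k \<odot> v2 + a2 i j \<odot> v3 + b2 i j \<odot> v4 + j \<odot> v5) \<in> A"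
    and B: "\<And>i j. (0, l i j \<odot> v2 + i \<odot> v3 + j \<odot> v4) \<in> B"
  shows "listed_pair (int CARD('p)) (1, 0, 0, 0, 0) (0, v2) (0, v3) (0, v4) (0, v5) A B"
  by (rule listed_pair_if_contains[OF f b listed7[where
      ?\<alpha>2.0 = "\<lambda>i j. int_of_bit (a2 (of_int i) (of_int j))"
      and ?\<beta>2.0 = "\<lambda>i j. int_of_bit (b2 (of_int i) (of_int j))"
      and ?\<Lambda>2.0 = "\<lambda>i j. int_of_bit (l (of_int i) (of_int j))"]])
    (auto simp: z A B zmult_e1 zmult_snd simp del: zmult_Pair)

lemma listed_pair10I:
  fixes a3 :: "bit \<Rightarrow> bit \<Rightarrow> 'p::prime_card mod_ring \<Rightarrow> bit"
    and a2 :: "bit \<Rightarrow> bit \<Rightarrow> bit"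
    and l :: "bit \<Rightarrow> 'p mod_ring"
  assumes f: "factorization A B" and b: "basis v2 v3 v4 v5"
    and z: "a3 0 0 0 = 0" "a2 0 0 = 0" "l 0 = 0"
    and A: "\<And>i j k. (k, a3 i j k \<odot> v2 + a2 i j \<odot> v3 + i \<odot> v4 + j \<odot> v5) \<in> A"
    and B: "\<And>i j. (l i, j \<odot> v2 + i \<odot> v3) \<in> B"
  shows "listed_pair (int CARD('p)) (1, 0, 0, 0, 0) (0, v2) (0, v3) (0, v4) (0, v5) A B"
  by (rule listed_pair_if_contains[OF f b listed10[where
      ?\<alpha>3.0 = "\<lambda>i j k. int_of_bit (a3 (of_int i) (of_int j) (of_int k))"
      and ?\<alpha>2.0 = "\<lambda>i j. int_of_bit (a2 (of_int i) (of_int j))"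
      and ?\<Lambda>1.0 = "\<lambda>i. to_int_mod_ring (l (of_int i))"]])
    (auto simp: z A B zmult_e1 zmult_snd simp del: zmult_Pair)

lemma listed_pair12I:
  fixes a3 :: "'p::prime_card mod_ring \<Rightarrow> bit \<Rightarrow> bit \<Rightarrow> bit"
    and b3 :: "'p mod_ring \<Rightarrow> bit \<Rightarrow> bit \<Rightarrow> bit"
  assumes f: "factorization A B" and b: "basis v2 v3 v4 v5"
    and z: "a3 0 0 0 = 0" "b3 0 0 0 = 0"
    and A: "\<And>i j k. (i, a3 i j k \<odot> v2 + b3 i j k \<odot> v3 + j \<odot> v4 + k \<odot> v5) \<in> A"
    and B: "\<And>i j. (0, i \<odot> v2 + j \<odot> v3) \<in> B"
  shows "listed_pair (int CARD('p)) (1, 0, 0, 0, 0) (0, v2) (0, v3) (0, v4) (0, v5) A B"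
  by (rule listed_pair_if_contains[OF f b listed12[where
      ?\<alpha>3.0 = "\<lambda>i j k. int_of_bit (a3 (of_int i) (of_int j) (of_int k))"
      and ?\<beta>3.0 = "\<lambda>i j k. int_of_bit (b3 (of_int i) (of_int j) (of_int k))"]])
    (auto simp: z A B zmult_e1 zmult_snd simp del: zmult_Pair)

lemma listed_pair13I:
  fixes a :: "bit \<Rightarrow> 'p::prime_card mod_ring"
    and a2 :: "bit \<Rightarrow> bit \<Rightarrow> bit"
    and l2 :: "'p mod_ring \<Rightarrow> bit \<Rightarrow> bit"
    and l :: "'p mod_ring \<Rightarrow> bit"
  assumes f: "factorization A B" and b: "basis v2 v3 v4 v5"
    and z: "a 0 = 0" "a2 0 0 = 0" "l2 0 0 = 0" "l 0 = 0"
    and A: "\<And>i j k. (a i, k \<odot> v2 + a2 i j \<odot> v3 + j \<odot> v4 + i \<odot> v5) \<in> A"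
    and B: "\<And>i j. (i, l2 i j \<odot> v2 + j \<odot> v3 + l i \<odot> v4) \<in> B"
  shows "listed_pair (int CARD('p)) (1, 0, 0, 0, 0) (0, v2) (0, v3) (0, v4) (0, v5) A B"
  by (rule listed_pair_if_contains[OF f b listed13[where
      ?\<alpha>1.0 = "\<lambda>i. to_int_mod_ring (a (of_int i))"
      and ?\<alpha>2.0 = "\<lambda>i j. int_of_bit (a2 (of_int i) (of_int j))"
      and ?\<Lambda>2.0 = "\<lambda>i j. int_of_bit (l2 (of_int i) (of_int j))"
      and ?\<Lambda>1.0 = "\<lambda>i. int_of_bit (l (of_int i))"]])
    (auto simp: z A B zmult_e1 zmult_snd simp del: zmult_Pair)

lemma listed_pair14I:
  fixes a_p :: "bit \<Rightarrow> bit \<Rightarrow> 'p::prime_card mod_ring"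
    and a_b :: "bit \<Rightarrow> bit \<Rightarrow> bit"
    and l2 :: "'p mod_ring \<Rightarrow> bit \<Rightarrow> bit"
  assumes f: "factorization A B" and b: "basis v2 v3 v4 v5"
    and odd: "odd CARD('p)"
    and z: "a_p 0 0 = 0" "a_b 0 0 = 0" "l2 0 0 = 0"
    and A: "\<And>i j k. (a_p i j, k \<odot> v2 + a_b i j \<odot> v3 + i \<odot> v4 + j \<odot> v5) \<in> A"
    and B: "\<And>i j. (i, l2 i j \<odot> v2 + j \<odot> v3) \<in> B"
  shows "listed_pair (int CARD('p)) (1, 0, 0, 0, 0) (0, v2) (0, v3) (0, v4) (0, v5) A B"
  by (rule listed_pair_if_contains[OF f b listed14[where
      ?\<alpha>2.0 = "\<lambda>i j. int_lift (a_p (of_int i) (of_int j)) (a_b (of_int i) (of_int j))"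
      and ?\<Lambda>2.0 = "\<lambda>i j. int_of_bit (l2 (of_int i) (of_int j))"]])
    (auto simp: z A B zmult_e1 zmult_snd int_lift[OF odd] int_lift_0 simp del: zmult_Pair)

lemma listed_pair15I:
  fixes a2 :: "bit \<Rightarrow> bit \<Rightarrow> 'p::prime_card mod_ring"
    and a3 :: "bit \<Rightarrow> bit \<Rightarrow> bit \<Rightarrow> bit"
    and l :: "'p mod_ring \<Rightarrow> bit"
  assumes f: "factorization A B" and b: "basis v2 v3 v4 v5"
    and z: "a2 0 0 = 0" "a3 0 0 0 = 0" "l 0 = 0"
    and A: "\<And>i j k. (a2 i j, a3 i j k \<odot> v2 + k \<odot> v3 + i \<odot> v4 + j \<odot> v5) \<in> A"
    and B: "\<And>i j. (i, j \<odot> v2 + l i \<odot> v3) \<in> B"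
  shows "listed_pair (int CARD('p)) (1, 0, 0, 0, 0) (0, v2) (0, v3) (0, v4) (0, v5) A B"
  by (rule listed_pair_if_contains[OF f b listed15[where
      ?\<alpha>2.0 = "\<lambda>i j. to_int_mod_ring (a2 (of_int i) (of_int j))"
      and ?\<alpha>3.0 = "\<lambda>i j k. int_of_bit (a3 (of_int i) (of_int j) (of_int k))"
      and ?\<Lambda>1.0 = "\<lambda>i. int_of_bit (l (of_int i))"]])
    (auto simp: z A B zmult_e1 zmult_snd simp del: zmult_Pair)

lemma listed_pair16I:
  fixes a :: "bit \<Rightarrow> 'p::prime_card mod_ring"
    and a3 :: "bit \<Rightarrow> bit \<Rightarrow> bit \<Rightarrow> bit"
    and l :: "'p mod_ring \<Rightarrow> bit"
    and m :: "'p mod_ring \<Rightarrow> bit"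
  assumes f: "factorization A B" and b: "basis v2 v3 v4 v5"
    and z: "a 0 = 0" "a3 0 0 0 = 0" "l 0 = 0" "m 0 = 0"
    and A: "\<And>i j k. (a i, a3 i j k \<odot> v2 + j \<odot> v3 + k \<odot> v4 + i \<odot> v5) \<in> A"
    and B: "\<And>i j. (i, j \<odot> v2 + l i \<odot> v3 + m i \<odot> v4) \<in> B"
  shows "listed_pair (int CARD('p)) (1, 0, 0, 0, 0) (0, v2) (0, v3) (0, v4) (0, v5) A B"
  by (rule listed_pair_if_contains[OF f b listed16[where
      ?\<alpha>1.0 = "\<lambda>i. to_int_mod_ring (a (of_int i))"
      and ?\<alpha>3.0 = "\<lambda>i j k. int_of_bit (a3 (of_int i) (of_int j) (of_int k))"
      and ?\<Lambda>1.0 = "\<lambda>i. int_of_bit (l (of_int i))"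
      and ?\<mu>1.0 = "\<lambda>i. int_of_bit (m (of_int i))"]])
    (auto simp: z A B zmult_e1 zmult_snd simp del: zmult_Pair)

lemma listed_pair18I:
  fixes a_p :: "bit \<Rightarrow> bit \<Rightarrow> bit \<Rightarrow> 'p::prime_card mod_ring"
    and a_b :: "bit \<Rightarrow> bit \<Rightarrow> bit \<Rightarrow> bit"
  assumes f: "factorization A B" and b: "basis v2 v3 v4 v5"
    and odd: "odd CARD('p)"
    and z: "a_p 0 0 0 = 0" "a_b 0 0 0 = 0"
    and A: "\<And>i j k. (a_p i j k, a_b i j k \<odot> v2 + i \<odot> v3 + j \<odot> v4 + k \<odot> v5) \<in> A"
    and B: "\<And>i j. (i, j \<odot> v2) \<in> B"
  shows "listed_pair (int CARD('p)) (1, 0, 0, 0, 0) (0, v2) (0, v3) (0, v4) (0, v5) A B"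
  by (rule listed_pair_if_contains[OF f b listed18[where
      ?\<alpha>3.0 = "\<lambda>i j k. int_lift (a_p (of_int i) (of_int j) (of_int k)) (a_b (of_int i) (of_int j) (of_int k))"]])
    (auto simp: z A B zmult_e1 zmult_snd int_lift[OF odd] int_lift_0 simp del: zmult_Pair)

lemma listed_pair20I:
  fixes a :: "bit \<Rightarrow> bit \<Rightarrow> bit \<Rightarrow> bit"
    and l :: "bit \<Rightarrow> 'p::prime_card mod_ring"
  assumes f: "factorization A B" and b: "basis v2 v3 v4 v5"
    and z: "a 0 0 0 = 0" "l 0 = 0"
    and A: "\<And>i j k l'. (l', a i j k \<odot> v2 + i \<odot> v3 + j \<odot> v4 + k \<odot> v5) \<in> A"
    and B: "\<And>i. (l i, i \<odot> v2) \<in> B"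
  shows "listed_pair (int CARD('p)) (1, 0, 0, 0, 0) (0, v2) (0, v3) (0, v4) (0, v5) A B"
  by (rule listed_pair_if_contains[OF f b listed20[where
      ?\<alpha>3.0 = "\<lambda>i j k. int_of_bit (a (of_int i) (of_int j) (of_int k))"
      and ?\<Lambda>1.0 = "\<lambda>i. to_int_mod_ring (l (of_int i))"]])
    (auto simp: z A B zmult_e1 zmult_snd simp del: zmult_Pair)

lemma listed_pair24I:
  fixes a :: "'p::prime_card mod_ring \<Rightarrow> bit \<Rightarrow> bit \<Rightarrow> bit \<Rightarrow> bit"
  assumes f: "factorization A B" and b: "basis v2 v3 v4 v5"
    and z: "a 0 0 0 0 = 0"
    and A: "\<And>i j k l. (i, a i j k l \<odot> v2 + j \<odot> v3 + k \<odot> v4 + l \<odot> v5) \<in> A"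
    and B: "\<And>i. (0, i \<odot> v2) \<in> B"
  shows "listed_pair (int CARD('p)) (1, 0, 0, 0, 0) (0, v2) (0, v3) (0, v4) (0, v5) A B"
  by (rule listed_pair_if_contains[OF f b listed24[where
      ?\<alpha>4.0 = "\<lambda>i j k l. int_of_bit (a (of_int i) (of_int j) (of_int k) (of_int l))"]])
    (auto simp: z A B zmult_e1 zmult_snd simp del: zmult_Pair)

lemma listed_pair25I:
  fixes a :: "bit \<Rightarrow> bit \<Rightarrow> bit \<Rightarrow> 'p::prime_card mod_ring"
    and l :: "'p mod_ring \<Rightarrow> bit"
  assumes f: "factorization A B" and b: "basis v2 v3 v4 v5"
    and z: "a 0 0 0 = 0" "l 0 = 0"
    and A: "\<And>i j k m. (a i j k, m \<odot> v2 + i \<odot> v3 + j \<odot> v4 + k \<odot> v5) \<in> A"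
    and B: "\<And>i. (i, l i \<odot> v2) \<in> B"
  shows "listed_pair (int CARD('p)) (1, 0, 0, 0, 0) (0, v2) (0, v3) (0, v4) (0, v5) A B"
  by (rule listed_pair_if_contains[OF f b listed25[where
      ?\<alpha>3.0 = "\<lambda>i j k. to_int_mod_ring (a (of_int i) (of_int j) (of_int k))"
      and ?\<Lambda>1.0 = "\<lambda>i. int_of_bit (l (of_int i))"]])
    (auto simp: z A B zmult_e1 zmult_snd simp del: zmult_Pair)

lemma listed_pair26I:
  fixes a :: "bit \<Rightarrow> bit \<Rightarrow> 'p::prime_card mod_ring"
    and l :: "'p mod_ring \<Rightarrow> bit"
    and m :: "'p mod_ring \<Rightarrow> bit"
  assumes f: "factorization A B" and b: "basis v2 v3 v4 v5"
    and z: "a 0 0 = 0" "l 0 = 0" "m 0 = 0"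
    and A: "\<And>i j k n. (a i j, k \<odot> v2 + n \<odot> v3 + i \<odot> v4 + j \<odot> v5) \<in> A"
    and B: "\<And>i. (i, l i \<odot> v2 + m i \<odot> v3) \<in> B"
  shows "listed_pair (int CARD('p)) (1, 0, 0, 0, 0) (0, v2) (0, v3) (0, v4) (0, v5) A B"
  by (rule listed_pair_if_contains[OF f b listed26[where
      ?\<alpha>2.0 = "\<lambda>i j. to_int_mod_ring (a (of_int i) (of_int j))"
      and ?\<Lambda>1.0 = "\<lambda>i. int_of_bit (l (of_int i))"
      and ?\<mu>1.0 = "\<lambda>i. int_of_bit (m (of_int i))"]])
    (auto simp: z A B zmult_e1 zmult_snd simp del: zmult_Pair)

lemma listed_pair27I:
  fixes a :: "bit \<Rightarrow> 'p::prime_card mod_ring"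
    and l :: "'p mod_ring \<Rightarrow> bit"
    and m :: "'p mod_ring \<Rightarrow> bit"
    and n :: "'p mod_ring \<Rightarrow> bit"
  assumes f: "factorization A B" and b: "basis v2 v3 v4 v5"
    and z: "a 0 = 0" "l 0 = 0" "m 0 = 0" "n 0 = 0"
    and A: "\<And>i j k q. (a i, j \<odot> v2 + k \<odot> v3 + q \<odot> v4 + i \<odot> v5) \<in> A"
    and B: "\<And>i. (i, l i \<odot> v2 + m i \<odot> v3 + n i \<odot> v4) \<in> B"
  shows "listed_pair (int CARD('p)) (1, 0, 0, 0, 0) (0, v2) (0, v3) (0, v4) (0, v5) A B"
  by (rule listed_pair_if_contains[OF f b listed27[where
      ?\<alpha>1.0 = "\<lambda>i. to_int_mod_ring (a (of_int i))"
      and ?\<Lambda>1.0 = "\<lambda>i. int_of_bit (l (of_int i))"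
      and ?\<mu>1.0 = "\<lambda>i. int_of_bit (m (of_int i))"
      and ?\<nu>1.0 = "\<lambda>i. int_of_bit (n (of_int i))"]])
    (auto simp: z A B zmult_e1 zmult_snd simp del: zmult_Pair)

lemma listed_pair28I:
  fixes a :: "bit \<Rightarrow> bit \<Rightarrow> bit \<Rightarrow> bit \<Rightarrow> 'p::prime_card mod_ring"
  assumes f: "factorization A B" and b: "basis v2 v3 v4 v5"
    and z: "a 0 0 0 0 = 0"
    and A: "\<And>i j k l. (a i j k l, i \<odot> v2 + j \<odot> v3 + k \<odot> v4 + l \<odot> v5) \<in> A"
    and B: "\<And>i. (i, 0) \<in> B"
  shows "listed_pair (int CARD('p)) (1, 0, 0, 0, 0) (0, v2) (0, v3) (0, v4) (0, v5) A B"
  by (rule listed_pair_if_contains[OF f b listed28[where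
      ?\<alpha>4.0 = "\<lambda>i j k l. to_int_mod_ring (a (of_int i) (of_int j) (of_int k) (of_int l))"]])
    (auto simp: z A B zmult_e1 zmult_snd simp del: zmult_Pair)

definition listed :: "('p::prime_card mod_ring \<times> bit4) set \<Rightarrow> ('p mod_ring \<times> bit4) set \<Rightarrow> bool" where
  "listed A B \<longleftrightarrow> (\<exists>v2 v3 v4 v5. basis v2 v3 v4 v5 \<and>
     listed_pair (int CARD('p)) (1, 0, 0, 0, 0) (0, v2) (0, v3) (0, v4) (0, v5) A B)"

lemma listedI:
  "basis v2 v3 v4 v5 \<Longrightarrow>
   listed_pair (int CARD('p)) (1, 0, 0, 0, 0) (0, v2) (0, v3) (0, v4) (0, v5) A B \<Longrightarrow>
   listed (A :: ('p::prime_card mod_ring \<times> bit4) set) B"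
  unfolding listed_def by blast

section \<open>Subgroups and bases of \<open>\<int>\<^sub>2\<^sup>4\<close>\<close>

text \<open>
  Closure under negation is automatic, since every element is its own negative.
\<close>

definition subgrp :: "bit4 set \<Rightarrow> bool" where
  "subgrp H \<longleftrightarrow> 0 \<in> H \<and> (\<forall>x\<in>H. \<forall>y\<in>H. x + y \<in> H)"

fun span_list :: "bit4 list \<Rightarrow> bit4 set" where
  "span_list [] = {0}"
| "span_list (v # vs) = {b \<odot> v + y |b y. y \<in> span_list vs}"

lemma subgrp_zero: "subgrp H \<Longrightarrow> 0 \<in> H"
  and subgrp_add: "subgrp H \<Longrightarrow> x \<in> H \<Longrightarrow> y \<in> H \<Longrightarrow> x + y \<in> H"
  by (simp_all add: subgrp_def)

lemma subgrp_add_left_iff: "subgrp H \<Longrightarrow> x \<in> H \<Longrightarrow> x + y \<in> H \<longleftrightarrow> y \<in> H"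
  by (metis bit4_add_left_self subgrp_add)

lemma subgrp_bscale: "subgrp H \<Longrightarrow> x \<in> H \<Longrightarrow> b \<odot> x \<in> H"
  by (simp add: bscale_def subgrp_zero)

lemma subgrp_span_list: "subgrp (span_list vs)"
proof (induction vs)
  case Nil
  then show ?case by (simp add: subgrp_def)
next
  case (Cons v vs)
  show ?case
    unfolding subgrp_def
  proof (intro conjI ballI)
    have "0 = 0 \<odot> v + 0" by simp
    then show "0 \<in> span_list (v # vs)"
      using subgrp_zero[OF Cons] unfolding span_list.simps by blast
    fix x y assume "x \<in> span_list (v # vs)" "y \<in> span_list (v # vs)"
    then obtain a b s t where "x = a \<odot> v + s" "y = b \<odot> v + t" "s \<in> span_list vs" "t \<in> span_list vs"
      unfolding span_list.simps by blast
    then have "x + y = (a + b) \<odot> v + (s + t)" "s + t \<in> span_list vs"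
      using Cons by (simp_all add: subgrp_add bscale_add_left ac_simps)
    then show "x + y \<in> span_list (v # vs)"
      unfolding span_list.simps by blast
  qed
qed

lemma span_list_subset:
  assumes "subgrp H" "set vs \<subseteq> H"
  shows "span_list vs \<subseteq> H"
  using assms(2)
proof (induction vs)
  case (Cons v vs)
  then show ?case
    using assms(1) by (auto simp: subgrp_add subgrp_bscale simp del: split_paired_All split_paired_Ex)
qed (simp add: subgrp_zero assms)

lemma set_subset_span_list: "set vs \<subseteq> span_list vs"
proof (induction vs)
  case (Cons v vs)
  have "v = 1 \<odot> v + 0" by simp
  then have "v \<in> span_list (v # vs)"
    using subgrp_zero[OF subgrp_span_list] unfolding span_list.simps by blast
  moreover have "x \<in> span_list (v # vs)" if "x \<in> span_list vs" for x
  proof -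
    have "x = 0 \<odot> v + x" by simp
    then show ?thesis using that unfolding span_list.simps by blast
  qed
  ultimately show ?case using Cons by auto
qed simp

lemma span_list_Cons_eq: "span_list (v # vs) = span_list vs \<union> (+) v ` span_list vs"
proof -
  have "x \<in> span_list (v # vs) \<longleftrightarrow> x \<in> span_list vs \<union> (+) v ` span_list vs" for x
  proof
    assume "x \<in> span_list (v # vs)"
    then obtain b y where "x = b \<odot> v + y" "y \<in> span_list vs"
      unfolding span_list.simps by blast
    then show "x \<in> span_list vs \<union> (+) v ` span_list vs" by (cases b) simp_all
  next
    assume "x \<in> span_list vs \<union> (+) v ` span_list vs"
    then consider "x \<in> span_list vs" | y where "x = v + y" "y \<in> span_list vs" by blast
    then show "x \<in> span_list (v # vs)"
    proof cases
      case 1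
      then have "x = 0 \<odot> v + x" by simp
      with 1 show ?thesis unfolding span_list.simps by blast
    next
      case 2
      then have "x = 1 \<odot> v + y" by simp
      with 2 show ?thesis unfolding span_list.simps by blast
    qed
  qed
  then show ?thesis by blast
qed

lemma card_span_list_le: "card (span_list vs) \<le> 2 ^ length vs"
proof (induction vs)
  case (Cons v vs)
  have "card (span_list (v # vs)) \<le> card (span_list vs) + card ((+) v ` span_list vs)"
    unfolding span_list_Cons_eq by (rule card_Un_le)
  also have "\<dots> \<le> 2 ^ length (v # vs)"
    using Cons card_image_le[of "span_list vs" "(+) v"] by simp
  finally show ?case .
qed simp

lemma card_span_list_Cons:
  assumes "v \<notin> span_list vs"
  shows "card (span_list (v # vs)) = 2 * card (span_list vs)"
proof -
  have "v + y \<notin> span_list vs" if "y \<in> span_list vs" for y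
    using assms that subgrp_add_left_iff[OF subgrp_span_list that] by (metis add.commute)
  then have "span_list vs \<inter> (+) v ` span_list vs = {}"
    by blast
  then show ?thesis
    unfolding span_list_Cons_eq by (simp add: card_Un_disjoint card_image)
qed

definition independent_list :: "bit4 list \<Rightarrow> bool" where
  "independent_list vs \<longleftrightarrow> card (span_list vs) = 2 ^ length vs"

lemma independent_list_Cons:
  "independent_list vs \<Longrightarrow> v \<notin> span_list vs \<Longrightarrow> independent_list (v # vs)"
  unfolding independent_list_def using card_span_list_Cons by simp

text \<open>
  Adding a vector outside the span doubles the span; this is repeated until \<open>M\<close> is exhausted.
\<close>

lemma extend_to_basis:
  assumes "subgrp M" "span_list vs \<subseteq> M" "independent_list vs"
  obtains ws where "span_list (ws @ vs) = M" "independent_list (ws @ vs)"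
  using assms(2,3)
proof (induction "card M - card (span_list vs)" arbitrary: vs thesis rule: less_induct)
  case less
  show ?case
  proof (cases "span_list vs = M")
    case True
    then show ?thesis using less.prems(1)[of "[]"] less.prems by simp
  next
    case False
    then obtain v where v: "v \<in> M" "v \<notin> span_list vs" using less.prems by blast
    have ind: "independent_list (v # vs)"
      using less.prems v independent_list_Cons by blast
    have sub: "span_list (v # vs) \<subseteq> M"
      using v less.prems set_subset_span_list[of vs] assms(1) by (intro span_list_subset) auto
    have "card (span_list vs) < card M"
      using False less.prems by (simp add: psubset_card_mono psubsetI)
    moreover have "card (span_list vs) < card (span_list (v # vs))"
      using less.prems ind by (simp only: independent_list_def) simp
    ultimately have "card M - card (span_list (v # vs)) < card M - card (span_list vs)"
      by simp
    from less.hyps[OF this _ sub ind] obtain ws where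
      "span_list (ws @ v # vs) = M" "independent_list (ws @ v # vs)" by blast
    then show ?thesis using less.prems(1)[of "ws @ [v]"] by simp
  qed
qed

lemma length_if_span_list_UNIV:
  assumes "span_list vs = UNIV" "independent_list vs"
  shows "length vs = 4"
proof -
  have "(2::nat) ^ length vs = 2 ^ 4"
    using assms by (simp add: independent_list_def)
  then show ?thesis by (simp only: power_inject_exp)
qed

lemma independent_Nil: "independent_list []"
  by (simp add: independent_list_def)

lemma subgrp_UNIV: "subgrp UNIV"
  by (simp add: subgrp_def)

text \<open>
  Lists grow at the front, so the vectors appear in reverse order.
\<close>

lemma basis_if_span_list_UNIV:
  assumes "span_list [v5, v4, v3, v2] = UNIV"
  shows "basis v2 v3 v4 v5"
  unfolding basis_def surj_def
proof
  fix y
  have "y \<in> span_list [v5, v4, v3, v2]" by (simp only: assms UNIV_I)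
  then obtain a b c d where "y = d \<odot> v5 + (c \<odot> v4 + (b \<odot> v3 + (a \<odot> v2 + 0)))"
    unfolding span_list.simps by blast
  then have "y = lin v2 v3 v4 v5 (a, b, c, d)"
    by (simp add: lin_def ac_simps)
  then show "\<exists>x. y = lin v2 v3 v4 v5 x" ..
qed

text \<open>
  The at most three nonzero elements span at most eight of the sixteen vectors.
\<close>

lemma small_subset_proper_subgrp:
  assumes "card T \<le> 4" "0 \<in> T"
  obtains H where "subgrp H" "T \<subseteq> H" "H \<noteq> UNIV"
proof -
  obtain vs where vs: "set vs = T - {0}" "distinct vs"
    using finite_distinct_list[of "T - {0}"] by auto
  have "length vs \<le> 3"
    using vs assms distinct_card[OF vs(2)] by simp
  then have "(2::nat) ^ length vs \<le> 2 ^ 3"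
    by (rule power_increasing) simp
  then have "card (span_list vs) \<le> 8"
    using card_span_list_le[of vs] by simp
  then have "span_list vs \<noteq> UNIV" by auto
  moreover have "T \<subseteq> span_list vs"
    using vs set_subset_span_list[of vs] subgrp_zero[OF subgrp_span_list, of vs] by auto
  ultimately show ?thesis
    using that subgrp_span_list by blast
qed

text \<open>
  The set \<open>T\<close> consists of \<open>K\<close> and at most one further coset, and the sum of two elements of the same
  coset lies in \<open>K\<close>.
\<close>

lemma subgrp_if_union_of_two_cosets:
  assumes K: "subgrp K" and inv: "\<And>x k. x \<in> T \<Longrightarrow> k \<in> K \<Longrightarrow> k + x \<in> T"
    and "0 \<in> T" and card: "card T \<le> 2 * card K"
  shows "subgrp T"
  unfolding subgrp_def
proof (intro conjI ballI)
  fix x y assume xy: "x \<in> T" "y \<in> T"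
  show "x + y \<in> T"
  proof (cases "x \<in> K \<or> y \<in> K")
    case True
    then show ?thesis using inv xy by (metis add.commute)
  next
    case False
    have KT: "K \<subseteq> T" using inv[OF \<open>0 \<in> T\<close>] by (simp add: subsetI)
    have xT: "(\<lambda>k. k + x) ` K \<subseteq> T" using inv xy by blast
    have dis: "K \<inter> (\<lambda>k. k + x) ` K = {}"
      using False subgrp_add_left_iff[OF K] by blast
    have "card (K \<union> (\<lambda>k. k + x) ` K) = 2 * card K"
      using dis by (simp add: card_Un_disjoint card_image)
    then have "K \<union> (\<lambda>k. k + x) ` K = T"
      using KT xT card by (intro card_seteq) auto
    then obtain k where "k \<in> K" "y = k + x" using False xy by blast
    then have "x + y = k" by (simp add: add.left_commute)
    then show ?thesis using \<open>k \<in> K\<close> KT by blast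
  qed
qed (fact assms)

text \<open>
  Membership in a span is accessed through the coefficients in \<open>in_span_listD\<close>, not through the
  recursion.
\<close>

declare span_list.simps(2) [simp del]

lemma lists_of_length:
  "length xs = Suc 0 \<Longrightarrow> \<exists>a. xs = [a]"
  "length xs = 2 \<Longrightarrow> \<exists>a b. xs = [a, b]"
  "length xs = 3 \<Longrightarrow> \<exists>a b c. xs = [a, b, c]"
  "length xs = 4 \<Longrightarrow> \<exists>a b c d. xs = [a, b, c, d]"
  by (auto simp: length_Suc_conv numeral_2_eq_2 numeral_3_eq_3 numeral_eq_Suc)

lemma in_span_listD:
  "x \<in> span_list [] \<Longrightarrow> x = 0"
  "x \<in> span_list [v] \<Longrightarrow> \<exists>a. x = a \<odot> v"
  "x \<in> span_list [w, v] \<Longrightarrow> \<exists>a b. x = a \<odot> v + b \<odot> w"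
  "x \<in> span_list [y, w, v] \<Longrightarrow> \<exists>a b c. x = a \<odot> v + b \<odot> w + c \<odot> y"
  "x \<in> span_list [z, y, w, v] \<Longrightarrow> \<exists>a b c d. x = a \<odot> v + b \<odot> w + c \<odot> y + d \<odot> z"
proof -
  have C: "\<exists>b y. x = b \<odot> v + y \<and> y \<in> span_list vs" if "x \<in> span_list (v # vs)" for x v vs
    using that unfolding span_list.simps by blast
  show 0: "x = 0" if "x \<in> span_list []" for x
    using that by simp
  show 1: "\<exists>a. x = a \<odot> v" if "x \<in> span_list [v]" for x v
    using C[OF that] 0 by (metis add_0_right)
  show 2: "\<exists>a b. x = a \<odot> v + b \<odot> w" if "x \<in> span_list [w, v]" for x v w
    using C[OF that] 1 by (metis add.commute)
  show 3: "\<exists>a b c. x = a \<odot> v + b \<odot> w + c \<odot> y" if "x \<in> span_list [y, w, v]" for x v w y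
    using C[OF that] 2 by (metis add.commute)
  show "\<exists>a b c d. x = a \<odot> v + b \<odot> w + c \<odot> y + d \<odot> z" if "x \<in> span_list [z, y, w, v]"
    using C[OF that] 3 by (metis add.commute)
qed

lemma in_span_list_append:
  assumes "x \<in> span_list (xs @ ys)"
  obtains u y where "u \<in> span_list xs" "y \<in> span_list ys" "x = u + y"
  using assms
proof (induction xs arbitrary: x thesis)
  case Nil
  show ?case using Nil.prems(1)[of 0 x] Nil.prems(2) by simp
next
  case (Cons v xs)
  then obtain b z where z: "x = b \<odot> v + z" "z \<in> span_list (xs @ ys)"
    unfolding append_Cons span_list.simps by blast
  then obtain u y where u: "u \<in> span_list xs" "y \<in> span_list ys" "z = u + y" using Cons.IH by blast
  then have "b \<odot> v + u \<in> span_list (v # xs)" unfolding span_list.simps by blast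
  then show ?case using Cons.prems(1) z u by (simp add: add.assoc)
qed

text \<open>
  Coefficients of a family of vectors in a span, chosen to be zero at an index where the vector is
  zero. The choice is explicit, as the normalization of the parameters asks for it.
\<close>

lemma ex_coeff1:
  assumes "\<And>i. f i \<in> span_list [v]" "f z = 0"
  shows "\<exists>a. a z = 0 \<and> (\<forall>i. f i = a i \<odot> v)"
proof -
  have "\<forall>i. \<exists>a. (i = z \<longrightarrow> a = 0) \<and> f i = a \<odot> v"
    using in_span_listD(2)[OF assms(1)] assms(2) by (metis bscale_simps(1))
  then show ?thesis by metis
qed

lemma ex_coeff2:
  assumes "\<And>i. f i \<in> span_list [w, v]" "f z = 0"
  shows "\<exists>a b. a z = 0 \<and> b z = 0 \<and> (\<forall>i. f i = a i \<odot> v + b i \<odot> w)"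
proof -
  have "\<forall>i. \<exists>a b. (i = z \<longrightarrow> a = 0 \<and> b = 0) \<and> f i = a \<odot> v + b \<odot> w"
    using in_span_listD(3)[OF assms(1)] assms(2) by (metis bscale_simps(1) add_0)
  then show ?thesis by metis
qed

lemma ex_coeff3:
  assumes "\<And>i. f i \<in> span_list [y, w, v]" "f z = 0"
  shows "\<exists>a b c. a z = 0 \<and> b z = 0 \<and> c z = 0 \<and> (\<forall>i. f i = a i \<odot> v + b i \<odot> w + c i \<odot> y)"
proof -
  have "\<forall>i. \<exists>a b c. (i = z \<longrightarrow> a = 0 \<and> b = 0 \<and> c = 0) \<and> f i = a \<odot> v + b \<odot> w + c \<odot> y"
    using in_span_listD(4)[OF assms(1)] assms(2) by (metis bscale_simps(1) add_0)
  then show ?thesis by metis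
qed

lemma ex_coeff4:
  assumes "\<And>i. f i \<in> span_list [x, y, w, v]" "f z = 0"
  shows "\<exists>a b c d. a z = 0 \<and> b z = 0 \<and> c z = 0 \<and> d z = 0 \<and>
    (\<forall>i. f i = a i \<odot> v + b i \<odot> w + c i \<odot> y + d i \<odot> x)"
proof -
  have "\<forall>i. \<exists>a b c d. (i = z \<longrightarrow> a = 0 \<and> b = 0 \<and> c = 0 \<and> d = 0) \<and> f i = a \<odot> v + b \<odot> w + c \<odot> y + d \<odot> x"
    using in_span_listD(5)[OF assms(1)] assms(2) by (metis bscale_simps(1) add_0)
  then show ?thesis by metis
qed

lemma ex_coeff1_curried:
  assumes "\<And>i j. f i j \<in> span_list [v]" "f 0 0 = 0"
  shows "\<exists>a. a 0 0 = 0 \<and> (\<forall>i j. f i j = a i j \<odot> v)"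
proof -
  let ?f = "\<lambda>z. f (fst z) (snd z)"
  have "\<And>z. ?f z \<in> span_list [v]" "?f (0, 0) = 0"
    using assms by simp_all
  then obtain a where z: "a (0, 0) = 0"
    and f: "\<forall>z. ?f z = a z \<odot> v"
    using ex_coeff1[of ?f v "(0, 0)"] by blast
  have "f i j = a (i, j) \<odot> v" for i j
    using f[rule_format, of "(i, j)"] by simp
  then show ?thesis
    using z by (intro exI[of _ "\<lambda>i j. a (i, j)"] conjI allI)
qed

lemma ex_coeff2_curried:
  assumes "\<And>i j. f i j \<in> span_list [w, v]" "f 0 0 = 0"
  shows "\<exists>a b. a 0 0 = 0 \<and> b 0 0 = 0 \<and> (\<forall>i j. f i j = a i j \<odot> v + b i j \<odot> w)"
proof -
  let ?f = "\<lambda>z. f (fst z) (snd z)"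
  have "\<And>z. ?f z \<in> span_list [w, v]" "?f (0, 0) = 0"
    using assms by simp_all
  then obtain a b where z: "a (0, 0) = 0" "b (0, 0) = 0"
    and f: "\<forall>z. ?f z = a z \<odot> v + b z \<odot> w"
    using ex_coeff2[of ?f w v "(0, 0)"] by blast
  have "f i j = a (i, j) \<odot> v + b (i, j) \<odot> w" for i j
    using f[rule_format, of "(i, j)"] by simp
  then show ?thesis
    using z by (intro exI[of _ "\<lambda>i j. a (i, j)"] exI[of _ "\<lambda>i j. b (i, j)"] conjI allI)
qed

lemma ex_coeff3_curried:
  assumes "\<And>i j. f i j \<in> span_list [y, w, v]" "f 0 0 = 0"
  shows "\<exists>a b c. a 0 0 = 0 \<and> b 0 0 = 0 \<and> c 0 0 = 0 \<and> (\<forall>i j. f i j = a i j \<odot> v + b i j \<odot> w + c i j \<odot> y)"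
proof -
  let ?f = "\<lambda>z. f (fst z) (snd z)"
  have "\<And>z. ?f z \<in> span_list [y, w, v]" "?f (0, 0) = 0"
    using assms by simp_all
  then obtain a b c where z: "a (0, 0) = 0" "b (0, 0) = 0" "c (0, 0) = 0"
    and f: "\<forall>z. ?f z = a z \<odot> v + b z \<odot> w + c z \<odot> y"
    using ex_coeff3[of ?f y w v "(0, 0)"] by blast
  have "f i j = a (i, j) \<odot> v + b (i, j) \<odot> w + c (i, j) \<odot> y" for i j
    using f[rule_format, of "(i, j)"] by simp
  then show ?thesis
    using z by (intro exI[of _ "\<lambda>i j. a (i, j)"] exI[of _ "\<lambda>i j. b (i, j)"] exI[of _ "\<lambda>i j. c (i, j)"] conjI allI)
qed

lemma extend_to_UNIV:
  assumes "independent_list vs"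
  obtains us where "span_list (us @ vs) = UNIV" "length us + length vs = 4"
proof -
  obtain us where us: "span_list (us @ vs) = UNIV" "independent_list (us @ vs)"
    using extend_to_basis[OF subgrp_UNIV _ assms] by blast
  show ?thesis using that[OF us(1)] length_if_span_list_UNIV[OF us] by simp
qed

lemma ex_basis_list:
  assumes "subgrp M"
  obtains vs where "span_list vs = M" "independent_list vs"
  using extend_to_basis[OF assms _ independent_Nil] subgrp_zero[OF assms] by auto

section \<open>The normal form of a factorization\<close>

definition slice :: "('a \<times> 'v) set \<Rightarrow> 'a \<Rightarrow> 'v set" where
  "slice A s = {v. (s, v) \<in> A}"

text \<open>
  The assumption \<open>const\<close> says that \<open>V\<close> is partitioned by the values of \<open>F\<close> into sets each of which is
  the direct sum of any slice of \<open>A\<close> and the corresponding fibre of \<open>F\<close> on \<open>Q\<close>.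
\<close>

locale normal_form =
  fixes A :: "('p::prime_card mod_ring \<times> bit4) set"
    and Q :: "bit4 set"
    and F :: "bit4 \<Rightarrow> 'p mod_ring"
  assumes odd_card: "odd CARD('p)"
    and slice_factorization: "\<And>s. factorization (slice A s) Q"
    and const: "\<And>s a q. (s, a) \<in> A \<Longrightarrow> q \<in> Q \<Longrightarrow> F (a + q) = F q"
    and zero_A: "(0, 0) \<in> A" and zero_Q: "0 \<in> Q" and F_0: "F 0 = 0"
    and graph_factorization: "factorization A ((\<lambda>q. (F q, q)) ` Q)"

lemma ex_fst_if_snd_image: "b \<in> snd ` B \<Longrightarrow> \<exists>x. (x, b) \<in> B"
  by force

text \<open>
  For every residue \<open>r\<close> modulo \<open>p\<close> there is an odd \<open>k\<close> that is congruent to \<open>r\<close>, and multiplication by \<open>k\<close>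
  turns \<open>B\<close> into \<open>{(r x, v) | (x, v) \<in> B}\<close>. With \<open>r = 0\<close> the new factor lies in \<open>V\<close>; this makes \<open>B\<close> a graph
  and factorizes \<open>V\<close> by each slice of \<open>A\<close>. If \<open>a + v = a' + w\<close> for \<open>(s, a), (t, a') \<in> A\<close> and
  \<open>(x, v), (y, w) \<in> B\<close> with \<open>x \<noteq> y\<close>, then \<open>r = (t - s) / (x - y)\<close> gives \<open>s + r x = t + r y\<close>, and the
  element \<open>(s + r x, a + v)\<close> has two representations. So \<open>x\<close> depends on \<open>a + v\<close> only.
\<close>

lemma ex_normal_form:
  fixes A B :: "('p::prime_card mod_ring \<times> bit4) set"
  assumes odd: "odd CARD('p)" and fac: "factorization A B" and card: "card B = 2 ^ n"
    and zero: "0 \<in> A" "0 \<in> B"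
  obtains Q F where "normal_form A Q F" "B = (\<lambda>q. (F q, q)) ` Q"
proof -
  have z: "(0, 0) \<in> A" "(0, 0) \<in> B"
    using zero by (simp_all only: zero_prod_def[where 'a = "'p mod_ring" and 'b = bit4])
  let ?m = "\<lambda>r (x, v). (r * x, v) :: 'p mod_ring \<times> bit4"
  have H: "factorization A (?m r ` B)" for r
  proof -
    obtain i where i: "r = of_nat i" using surj_of_nat_mod_ring by blast
    \<comment> \<open>Since \<open>p\<close> is odd, one of \<open>i\<close> and \<open>i + p\<close> is odd.\<close>
    define k where "k = (if odd i then i else i + CARD('p))"
    have k: "odd k" "of_nat k = r"
      using odd i of_int_CARD[where 'p = 'p] by (auto simp: k_def)
    then have "factorization A ((\<lambda>b. int k \<cdot> b) ` B)"
      by (intro factorization_coprime_multiple[OF fac]) (auto simp: card odd_pos)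
    moreover have "int k \<cdot> b = ?m r b" for b
    proof -
      have k1: "(of_int (int k) :: bit) = 1"
        using k(1) by (elim oddE) simp
      have kr: "of_int (int k) = r"
        using k(2) by simp
      obtain x v where b: "b = (x, v)" by (rule prod.exhaust)
      show ?thesis
        by (simp only: b zmult_Pair zmult_ring zmult_bit4 k1 kr prod.case bscale_simps)
    qed
    ultimately show ?thesis by simp
  qed
  have U: "a = a' \<and> v = w"
    if *: "(s, a) \<in> A" "(t, a') \<in> A" "(x, v) \<in> B" "(y, w) \<in> B" "a + v = a' + w" "s + r * x = t + r * y"
    for s t a a' x y v w r
  proof -
    have "(r * x, v) \<in> ?m r ` B" "(r * y, w) \<in> ?m r ` B"
      using image_eqI[OF _ *(3), of _ "?m r"] image_eqI[OF _ *(4), of _ "?m r"] by simp_all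
    then have "(s, a) = (t, a')" "(r * x, v) = (r * y, w)"
      using factorization_uniqueD[OF H[of r], of "(s, a)" "(r * x, v)" "(t, a')" "(r * y, w)"] *
      by simp_all
    then show ?thesis by simp
  qed
  \<comment> \<open>By counting: the factor belonging to \<open>r = 0\<close> has as many elements as \<open>B\<close>.\<close>
  have inj: "inj_on snd B"
  proof -
    have "card A * card (?m 0 ` B) = card A * card B"
      using factorization_card[OF H[of 0]] factorization_card[OF fac] by simp
    moreover have "card A \<noteq> 0" using zero by auto
    ultimately have "card (?m 0 ` B) = card B" by simp
    then have "inj_on (?m 0) B" by (simp add: eq_card_imp_inj_on)
    then show ?thesis unfolding inj_on_def by force
  qed
  define F where "F v = (THE x. \<exists>s a w. (s, a) \<in> A \<and> (x, w) \<in> B \<and> v = a + w)" for v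
  have F: "F (a + w) = x" if "(s, a) \<in> A" "(x, w) \<in> B" for s a x w
    unfolding F_def
  proof (rule the_equality)
    show "\<exists>s a' w'. (s, a') \<in> A \<and> (x, w') \<in> B \<and> a + w = a' + w'" using that by blast
    fix y assume "\<exists>s a' w'. (s, a') \<in> A \<and> (y, w') \<in> B \<and> a + w = a' + w'"
    then obtain t a' w' where *: "(t, a') \<in> A" "(y, w') \<in> B" "a + w = a' + w'" by blast
    show "y = x"
    proof (rule ccontr)
      assume "y \<noteq> x"
      \<comment> \<open>This is the multiple for which the two sums collide.\<close>
      then have "s + ((t - s) / (x - y)) * x = t + ((t - s) / (x - y)) * y"
        by (simp add: field_simps)
      then have "w = w'" using U[OF that(1) *(1) that(2) *(2,3)] by blast
      then show False
        using \<open>y \<noteq> x\<close> inj that * by (force simp: inj_on_def)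
    qed
  qed
  have F1: "F v = x" if "(x, v) \<in> B" for x v
    using F[OF z(1) that] by simp
  have B: "B = (\<lambda>q. (F q, q)) ` (snd ` B)"
    unfolding image_image using F1 by (force intro: image_eqI)
  have "normal_form A (snd ` B) F"
  proof
    fix s a q assume *: "(s, a) \<in> A" "q \<in> snd ` B"
    from ex_fst_if_snd_image[OF *(2)] obtain x where x: "(x, q) \<in> B" ..
    then show "F (a + q) = F q"
      using F[OF *(1) x] F1[OF x] by simp
  next
    show "0 \<in> snd ` B" using image_eqI[OF _ z(2), of 0 snd] by simp
    show "F 0 = 0" using F1 z by blast
  next
    show "factorization A ((\<lambda>q. (F q, q)) ` (snd ` B))"
      using fac B by simp
  next
    fix s
    show "factorization (slice A s) (snd ` B)"
      unfolding factorization_iff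
    proof (intro conjI allI ballI impI)
      fix g
      obtain a b where "a \<in> A" "b \<in> ?m 0 ` B" "(s, g) = a + b"
        using factorization_coverE[OF H[of 0]] .
      moreover obtain a1 a2 where a: "a = (a1, a2)" by (rule prod.exhaust)
      moreover obtain x v where b: "(x, v) \<in> B" "b = ?m 0 (x, v)"
        using \<open>b \<in> ?m 0 ` B\<close> by (elim imageE) (metis prod.collapse)
      ultimately have "a2 \<in> slice A s" "g = a2 + v"
        by (simp_all add: slice_def)
      moreover have "v \<in> snd ` B" using image_eqI[OF _ b(1), of v snd] by simp
      ultimately show "\<exists>a\<in>slice A s. \<exists>b\<in>snd ` B. g = a + b"
        by blast
    next
      fix a b a' b' assume *: "a \<in> slice A s" "b \<in> snd ` B" "a' \<in> slice A s" "b' \<in> snd ` B" "a + b = a' + b'"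
      from ex_fst_if_snd_image[OF *(2)] obtain x where "(x, b) \<in> B" ..
      moreover from ex_fst_if_snd_image[OF *(4)] obtain y where "(y, b') \<in> B" ..
      moreover have "(s, a) \<in> A" "(s, a') \<in> A" using * by (simp_all add: slice_def)
      moreover have "s + 0 * x = s + 0 * y" by simp
      ultimately have "a = a' \<and> b = b'" using U *(5) by blast
      then show "a = a'" "b = b'" by simp_all
    qed
  qed (fact odd z)+
  then show ?thesis using that B by blast
qed

context normal_form
begin

abbreviation "B \<equiv> (\<lambda>q. (F q, q)) ` Q"

lemma graphI: "q \<in> Q \<Longrightarrow> F q = x \<Longrightarrow> (x, q) \<in> B"
  by blast

lemma cover:
  obtains a q where "(s, a) \<in> A" "q \<in> Q" "v = a + q"
  using factorization_coverE[OF slice_factorization[of s], of v] unfolding slice_def by blast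

lemma unique:
  assumes "(s, a) \<in> A" "(s, a') \<in> A" "q \<in> Q" "q' \<in> Q" "a + q = a' + q'"
  shows "a = a'" "q = q'"
  using factorization_uniqueD[OF slice_factorization[of s], of a q a' q'] assms by (simp_all add: slice_def)

lemma card_slice: "card (slice A s) * card Q = 16"
  using factorization_card[OF slice_factorization] by simp

lemma F_slice: "(s, a) \<in> A \<Longrightarrow> F a = 0"
  using const[of s a 0] zero_Q F_0 by simp

definition stab :: "bit4 set" where
  "stab = {m. \<forall>v. F (v + m) = F v}"

lemma stabD: "m \<in> stab \<Longrightarrow> F (v + m) = F v" "m \<in> stab \<Longrightarrow> F (m + v) = F v"
  by (simp_all add: stab_def add.commute[of m v] del: split_paired_All)

lemma subgrp_stab: "subgrp stab"
  unfolding subgrp_def stab_def by (simp add: add.assoc[symmetric] del: split_paired_All)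

lemma F_eq_0_if_stab_UNIV: "stab = UNIV \<Longrightarrow> F v = 0"
  using stabD(1)[of v 0] F_0 by simp

lemma graph_stab: "m \<in> stab \<Longrightarrow> m + v \<in> Q \<Longrightarrow> (F v, m + v) \<in> B"
  using stabD(2) by (intro graphI) simp_all

lemma factorization_swap: "factorization B A"
  using graph_factorization factorization_commute by blast

section \<open>The case \<open>card Q = 16\<close>\<close>

text \<open>
  If every vector lies in \<open>Q\<close>, then \<open>const\<close> literally says that \<open>a\<close> is a period of \<open>F\<close>.
\<close>

lemma slice_subset_stab_if_Q_UNIV: "Q = UNIV \<Longrightarrow> (s, a) \<in> A \<Longrightarrow> a \<in> stab"
  using const[of s a] by (simp add: stab_def add.commute[of _ a] del: split_paired_All)

lemma ex_section_if_Q_UNIV: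
  assumes "Q = UNIV"
  obtains x where "x 0 = 0" "\<And>s. (s, x s) \<in> A"
proof -
  have "\<forall>s. \<exists>a. (s = 0 \<longrightarrow> a = 0) \<and> (s, a) \<in> A"
    using cover zero_A by metis
  then show ?thesis using that by metis
qed

lemma listed_1:
  assumes "Q = UNIV" "stab = UNIV"
  shows "listed A B"
proof -
  obtain us where "span_list (us @ []) = UNIV" "length us + length ([] :: bit4 list) = 4"
    using extend_to_UNIV[OF independent_Nil] .
  then obtain v2 v3 v4 v5 where sp: "span_list [v5, v4, v3, v2] = UNIV"
    using lists_of_length(4)[of us] by auto
  then have b: "basis v2 v3 v4 v5" by (rule basis_if_span_list_UNIV)
  obtain x where x: "x 0 = 0" "\<And>s. (s, x s) \<in> A" using ex_section_if_Q_UNIV[OF assms(1)] by blast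
  obtain \<alpha> \<beta> \<gamma> \<delta> where c: "\<alpha> 0 = 0" "\<beta> 0 = 0" "\<gamma> 0 = 0" "\<delta> 0 = 0"
    "\<forall>i. x i = \<alpha> i \<odot> v2 + \<beta> i \<odot> v3 + \<gamma> i \<odot> v4 + \<delta> i \<odot> v5"
    using ex_coeff4[of x v5 v4 v3 v2 0] unfolding sp using x(1) by blast
  show ?thesis
  proof (rule listedI[OF b], rule listed_pair1I[OF graph_factorization b,
        where a = \<alpha> and b = \<beta> and c = \<gamma> and d = \<delta>])
    show "(i, \<alpha> i \<odot> v2 + \<beta> i \<odot> v3 + \<gamma> i \<odot> v4 + \<delta> i \<odot> v5) \<in> A" for i
      using x(2)[of i] by (simp only: c(5))
    show "(0, i \<odot> v2 + j \<odot> v3 + k \<odot> v4 + l \<odot> v5) \<in> B" for i j k l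
      using F_eq_0_if_stab_UNIV[OF assms(2)] assms(1) by (intro graphI) simp_all
  qed (simp_all add: c(1-4))
qed

text \<open>
  Every slice consists of one element of \<open>stab\<close>. The vectors of a basis that lie in \<open>stab\<close> carry the
  coefficients of these elements, while \<open>F\<close> depends only on the coefficients of the others; the four
  cases are the possible dimensions of \<open>stab\<close>.
\<close>

lemma listed_25_to_28:
  assumes Q: "Q = UNIV" and M: "stab \<noteq> UNIV"
  shows "listed B A"
proof -
  obtain ms where ms: "span_list ms = stab" "independent_list ms"
    using ex_basis_list[OF subgrp_stab] .
  obtain us where us: "span_list (us @ ms) = UNIV" "length us + length ms = 4"
    using extend_to_UNIV[OF ms(2)] .
  have "us \<noteq> []" using us ms M by auto
  then have "length us > 0" by simp
  obtain x where x: "x 0 = 0" "\<And>s. (s, x s) \<in> A" using ex_section_if_Q_UNIV[OF Q] by blast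
  have xM: "\<And>s. x s \<in> span_list ms"
    using x(2) slice_subset_stab_if_Q_UNIV[OF Q] ms by blast
  have G: "(F v, m + v) \<in> B" if "m \<in> span_list ms" for m v
    using that graph_stab ms Q by simp
  have in_ms: "0 \<in> span_list ms" "\<And>b v. v \<in> set ms \<Longrightarrow> b \<odot> v \<in> span_list ms"
    "\<And>u v. u \<in> span_list ms \<Longrightarrow> v \<in> span_list ms \<Longrightarrow> u + v \<in> span_list ms"
    by (meson subgrp_zero subgrp_bscale set_subset_span_list subsetD subgrp_add subgrp_span_list)+
  note f = factorization_swap
  consider "length ms = 0" "length us = 4" | "length ms = 1" "length us = 3"
    | "length ms = 2" "length us = 2" | "length ms = 3" "length us = 1"
    using us \<open>length us > 0\<close> by linarith
  then show ?thesis
  proof cases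
    case 1
    then obtain v2 v3 v4 v5 where l: "ms = []" "us = [v5, v4, v3, v2]"
      using lists_of_length(4)[of us] by auto
    then have b: "basis v2 v3 v4 v5" using us by (intro basis_if_span_list_UNIV) simp
    have x0: "x s = 0" for s using xM[of s] l by simp
    show ?thesis
    proof (rule listedI[OF b], rule listed_pair28I[OF f b,
        where a = "\<lambda>i j k l. F (i \<odot> v2 + j \<odot> v3 + k \<odot> v4 + l \<odot> v5)"])
      show "(F (i \<odot> v2 + j \<odot> v3 + k \<odot> v4 + l \<odot> v5), i \<odot> v2 + j \<odot> v3 + k \<odot> v4 + l \<odot> v5) \<in> B" for i j k l
        using Q by blast
      show "(i, 0) \<in> A" for i using x(2)[of i] x0 by simp
    qed (simp add: F_0)
  next
    case 2
    then obtain v2 v3 v4 v5 where l: "ms = [v2]" "us = [v5, v4, v3]"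
      using lists_of_length(1)[of ms] lists_of_length(3)[of us] by auto
    then have b: "basis v2 v3 v4 v5" using us by (intro basis_if_span_list_UNIV) simp
    obtain \<alpha> where c: "\<alpha> 0 = 0" "\<forall>i. x i = \<alpha> i \<odot> v2"
      using ex_coeff1[of x v2 0] xM x(1) l by auto
    show ?thesis
    proof (rule listedI[OF b], rule listed_pair25I[OF f b,
        where a = "\<lambda>i j k. F (i \<odot> v3 + j \<odot> v4 + k \<odot> v5)" and l = \<alpha>])
      show "(F (i \<odot> v3 + j \<odot> v4 + k \<odot> v5), m \<odot> v2 + i \<odot> v3 + j \<odot> v4 + k \<odot> v5) \<in> B" for i j k m
        using G[OF in_ms(2)[of v2 m], of "i \<odot> v3 + j \<odot> v4 + k \<odot> v5"] l by (simp add: add.assoc)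
      show "(i, \<alpha> i \<odot> v2) \<in> A" for i using x(2)[of i] c(2) by simp
    qed (simp_all add: F_0 c(1))
  next
    case 3
    then obtain v2 v3 v4 v5 where l: "ms = [v3, v2]" "us = [v5, v4]"
      using lists_of_length(2)[of ms] lists_of_length(2)[of us] by auto
    then have b: "basis v2 v3 v4 v5" using us by (intro basis_if_span_list_UNIV) simp
    obtain \<alpha> \<beta> where c: "\<alpha> 0 = 0" "\<beta> 0 = 0" "\<forall>i. x i = \<alpha> i \<odot> v2 + \<beta> i \<odot> v3"
      using ex_coeff2[of x v3 v2 0] xM x(1) l by auto
    show ?thesis
    proof (rule listedI[OF b], rule listed_pair26I[OF f b,
        where a = "\<lambda>i j. F (i \<odot> v4 + j \<odot> v5)" and l = \<alpha> and m = \<beta>])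
      show "(F (i \<odot> v4 + j \<odot> v5), k \<odot> v2 + n \<odot> v3 + i \<odot> v4 + j \<odot> v5) \<in> B" for i j k n
        using G[OF in_ms(3)[OF in_ms(2)[of v2 k] in_ms(2)[of v3 n]], of "i \<odot> v4 + j \<odot> v5"] l
        by (simp add: add.assoc)
      show "(i, \<alpha> i \<odot> v2 + \<beta> i \<odot> v3) \<in> A" for i using x(2)[of i] c(3) by simp
    qed (simp_all add: F_0 c(1,2))
  next
    case 4
    then obtain v2 v3 v4 v5 where l: "ms = [v4, v3, v2]" "us = [v5]"
      using lists_of_length(3)[of ms] lists_of_length(1)[of us] by auto
    then have b: "basis v2 v3 v4 v5" using us by (intro basis_if_span_list_UNIV) simp
    obtain \<alpha> \<beta> \<gamma> where c: "\<alpha> 0 = 0" "\<beta> 0 = 0" "\<gamma> 0 = 0" "\<forall>i. x i = \<alpha> i \<odot> v2 + \<beta> i \<odot> v3 + \<gamma> i \<odot> v4"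
      using ex_coeff3[of x v4 v3 v2 0] xM x(1) l by auto
    show ?thesis
    proof (rule listedI[OF b], rule listed_pair27I[OF f b,
        where a = "\<lambda>i. F (i \<odot> v5)" and l = \<alpha> and m = \<beta> and n = \<gamma>])
      show "(F (i \<odot> v5), j \<odot> v2 + k \<odot> v3 + q \<odot> v4 + i \<odot> v5) \<in> B" for i j k q
        using G[OF in_ms(3)[OF in_ms(3)[OF in_ms(2)[of v2 j] in_ms(2)[of v3 k]] in_ms(2)[of v4 q]], of "i \<odot> v5"] l
        by (simp add: add.assoc)
      show "(i, \<alpha> i \<odot> v2 + \<beta> i \<odot> v3 + \<gamma> i \<odot> v4) \<in> A" for i using x(2)[of i] c(4) by simp
    qed (simp_all add: F_0 c(1-3))
  qed
qed

section \<open>The case \<open>card Q = 8\<close>\<close>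

text \<open>
  The periods of \<open>Q\<close> that are also periods of \<open>F\<close>; equivalently, the periods in \<open>V\<close> of the graph of \<open>F\<close> on
  \<open>Q\<close>.
\<close>

definition periods :: "bit4 set" where
  "periods = {k \<in> stab. \<forall>q. q + k \<in> Q \<longleftrightarrow> q \<in> Q}"

lemma subgrp_periods: "subgrp periods"
  using subgrp_stab unfolding subgrp_def periods_def
  by (simp add: add.assoc[symmetric] del: split_paired_All)

lemma periodsD: "k \<in> periods \<Longrightarrow> k + q \<in> Q \<longleftrightarrow> q \<in> Q" "k \<in> periods \<Longrightarrow> k \<in> stab"
  by (simp_all add: periods_def add.commute[of k q] del: split_paired_All)

lemma slice_eq_pair:
  assumes "card Q = 8" "(s, a) \<in> A" "(s, a') \<in> A" "a \<noteq> a'"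
  shows "(s, x) \<in> A \<longleftrightarrow> x = a \<or> x = a'"
proof -
  have "card (slice A s) = 2" using card_slice[of s] assms(1) by simp
  moreover have "{a, a'} \<subseteq> slice A s" using assms by (simp add: slice_def)
  ultimately have "slice A s = {a, a'}"
    using assms(4) by (metis card_2_iff card_subset_eq finite)
  then show ?thesis unfolding slice_def by blast
qed

lemma slice_pair:
  assumes "card Q = 8" "(s, a) \<in> A"
  obtains a' where "(s, a') \<in> A" "a' \<noteq> a"
proof -
  have "card (slice A s) = 2" using card_slice[of s] assms(1) by simp
  then have "slice A s \<noteq> {a}" by auto
  then show ?thesis using that assms(2) unfolding slice_def by blast
qed

text \<open>
  A slice \<open>{a, a'}\<close> and \<open>Q\<close> factorize \<open>V\<close> if and only if \<open>Q\<close> contains exactly one element of each pair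
  \<open>{v, v + (a + a')}\<close>. So translation by \<open>a + a'\<close> interchanges \<open>Q\<close> with its complement.
\<close>

lemma Q_difference_iff:
  assumes "card Q = 8" "(s, a) \<in> A" "(s, a') \<in> A" "a \<noteq> a'"
  shows "v + (a + a') \<in> Q \<longleftrightarrow> v \<notin> Q"
proof
  assume "v + (a + a') \<in> Q"
  moreover have "a + v = a' + (v + (a + a'))" by (simp add: ac_simps)
  ultimately show "v \<notin> Q" using unique(1)[OF assms(2,3)] assms(4) by blast
next
  assume v: "v \<notin> Q"
  obtain y q where y: "(s, y) \<in> A" "q \<in> Q" "v + a = y + q" by (rule cover)
  from y(1) have "y = a \<or> y = a'" using slice_eq_pair[OF assms] by simp
  moreover have "y \<noteq> a"
  proof
    assume "y = a"
    then have "v = q" using y(3) by (simp add: add.commute)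
    then show False using v y by simp
  qed
  ultimately have "v + a = a' + q" using y by simp
  then have "v + (a + a') = q" by (metis add.assoc add.commute bit4_add_left_self)
  then show "v + (a + a') \<in> Q" using y by simp
qed

lemma slice_difference_in_stab:
  assumes "card Q = 8" "(s, a) \<in> A" "(s, a') \<in> A"
  shows "a + a' \<in> stab"
proof (cases "a = a'")
  case True
  then show ?thesis using subgrp_zero[OF subgrp_stab] by simp
next
  case False
  have "F (v + (a + a')) = F v" for v
  proof -
    obtain y q where y: "(s, y) \<in> A" "q \<in> Q" "v = y + q" by (rule cover)
    from y(1) have "y = a \<or> y = a'" using slice_eq_pair[OF assms False] by simp
    then have "v + (a + a') = a' + q \<or> v + (a + a') = a + q"
      using y(3) by (auto simp: ac_simps simp del: split_paired_All)
    then show ?thesis using const y assms by metis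
  qed
  then show ?thesis unfolding stab_def by blast
qed

text \<open>
  The slice at \<open>0\<close> contains the zero vector, so it consists of differences and lies in \<open>stab\<close>. An
  arbitrary vector is the sum of an element \<open>y\<close> of this slice and some \<open>q \<in> Q\<close>, and both \<open>F (y + q)\<close> and
  \<open>F (y + q + a)\<close> are equal to \<open>F q\<close>.
\<close>

lemma slice_subset_stab:
  assumes "card Q = 8" "(s, a) \<in> A"
  shows "a \<in> stab"
proof -
  have "F (v + a) = F v" for v
  proof -
    obtain y q where y: "(0, y) \<in> A" "q \<in> Q" "v = y + q" by (rule cover)
    have "y + 0 \<in> stab" using slice_difference_in_stab[OF assms(1) y(1) zero_A] .
    then have "F (y + (a + q)) = F (a + q)" using stabD(2) by simp
    then show ?thesis using const[OF assms(2) y(2)] const[OF y(1,2)] y(3) by (simp add: ac_simps)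
  qed
  then show ?thesis unfolding stab_def by blast
qed

text \<open>
  The coefficient of \<open>h\<close> that moves \<open>v\<close> into \<open>Q\<close>, where \<open>h\<close> is a vector by which translation interchanges
  \<open>Q\<close> with its complement.
\<close>

definition pick :: "bit4 \<Rightarrow> bit" where
  "pick v = (if v \<in> Q then 0 else 1)"

lemma pick_0 [simp]: "pick 0 = 0"
  by (simp add: pick_def zero_Q)

text \<open>
  Let \<open>{0, h}\<close> be the slice at \<open>0\<close>. Translations by \<open>h\<close> and by the difference of any other slice both
  interchange \<open>Q\<close> with its complement, so their sum is a period of \<open>Q\<close>. Hence every slice has the form
  \<open>{u + \<kappa>\<^sub>0, u + h + \<kappa>\<^sub>1}\<close> with \<open>\<kappa>\<^sub>0\<close> and \<open>\<kappa>\<^sub>1\<close> in \<open>periods\<close>, where \<open>u\<close> can be taken from a complement of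
  \<open>\<langle>h\<rangle> + periods\<close> in \<open>stab\<close>, spanned by \<open>ws\<close>.
\<close>

lemma adapted_basis_if_card_8:
  assumes "card Q = 8"
  obtains ks ws h us u \<kappa> where
    "span_list ks = periods" "independent_list ks"
    "span_list (ws @ h # ks) = stab" "independent_list (ws @ h # ks)"
    "span_list (us @ ws @ h # ks) = UNIV" "length us + length ws + length ks = 3"
    "\<And>k v. k \<in> span_list ks \<Longrightarrow> k + (pick v \<odot> h + v) \<in> Q"
    "h \<in> stab"
    "u 0 = 0" "\<And>s. u s \<in> span_list ws" "\<kappa> 0 0 = 0" "\<And>s j. \<kappa> s j \<in> span_list ks"
    "\<And>s j. (s, u s + j \<odot> h + \<kappa> s j) \<in> A"
proof -
  obtain h where h: "(0, h) \<in> A" "h \<noteq> 0" using slice_pair[OF assms zero_A] .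
  have hQ: "v + h \<in> Q \<longleftrightarrow> v \<notin> Q" for v
    using Q_difference_iff[OF assms zero_A h(1), of v] h by simp
  have h_stab: "h \<in> stab" using slice_subset_stab[OF assms h(1)] .
  have h_K: "h \<notin> periods" using hQ[of 0] periodsD(1)[of h 0] zero_Q by auto
  obtain ks where ks: "span_list ks = periods" "independent_list ks"
    using ex_basis_list[OF subgrp_periods] .
  have ind: "independent_list (h # ks)" using independent_list_Cons ks h_K by simp
  have sub: "span_list (h # ks) \<subseteq> stab"
  proof (rule span_list_subset[OF subgrp_stab])
    have "set ks \<subseteq> periods" using set_subset_span_list[of ks] ks by simp
    then show "set (h # ks) \<subseteq> stab" using h_stab periodsD(2) by auto
  qed
  obtain ws where ws: "span_list (ws @ h # ks) = stab" "independent_list (ws @ h # ks)"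
    using extend_to_basis[OF subgrp_stab sub ind] .
  obtain us where us: "span_list (us @ ws @ h # ks) = UNIV" "length us + length (ws @ h # ks) = 4"
    using extend_to_UNIV[OF ws(2)] .
  have pick: "k + (pick v \<odot> h + v) \<in> Q" if "k \<in> span_list ks" for k v
  proof -
    have "pick v \<odot> h + v \<in> Q" using hQ[of v] by (simp add: pick_def add.commute)
    then show ?thesis using that periodsD(1) ks by simp
  qed
  have *: "\<exists>u. (s = 0 \<longrightarrow> u = 0) \<and> u \<in> span_list ws \<and>
     (\<forall>j. \<exists>k. (s = 0 \<and> j = 0 \<longrightarrow> k = 0) \<and> k \<in> span_list ks \<and> (s, u + j \<odot> h + k) \<in> A)" for s
  proof (cases "s = 0")
    case True
    \<comment> \<open>At \<open>s = 0\<close> all choices are zero, as the list requires.\<close>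
    have "(0, 0 + j \<odot> h + 0) \<in> A" for j using h zero_A by (cases j) simp_all
    then show ?thesis
      using True subgrp_zero[OF subgrp_span_list] by blast
  next
    case False
    obtain x q where x: "(s, x) \<in> A" "q \<in> Q" "0 = x + q" by (rule cover)
    obtain x' where x': "(s, x') \<in> A" "x' \<noteq> x" using slice_pair[OF assms x(1)] .
    have hK: "h + (x + x') \<in> span_list ks"
    proof -
      have "q + (h + (x + x')) \<in> Q \<longleftrightarrow> q \<in> Q" for q
        using Q_difference_iff[OF assms x(1) x'(1) x'(2)[symmetric], of "q + h"] hQ[of q]
        by (simp add: add.assoc)
      moreover have "h + (x + x') \<in> stab"
        using subgrp_add[OF subgrp_stab h_stab] slice_difference_in_stab[OF assms x(1) x'(1)] .
      ultimately show ?thesis unfolding ks periods_def by blast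
    qed
    have "x \<in> span_list (ws @ h # ks)" using slice_subset_stab[OF assms x(1)] ws by simp
    then obtain u y where u: "u \<in> span_list ws" "y \<in> span_list (h # ks)" "x = u + y"
      by (rule in_span_list_append)
    then obtain b k where y: "y = b \<odot> h + k" "k \<in> span_list ks"
      unfolding span_list.simps by blast
    \<comment> \<open>The coefficient \<open>b\<close> of \<open>h\<close> in \<open>x\<close> decides which of \<open>x\<close> and \<open>x'\<close> is the element for the index \<open>j\<close>.\<close>
    have "\<exists>k. (s = 0 \<and> j = 0 \<longrightarrow> k = 0) \<and> k \<in> span_list ks \<and> (s, u + j \<odot> h + k) \<in> A" for j
    proof (cases "j = b")
      case True
      then show ?thesis using False x(1) y u by (auto simp: add.assoc simp del: split_paired_Ex)
    next
      case False
      then have "j = b + 1" by (cases j; cases b) simp_all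
      then have "u + j \<odot> h + (k + (h + (x + x'))) = x'"
        by (simp add: bscale_add_left u(3) y(1) ac_simps)
      moreover have "k + (h + (x + x')) \<in> span_list ks"
        using subgrp_add[OF subgrp_span_list y(2) hK] .
      ultimately show ?thesis using \<open>s \<noteq> 0\<close> x'(1) by metis
    qed
    then show ?thesis using u(1) False by blast
  qed
  obtain u where u: "\<And>s. s = 0 \<longrightarrow> u s = 0" "\<And>s. u s \<in> span_list ws"
    "\<And>s. (\<forall>j. \<exists>k. (s = 0 \<and> j = 0 \<longrightarrow> k = 0) \<and> k \<in> span_list ks \<and> (s, u s + j \<odot> h + k) \<in> A)"
    using * by metis
  obtain \<kappa> where \<kappa>: "\<And>s j. s = 0 \<and> j = 0 \<longrightarrow> \<kappa> s j = 0" "\<And>s j. \<kappa> s j \<in> span_list ks"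
     "\<And>s j. (s, u s + j \<odot> h + \<kappa> s j) \<in> A"
    using u(3) by metis
  show ?thesis
    by (rule that[OF ks ws us(1) _ pick h_stab _ u(2) _ \<kappa>(2,3)])
      (use us(2) u(1)[of 0] \<kappa>(1)[of 0 0] in simp_all)
qed

text \<open>
  Here \<open>F\<close> vanishes, and the dimension of \<open>periods\<close>, at most three since \<open>h\<close> is not a period,
  distinguishes the four cases.
\<close>

lemma listed_2_to_5:
  assumes Q8: "card Q = 8" and M: "stab = UNIV"
  shows "listed A B"
proof -
  obtain ks ws h us u \<kappa> where ks: "span_list ks = periods" "independent_list ks"
    and ws: "span_list (ws @ h # ks) = stab" "independent_list (ws @ h # ks)"
    and "span_list (us @ ws @ h # ks) = UNIV" "length us + length ws + length ks = 3"
    and pick: "\<And>k v. k \<in> span_list ks \<Longrightarrow> k + (pick v \<odot> h + v) \<in> Q"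
    and "h \<in> stab"
    and u: "u 0 = 0" "\<And>s. u s \<in> span_list ws"
    and \<kappa>: "\<kappa> 0 0 = 0" "\<And>s j. \<kappa> s j \<in> span_list ks"
    and A: "\<And>s j. (s, u s + j \<odot> h + \<kappa> s j) \<in> A"
    by (rule adapted_basis_if_card_8[OF Q8]) blast
  have sp: "span_list (ws @ h # ks) = UNIV" using ws M by simp
  have len: "length ws + length ks = 3" using length_if_span_list_UNIV[OF sp ws(2)] by simp
  have Bpick: "(0, k + (pick v \<odot> h + v)) \<in> B" if "k \<in> span_list ks" for k v
    using pick[OF that] F_eq_0_if_stab_UNIV[OF M] by (intro graphI) simp_all
  have in_ks: "0 \<in> span_list ks" "\<And>b v. v \<in> set ks \<Longrightarrow> b \<odot> v \<in> span_list ks"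
    "\<And>u v. u \<in> span_list ks \<Longrightarrow> v \<in> span_list ks \<Longrightarrow> u + v \<in> span_list ks"
    by (meson subgrp_zero subgrp_bscale set_subset_span_list subsetD subgrp_add subgrp_span_list)+
  note f = graph_factorization
  consider "length ks = 0" "length ws = 3" | "length ks = 1" "length ws = 2"
    | "length ks = 2" "length ws = 1" | "length ks = 3" "length ws = 0"
    using len by linarith
  then show ?thesis
  proof cases
    case 1
    then obtain v3 v4 v5 where l: "ks = []" "ws = [v5, v4, v3]"
      using lists_of_length(3)[of ws] by auto
    then have b: "basis h v3 v4 v5" using sp by (intro basis_if_span_list_UNIV) simp
    have \<kappa>0: "\<kappa> s j = 0" for s j using \<kappa>(2)[of s j] l by simp
    obtain \<alpha> \<beta> \<gamma> where c: "\<alpha> 0 = 0" "\<beta> 0 = 0" "\<gamma> 0 = 0" "\<forall>i. u i = \<alpha> i \<odot> v3 + \<beta> i \<odot> v4 + \<gamma> i \<odot> v5"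
      using ex_coeff3[of u v5 v4 v3 0] u l by auto
    show ?thesis
    proof (rule listedI[OF b], rule listed_pair2I[OF f b,
        where a = \<alpha> and b = \<beta> and c = \<gamma> and l = "\<lambda>i j k. pick (i \<odot> v3 + j \<odot> v4 + k \<odot> v5)"])
      show "(i, j \<odot> h + \<alpha> i \<odot> v3 + \<beta> i \<odot> v4 + \<gamma> i \<odot> v5) \<in> A" for i j
        using A[of i j] by (simp add: \<kappa>0 c(4) ac_simps)
      show "(0, pick (i \<odot> v3 + j \<odot> v4 + k \<odot> v5) \<odot> h + i \<odot> v3 + j \<odot> v4 + k \<odot> v5) \<in> B" for i j k
        using Bpick[OF in_ks(1), of "i \<odot> v3 + j \<odot> v4 + k \<odot> v5"] by (simp only: add.assoc add_0)
    qed (simp_all add: c(1-3))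
  next
    case 2
    then obtain v2 v4 v5 where l: "ks = [v2]" "ws = [v5, v4]"
      using lists_of_length(1)[of ks] lists_of_length(2)[of ws] by auto
    then have b: "basis v2 h v4 v5" using sp by (intro basis_if_span_list_UNIV) simp
    obtain \<gamma> where d: "\<gamma> 0 0 = 0" "\<forall>i j. \<kappa> i j = \<gamma> i j \<odot> v2"
      using ex_coeff1_curried[of \<kappa> v2] \<kappa> l by auto
    obtain \<alpha> \<beta> where c: "\<alpha> 0 = 0" "\<beta> 0 = 0" "\<forall>i. u i = \<alpha> i \<odot> v4 + \<beta> i \<odot> v5"
      using ex_coeff2[of u v5 v4 0] u l by auto
    show ?thesis
    proof (rule listedI[OF b], rule listed_pair3I[OF f b,
        where ?a2.0 = \<gamma> and a = \<alpha> and b = \<beta> and l = "\<lambda>i j. pick (i \<odot> v4 + j \<odot> v5)"])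
      show "(i, \<gamma> i j \<odot> v2 + j \<odot> h + \<alpha> i \<odot> v4 + \<beta> i \<odot> v5) \<in> A" for i j
        using A[of i j] by (simp add: d(2) c(3) ac_simps)
      show "(0, k \<odot> v2 + pick (i \<odot> v4 + j \<odot> v5) \<odot> h + i \<odot> v4 + j \<odot> v5) \<in> B" for i j k
        using Bpick[OF in_ks(2)[of v2 k], of "i \<odot> v4 + j \<odot> v5"] l by (simp add: add.assoc)
    qed (simp_all add: c(1,2) d(1))
  next
    case 3
    then obtain v2 v3 v5 where l: "ks = [v3, v2]" "ws = [v5]"
      using lists_of_length(2)[of ks] lists_of_length(1)[of ws] by auto
    then have b: "basis v2 v3 h v5" using sp by (intro basis_if_span_list_UNIV) simp
    obtain \<gamma> \<delta> where d: "\<gamma> 0 0 = 0" "\<delta> 0 0 = 0" "\<forall>i j. \<kappa> i j = \<gamma> i j \<odot> v2 + \<delta> i j \<odot> v3"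
      using ex_coeff2_curried[of \<kappa> v3 v2] \<kappa> l by auto
    obtain \<alpha> where c: "\<alpha> 0 = 0" "\<forall>i. u i = \<alpha> i \<odot> v5"
      using ex_coeff1[of u v5 0] u l by auto
    show ?thesis
    proof (rule listedI[OF b], rule listed_pair4I[OF f b,
        where ?a2.0 = \<gamma> and ?b2.0 = \<delta> and a = \<alpha> and l = "\<lambda>i. pick (i \<odot> v5)"])
      show "(i, \<gamma> i j \<odot> v2 + \<delta> i j \<odot> v3 + j \<odot> h + \<alpha> i \<odot> v5) \<in> A" for i j
        using A[of i j] by (simp add: d(3) c(2) ac_simps)
      show "(0, j \<odot> v2 + k \<odot> v3 + pick (i \<odot> v5) \<odot> h + i \<odot> v5) \<in> B" for i j k
        using Bpick[OF in_ks(3)[OF in_ks(2)[of v2 j] in_ks(2)[of v3 k]], of "i \<odot> v5"] l by (simp add: add.assoc)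
    qed (simp_all add: c(1) d(1,2))
  next
    case 4
    then obtain v2 v3 v4 where l: "ks = [v4, v3, v2]" "ws = []"
      using lists_of_length(3)[of ks] by auto
    then have b: "basis v2 v3 v4 h" using sp by (intro basis_if_span_list_UNIV) simp
    obtain \<gamma> \<delta> \<epsilon> where d: "\<gamma> 0 0 = 0" "\<delta> 0 0 = 0" "\<epsilon> 0 0 = 0"
      "\<forall>i j. \<kappa> i j = \<gamma> i j \<odot> v2 + \<delta> i j \<odot> v3 + \<epsilon> i j \<odot> v4"
      using ex_coeff3_curried[of \<kappa> v4 v3 v2] \<kappa> l by auto
    have u0: "u s = 0" for s using u(2)[of s] l by simp
    show ?thesis
    proof (rule listedI[OF b], rule listed_pair5I[OF f b,
        where ?a2.0 = \<gamma> and ?b2.0 = \<delta> and ?c2.0 = \<epsilon>])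
      show "(i, \<gamma> i j \<odot> v2 + \<delta> i j \<odot> v3 + \<epsilon> i j \<odot> v4 + j \<odot> h) \<in> A" for i j
        using A[of i j] by (simp add: d(4) u0 ac_simps)
      show "(0, i \<odot> v2 + j \<odot> v3 + k \<odot> v4) \<in> B" for i j k
        using Bpick[OF in_ks(3)[OF in_ks(3)[OF in_ks(2)[of v2 i] in_ks(2)[of v3 j]] in_ks(2)[of v4 k]], of 0] l
        by (simp add: add.assoc)
    qed (simp_all add: d(1-3))
  qed
qed

text \<open>
  As \<open>stab\<close> is proper, there is a basis vector outside it. The dimensions of \<open>periods\<close> and \<open>stab\<close> leave
  six cases; in one of them \<open>periods\<close> has order four, and then \<open>Q\<close> is a union of two of its cosets and
  hence a proper subgroup, against \<open>gen\<close>.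
\<close>

lemma listed_13_to_18:
  assumes Q8: "card Q = 8" and M: "stab \<noteq> UNIV" and gen: "\<And>H. subgrp H \<Longrightarrow> Q \<subseteq> H \<Longrightarrow> H = UNIV"
  shows "listed B A"
proof -
  obtain ks ws h us u \<kappa> where ks: "span_list ks = periods" "independent_list ks"
    and ws: "span_list (ws @ h # ks) = stab" "independent_list (ws @ h # ks)"
    and us: "span_list (us @ ws @ h # ks) = UNIV" "length us + length ws + length ks = 3"
    and pick: "\<And>k v. k \<in> span_list ks \<Longrightarrow> k + (pick v \<odot> h + v) \<in> Q"
    and h: "h \<in> stab"
    and u: "u 0 = 0" "\<And>s. u s \<in> span_list ws"
    and \<kappa>: "\<kappa> 0 0 = 0" "\<And>s j. \<kappa> s j \<in> span_list ks"
    and A: "\<And>s j. (s, u s + j \<odot> h + \<kappa> s j) \<in> A"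
    by (rule adapted_basis_if_card_8[OF Q8]) blast
  have "us \<noteq> []" using us ws M by auto
  have Bpick: "(F (w + v), k + (pick (w + v) \<odot> h + (w + v))) \<in> B" if "k \<in> span_list ks" for k v w
  proof -
    have "k \<in> stab" using that ks periodsD(2) by simp
    then have "F (k + (pick (w + v) \<odot> h + (w + v))) = F (w + v)"
      using stabD(2) subgrp_bscale[OF subgrp_stab h] by simp
    then show ?thesis using pick[OF that] by (intro graphI)
  qed
  have in_ks: "0 \<in> span_list ks" "\<And>b v. v \<in> set ks \<Longrightarrow> b \<odot> v \<in> span_list ks"
    by (meson subgrp_zero subgrp_bscale set_subset_span_list subsetD subgrp_span_list)+
  have ws_stab: "b \<odot> v \<in> stab" if "v \<in> set ws" for b v
  proof -
    have "set ws \<subseteq> stab" using set_subset_span_list[of "ws @ h # ks"] ws by simp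
    then show ?thesis using that subgrp_bscale[OF subgrp_stab] by blast
  qed
  have not_2: "length ks \<noteq> 2"
  proof
    assume "length ks = 2"
    then have "card periods = 4" using ks by (simp add: independent_list_def)
    then have "subgrp Q"
      using periodsD(1) zero_Q Q8 by (intro subgrp_if_union_of_two_cosets[OF subgrp_periods]) simp_all
    then have "Q = UNIV" using gen by blast
    then show False using Q8 by simp
  qed
  note f = factorization_swap
  consider "length ks = 0" "length ws = 0" "length us = 3" | "length ks = 0" "length ws = 1" "length us = 2"
    | "length ks = 0" "length ws = 2" "length us = 1"
    | "length ks = 1" "length ws = 0" "length us = 2" | "length ks = 1" "length ws = 1" "length us = 1"
  proof -
    have "length us \<noteq> 0" using \<open>us \<noteq> []\<close> by simp
    then have "length ks = 0 \<and> length ws = 0 \<and> length us = 3 \<or> length ks = 0 \<and> length ws = 1 \<and> length us = 2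
      \<or> length ks = 0 \<and> length ws = 2 \<and> length us = 1
      \<or> length ks = 1 \<and> length ws = 0 \<and> length us = 2 \<or> length ks = 1 \<and> length ws = 1 \<and> length us = 1"
      using us(2) not_2 by presburger
    then show thesis using that by blast
  qed
  then show ?thesis
  proof cases
    case 1
    then obtain v3 v4 v5 where l: "ks = []" "ws = []" "us = [v5, v4, v3]"
      using lists_of_length(3)[of us] by auto
    then have b: "basis h v3 v4 v5" using us by (intro basis_if_span_list_UNIV) simp
    have 0: "u s = 0" "\<kappa> s j = 0" for s j using u(2)[of s] \<kappa>(2)[of s j] l by simp_all
    let ?v = "\<lambda>i j k. i \<odot> v3 + j \<odot> v4 + k \<odot> v5"
    show ?thesis
    proof (rule listedI[OF b], rule listed_pair18I[OF f b odd_card,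
        where a_p = "\<lambda>i j k. F (?v i j k)" and a_b = "\<lambda>i j k. pick (?v i j k)"])
      show "(F (?v i j k), pick (?v i j k) \<odot> h + i \<odot> v3 + j \<odot> v4 + k \<odot> v5) \<in> B" for i j k
        using Bpick[OF in_ks(1), of 0 "?v i j k"] by (simp only: add.assoc add_0)
      show "(i, j \<odot> h) \<in> A" for i j using A[of i j] 0 by simp
    qed (simp_all add: F_0)
  next
    case 2
    then obtain v3 v4 v5 where l: "ks = []" "ws = [v3]" "us = [v5, v4]"
      using lists_of_length(1)[of ws] lists_of_length(2)[of us] by auto
    then have b: "basis h v3 v4 v5" using us by (intro basis_if_span_list_UNIV) simp
    have 0: "\<kappa> s j = 0" for s j using \<kappa>(2)[of s j] l by simp
    obtain \<alpha> where c: "\<alpha> 0 = 0" "\<forall>i. u i = \<alpha> i \<odot> v3"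
      using ex_coeff1[of u v3 0] u l by auto
    let ?v = "\<lambda>i j. i \<odot> v4 + j \<odot> v5"
    show ?thesis
    proof (rule listedI[OF b], rule listed_pair15I[OF f b,
        where ?a2.0 = "\<lambda>i j. F (?v i j)" and ?a3.0 = "\<lambda>i j k. pick (k \<odot> v3 + ?v i j)" and l = \<alpha>])
      show "(F (?v i j), pick (k \<odot> v3 + ?v i j) \<odot> h + k \<odot> v3 + i \<odot> v4 + j \<odot> v5) \<in> B" for i j k
        using Bpick[OF in_ks(1), of "k \<odot> v3" "?v i j"] stabD(2)[OF ws_stab[of v3 k], of "?v i j"] l
        by (simp add: add.assoc)
      show "(i, j \<odot> h + \<alpha> i \<odot> v3) \<in> A" for i j using A[of i j] 0 c(2) by (simp add: add.commute)
    qed (simp_all add: F_0 c(1))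
  next
    case 3
    then obtain v3 v4 v5 where l: "ks = []" "ws = [v4, v3]" "us = [v5]"
      using lists_of_length(2)[of ws] lists_of_length(1)[of us] by auto
    then have b: "basis h v3 v4 v5" using us by (intro basis_if_span_list_UNIV) simp
    have 0: "\<kappa> s j = 0" for s j using \<kappa>(2)[of s j] l by simp
    obtain \<alpha> \<beta> where c: "\<alpha> 0 = 0" "\<beta> 0 = 0" "\<forall>i. u i = \<alpha> i \<odot> v3 + \<beta> i \<odot> v4"
      using ex_coeff2[of u v4 v3 0] u l by auto
    show ?thesis
    proof (rule listedI[OF b], rule listed_pair16I[OF f b,
        where a = "\<lambda>i. F (i \<odot> v5)" and ?a3.0 = "\<lambda>i j k. pick ((j \<odot> v3 + k \<odot> v4) + i \<odot> v5)" and l = \<alpha> and m = \<beta>])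
      show "(F (i \<odot> v5), pick ((j \<odot> v3 + k \<odot> v4) + i \<odot> v5) \<odot> h + j \<odot> v3 + k \<odot> v4 + i \<odot> v5) \<in> B" for i j k
        using Bpick[OF in_ks(1), of "j \<odot> v3 + k \<odot> v4" "i \<odot> v5"]
          stabD(2)[OF subgrp_add[OF subgrp_stab ws_stab[of v3 j] ws_stab[of v4 k]], of "i \<odot> v5"] l
        by (simp add: add.assoc)
      show "(i, j \<odot> h + \<alpha> i \<odot> v3 + \<beta> i \<odot> v4) \<in> A" for i j using A[of i j] 0 c(3) by (simp add: ac_simps)
    qed (simp_all add: F_0 c(1,2))
  next
    case 4
    then obtain v2 v4 v5 where l: "ks = [v2]" "ws = []" "us = [v5, v4]"
      using lists_of_length(1)[of ks] lists_of_length(2)[of us] by auto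
    then have b: "basis v2 h v4 v5" using us by (intro basis_if_span_list_UNIV) simp
    have 0: "u s = 0" for s using u(2)[of s] l by simp
    obtain \<gamma> where d: "\<gamma> 0 0 = 0" "\<forall>i j. \<kappa> i j = \<gamma> i j \<odot> v2"
      using ex_coeff1_curried[of \<kappa> v2] \<kappa> l by auto
    let ?v = "\<lambda>i j. i \<odot> v4 + j \<odot> v5"
    show ?thesis
    proof (rule listedI[OF b], rule listed_pair14I[OF f b odd_card,
        where a_p = "\<lambda>i j. F (?v i j)" and a_b = "\<lambda>i j. pick (?v i j)" and ?l2.0 = \<gamma>])
      show "(F (?v i j), k \<odot> v2 + pick (?v i j) \<odot> h + i \<odot> v4 + j \<odot> v5) \<in> B" for i j k
        using Bpick[OF in_ks(2)[of v2 k], of 0 "?v i j"] l by (simp add: add.assoc)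
      show "(i, \<gamma> i j \<odot> v2 + j \<odot> h) \<in> A" for i j using A[of i j] 0 d(2) by (simp add: add.commute)
    qed (simp_all add: F_0 d(1))
  next
    case 5
    then obtain v2 v4 v5 where l: "ks = [v2]" "ws = [v4]" "us = [v5]"
      using lists_of_length(1)[of ks] lists_of_length(1)[of ws] lists_of_length(1)[of us] by auto
    then have b: "basis v2 h v4 v5" using us by (intro basis_if_span_list_UNIV) simp
    obtain \<gamma> where d: "\<gamma> 0 0 = 0" "\<forall>i j. \<kappa> i j = \<gamma> i j \<odot> v2"
      using ex_coeff1_curried[of \<kappa> v2] \<kappa> l by auto
    obtain \<alpha> where c: "\<alpha> 0 = 0" "\<forall>i. u i = \<alpha> i \<odot> v4"
      using ex_coeff1[of u v4 0] u l by auto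
    show ?thesis
    proof (rule listedI[OF b], rule listed_pair13I[OF f b,
        where a = "\<lambda>i. F (i \<odot> v5)" and ?a2.0 = "\<lambda>i j. pick (j \<odot> v4 + i \<odot> v5)" and ?l2.0 = \<gamma> and l = \<alpha>])
      show "(F (i \<odot> v5), k \<odot> v2 + pick (j \<odot> v4 + i \<odot> v5) \<odot> h + j \<odot> v4 + i \<odot> v5) \<in> B" for i j k
        using Bpick[OF in_ks(2)[of v2 k], of "j \<odot> v4" "i \<odot> v5"] stabD(2)[OF ws_stab[of v4 j], of "i \<odot> v5"] l
        by (simp add: add.assoc)
      show "(i, \<gamma> i j \<odot> v2 + j \<odot> h + \<alpha> i \<odot> v4) \<in> A" for i j
        using A[of i j] d(2) c(2) by (simp add: ac_simps)
    qed (simp_all add: F_0 c(1) d(1))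
  qed
qed

section \<open>The case \<open>card Q = 2\<close>\<close>

text \<open>
  If \<open>F b = 0\<close>, every slice is an arbitrary transversal of \<open>\<langle>b\<rangle>\<close>. Otherwise \<open>F\<close> tells the two parts \<open>a\<close>
  and \<open>a + b\<close> of a sum apart, so all slices are equal to the zero set of \<open>F\<close>.
\<close>

lemma listed_20_24:
  assumes Q: "Q = {0, b}" and b: "b \<noteq> 0"
  shows "listed A B"
proof -
  have "independent_list [b]" using independent_list_Cons[OF independent_Nil] b by simp
  then obtain us where us: "span_list (us @ [b]) = UNIV" "length us + length [b] = 4"
    by (rule extend_to_UNIV)
  then obtain v3 v4 v5 where "us = [v5, v4, v3]" using lists_of_length(3)[of us] by auto
  then have basis: "basis b v3 v4 v5" using us by (intro basis_if_span_list_UNIV) simp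
  note f = graph_factorization
  let ?v = "\<lambda>i j k. i \<odot> v3 + j \<odot> v4 + k \<odot> v5"
  show ?thesis
  proof (cases "F b = 0")
    case True
    define \<alpha> where "\<alpha> s v = (if (s, v) \<in> A then 0 else (1 :: bit))" for s v
    have \<alpha>: "(s, \<alpha> s v \<odot> b + v) \<in> A" for s v
    proof -
      obtain a q where a: "(s, a) \<in> A" "q \<in> Q" "v = a + q" by (rule cover)
      then have "q = 0 \<or> q = b" using Q by blast
      then show ?thesis
      proof
        assume "q = b"
        then have "b + v = a" using a(3) by (simp add: add.left_commute)
        then show ?thesis using a(1) by (simp add: \<alpha>_def)
      qed (use a in \<open>simp add: \<alpha>_def\<close>)
    qed
    show ?thesis
    proof (rule listedI[OF basis], rule listed_pair24I[OF f basis,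
        where a = "\<lambda>s i j k. \<alpha> s (?v i j k)"])
      show "(s, \<alpha> s (?v i j k) \<odot> b + i \<odot> v3 + j \<odot> v4 + k \<odot> v5) \<in> A" for s i j k
        using \<alpha>[of s "?v i j k"] by (simp only: add.assoc)
      show "(0, i \<odot> b) \<in> B" for i
        using True F_0 Q by (intro graphI) (cases i; simp)+
      show "\<alpha> 0 (?v 0 0 0) = 0" using zero_A by (simp add: \<alpha>_def)
    qed
  next
    case False
    define \<alpha> where "\<alpha> v = (if F v = 0 then 0 else (1 :: bit))" for v
    have \<alpha>: "(s, \<alpha> v \<odot> b + v) \<in> A" for s v
    proof -
      obtain a q where a: "(s, a) \<in> A" "q \<in> Q" "v = a + q" by (rule cover)
      then have "F v = F q" using const by simp
      from a have "q = 0 \<or> q = b" using Q by blast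
      then show ?thesis
      proof
        assume "q = b"
        then have "b + v = a" using a(3) by (simp add: add.left_commute)
        then show ?thesis using a(1) \<open>F v = F q\<close> \<open>q = b\<close> False by (simp add: \<alpha>_def)
      qed (use a F_0 \<open>F v = F q\<close> in \<open>simp add: \<alpha>_def\<close>)
    qed
    show ?thesis
    proof (rule listedI[OF basis], rule listed_pair20I[OF f basis,
        where a = "\<lambda>i j k. \<alpha> (?v i j k)" and l = "\<lambda>i. F (i \<odot> b)"])
      show "(s, \<alpha> (?v i j k) \<odot> b + i \<odot> v3 + j \<odot> v4 + k \<odot> v5) \<in> A" for s i j k
        using \<alpha>[of s "?v i j k"] by (simp only: add.assoc)
      show "(F (i \<odot> b), i \<odot> b) \<in> B" for i
        using Q by (intro graphI) (cases i; simp)+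
    qed (simp_all add: F_0 \<alpha>_def)
  qed
qed

section \<open>The case \<open>card Q = 4\<close>\<close>

lemma listed_12:
  assumes Q: "Q = {0, b, c, b + c}" and bc: "b \<noteq> 0" "c \<noteq> 0" "b \<noteq> c" and F: "\<And>q. q \<in> Q \<Longrightarrow> F q = 0"
  shows "listed A B"
proof -
  have "c \<notin> span_list [b]" using bc by (auto dest!: in_span_listD(2) simp: bscale_def split: if_splits)
  then have "independent_list [c, b]"
    using independent_list_Cons[OF independent_list_Cons[OF independent_Nil]] bc by simp
  then obtain us where us: "span_list (us @ [c, b]) = UNIV" "length us + length [c, b] = 4"
    by (rule extend_to_UNIV)
  then obtain v4 v5 where "us = [v5, v4]" using lists_of_length(2)[of us] by auto
  then have basis: "basis b c v4 v5" using us by (intro basis_if_span_list_UNIV) simp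
  have inQ: "i \<odot> b + j \<odot> c \<in> Q" for i j
    using Q by (cases i; cases j) simp_all
  have "\<exists>\<alpha> \<beta>. ((s, v) \<in> A \<longrightarrow> \<alpha> = 0 \<and> \<beta> = 0) \<and> (s, \<alpha> \<odot> b + \<beta> \<odot> c + v) \<in> A" for s v
  proof (cases "(s, v) \<in> A")
    case True
    then show ?thesis by (intro exI[of _ 0]) simp
  next
    case False
    obtain a q where a: "(s, a) \<in> A" "q \<in> Q" "v = a + q" by (rule cover)
    have "q = 0 \<odot> b + 0 \<odot> c \<or> q = 1 \<odot> b + 0 \<odot> c \<or> q = 0 \<odot> b + 1 \<odot> c \<or> q = 1 \<odot> b + 1 \<odot> c"
      using a(2) unfolding Q by simp
    then obtain \<alpha> \<beta> where q: "q = \<alpha> \<odot> b + \<beta> \<odot> c" by blast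
    have "q + v = a" using a(3) by (simp add: add.left_commute)
    then show ?thesis using False a(1) q by metis
  qed
  then obtain \<alpha> \<beta> where \<alpha>: "\<And>s v. (s, v) \<in> A \<longrightarrow> \<alpha> s v = 0 \<and> \<beta> s v = 0"
    "\<And>s v. (s, \<alpha> s v \<odot> b + \<beta> s v \<odot> c + v) \<in> A"
    by metis
  let ?v = "\<lambda>i j. i \<odot> v4 + j \<odot> v5"
  show ?thesis
  proof (rule listedI[OF basis], rule listed_pair12I[OF graph_factorization basis,
      where ?a3.0 = "\<lambda>s i j. \<alpha> s (?v i j)" and ?b3.0 = "\<lambda>s i j. \<beta> s (?v i j)"])
    show "(s, \<alpha> s (?v i j) \<odot> b + \<beta> s (?v i j) \<odot> c + i \<odot> v4 + j \<odot> v5) \<in> A" for s i j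
      using \<alpha>(2)[of s "?v i j"] by (simp only: add.assoc)
    show "(0, i \<odot> b + j \<odot> c) \<in> B" for i j
      using inQ F by (intro graphI) simp_all
  qed (use \<alpha>(1) zero_A in simp_all)
qed

text \<open>
  A slice is periodic with period \<open>g = b + c + d\<close>: if \<open>g + a = a' + q\<close> with \<open>q = b\<close>, then
  \<open>a + c = a' + d\<close>, against uniqueness, and likewise for \<open>q = c\<close> and \<open>q = d\<close>; so \<open>q = 0\<close>. In the basis
  that starts with \<open>g, b, c\<close> the set \<open>Q\<close> consists of \<open>0\<close>, \<open>b\<close>, \<open>c\<close> and \<open>g + b + c\<close>.
\<close>

lemma listed_7:
  assumes Q: "Q = {0, b, c, d}" and bc: "b \<noteq> 0" "c \<noteq> 0" "d \<noteq> 0" "b \<noteq> c" "b \<noteq> d" "c \<noteq> d"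
    and d: "d \<noteq> b + c" and F: "\<And>q. q \<in> Q \<Longrightarrow> F q = 0"
  shows "listed A B"
proof -
  define g where "g = b + c + d"
  have dg: "d = g + b + c" by (simp add: g_def ac_simps)
  have "b \<notin> span_list [g]"
    using bc d by (auto dest!: in_span_listD(2) simp: bscale_def g_def ac_simps bit4_add_eq_0_iff split: if_splits)
  moreover have "c \<notin> span_list [b, g]"
    using bc d by (auto dest!: in_span_listD(3) simp: bscale_def g_def ac_simps bit4_add_eq_0_iff split: if_splits)
  moreover have "g \<noteq> 0"
    using d by (metis bit4_add_left_self add_0_right g_def add.assoc add.commute)
  ultimately have "independent_list [c, b, g]"
    using independent_list_Cons[OF independent_list_Cons[OF independent_list_Cons[OF independent_Nil]]] by simp
  then obtain us where us: "span_list (us @ [c, b, g]) = UNIV" "length us + length [c, b, g] = 4"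
    by (rule extend_to_UNIV)
  then obtain v5 where "us = [v5]" using lists_of_length(1)[of us] by auto
  then have basis: "basis g b c v5" using us by (intro basis_if_span_list_UNIV) simp
  have per: "(s, g + a) \<in> A" if "(s, a) \<in> A" for s a
  proof -
    obtain a' q where a: "(s, a') \<in> A" "q \<in> Q" "g + a = a' + q" by (rule cover)
    have "q \<noteq> b"
    proof
      assume "q = b"
      have "a + c = (g + a) + (b + d)" by (simp add: g_def ac_simps)
      also have "\<dots> = a' + d" unfolding a(3) \<open>q = b\<close> by (simp add: ac_simps)
      finally have "a + c = a' + d" .
      then show False using unique(2)[OF that a(1)] Q bc by blast
    qed
    moreover have "q \<noteq> c"
    proof
      assume "q = c"
      have "a + b = (g + a) + (c + d)" by (simp add: g_def ac_simps)
      also have "\<dots> = a' + d" unfolding a(3) \<open>q = c\<close> by (simp add: ac_simps)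
      finally have "a + b = a' + d" .
      then show False using unique(2)[OF that a(1)] Q bc by blast
    qed
    moreover have "q \<noteq> d"
    proof
      assume "q = d"
      have "a + b = (g + a) + (d + c)" by (simp add: g_def ac_simps)
      also have "\<dots> = a' + c" unfolding a(3) \<open>q = d\<close> by (simp add: ac_simps)
      finally have "a + b = a' + c" .
      then show False using unique(2)[OF that a(1)] Q bc by blast
    qed
    ultimately show ?thesis using a Q by auto
  qed
  have per': "(s, k \<odot> g + a) \<in> A" if "(s, a) \<in> A" for s a k
    using per[OF that] that by (cases k) simp_all
  have "\<exists>\<alpha> \<beta>. ((s, v) \<in> A \<longrightarrow> \<alpha> = 0 \<and> \<beta> = 0) \<and> (s, \<alpha> \<odot> b + \<beta> \<odot> c + v) \<in> A" for s v
  proof (cases "(s, v) \<in> A")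
    case True
    then show ?thesis by (intro exI[of _ 0]) simp
  next
    case False
    obtain a q where a: "(s, a) \<in> A" "q \<in> Q" "v = a + q" by (rule cover)
    have "\<exists>k \<alpha> \<beta>. q = k \<odot> g + (\<alpha> \<odot> b + \<beta> \<odot> c)"
    proof -
      have "q = 0 \<odot> g + (0 \<odot> b + 0 \<odot> c) \<or> q = 0 \<odot> g + (1 \<odot> b + 0 \<odot> c) \<or> q = 0 \<odot> g + (0 \<odot> b + 1 \<odot> c)
        \<or> q = 1 \<odot> g + (1 \<odot> b + 1 \<odot> c)"
        using a(2) dg unfolding Q by (simp add: add.assoc)
      then show ?thesis by blast
    qed
    then obtain k \<alpha> \<beta> where q: "q = k \<odot> g + (\<alpha> \<odot> b + \<beta> \<odot> c)" by blast
    have "\<alpha> \<odot> b + \<beta> \<odot> c + v = k \<odot> g + a" using a(3) q by (simp add: ac_simps)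
    then show ?thesis using False per'[OF a(1)] by metis
  qed
  then obtain \<alpha> \<beta> where \<alpha>: "\<And>s v. (s, v) \<in> A \<longrightarrow> \<alpha> s v = 0 \<and> \<beta> s v = 0"
    "\<And>s v. (s, \<alpha> s v \<odot> b + \<beta> s v \<odot> c + v) \<in> A"
    by metis
  show ?thesis
  proof (rule listedI[OF basis], rule listed_pair7I[OF graph_factorization basis,
      where ?a2.0 = "\<lambda>s j. \<alpha> s (j \<odot> v5)" and ?b2.0 = "\<lambda>s j. \<beta> s (j \<odot> v5)" and l = "\<lambda>i j. i * j"])
    show "(s, k \<odot> g + \<alpha> s (j \<odot> v5) \<odot> b + \<beta> s (j \<odot> v5) \<odot> c + j \<odot> v5) \<in> A" for s j k
      using per'[OF \<alpha>(2)[of s "j \<odot> v5"], of k] by (simp only: add.assoc)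
    have "(i * j) \<odot> g + i \<odot> b + j \<odot> c \<in> Q" for i j
      using Q dg by (cases i; cases j) simp_all
    then show "(0, (i * j) \<odot> g + i \<odot> b + j \<odot> c) \<in> B" for i j
      using F by (intro graphI) simp_all
  qed (use \<alpha>(1) zero_A in simp_all)
qed

text \<open>
  Here \<open>V\<close> is the disjoint union of the zero set of \<open>F\<close> and its translate by \<open>c\<close>, and every slice is a
  transversal of \<open>\<langle>b\<rangle>\<close> in the zero set. The coefficient \<open>\<beta>\<close> of \<open>c\<close> moves a vector into the zero set, and
  then the coefficient \<open>\<alpha>\<close> of \<open>b\<close> moves it into the slice.
\<close>

lemma listed_10:
  assumes Q: "Q = {0, b, c, b + c}" and bc: "b \<noteq> 0" "c \<noteq> 0" "b \<noteq> c"
    and F: "F b = 0" "F c \<noteq> 0" "F (b + c) = F c"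
  shows "listed A B"
proof -
  have "c \<notin> span_list [b]" using bc by (auto dest!: in_span_listD(2) simp: bscale_def split: if_splits)
  then have "independent_list [c, b]"
    using independent_list_Cons[OF independent_list_Cons[OF independent_Nil]] bc by simp
  then obtain us where us: "span_list (us @ [c, b]) = UNIV" "length us + length [c, b] = 4"
    by (rule extend_to_UNIV)
  then obtain v4 v5 where "us = [v5, v4]" using lists_of_length(2)[of us] by auto
  then have basis: "basis b c v4 v5" using us by (intro basis_if_span_list_UNIV) simp
  define \<beta> where "\<beta> v = (if F v = 0 then 0 else (1 :: bit))" for v
  define \<alpha> where "\<alpha> s v = (if (s, \<beta> v \<odot> c + v) \<in> A then 0 else (1 :: bit))" for s v
  have \<beta>: "F (\<beta> v \<odot> c + v) = 0" for v
  proof (cases "F v = 0")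
    case False
    obtain a q where a: "(0, a) \<in> A" "q \<in> Q" "v = a + q" by (rule cover)
    then have "F q \<noteq> 0" using False const by simp
    then have q: "q = c \<or> q = b + c" using a(2) Q F_0 F by auto
    then have "q + c \<in> Q" "F (q + c) = 0" using Q F F_0 by (auto simp: ac_simps)
    then have "F (a + (q + c)) = 0" using const[OF a(1)] by simp
    then show ?thesis using False a(3) by (simp add: \<beta>_def ac_simps)
  qed (simp add: \<beta>_def)
  have \<alpha>: "(s, \<alpha> s v \<odot> b + (\<beta> v \<odot> c + v)) \<in> A" for s v
  proof -
    obtain a q where a: "(s, a) \<in> A" "q \<in> Q" "\<beta> v \<odot> c + v = a + q" by (rule cover)
    then have "F q = 0" using \<beta>[of v] const by simp
    then have "q = 0 \<or> q = b" using a(2) Q F by auto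
    then show ?thesis
    proof
      assume "q = b"
      then have "b + (\<beta> v \<odot> c + v) = a" using a(3) by (simp add: add.left_commute)
      then show ?thesis using a(1) by (simp add: \<alpha>_def)
    qed (use a in \<open>simp add: \<alpha>_def\<close>)
  qed
  let ?v = "\<lambda>i j. i \<odot> v4 + j \<odot> v5"
  show ?thesis
  proof (rule listedI[OF basis], rule listed_pair10I[OF graph_factorization basis,
      where ?a3.0 = "\<lambda>i j s. \<alpha> s (?v i j)" and ?a2.0 = "\<lambda>i j. \<beta> (?v i j)" and l = "\<lambda>i. F (i \<odot> c)"])
    show "(s, \<alpha> s (?v i j) \<odot> b + \<beta> (?v i j) \<odot> c + i \<odot> v4 + j \<odot> v5) \<in> A" for s i j
      using \<alpha>[of s "?v i j"] by (simp only: add.assoc)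
    show "(F (i \<odot> c), j \<odot> b + i \<odot> c) \<in> B" for i j
      using Q F F_0 by (intro graphI) (cases i; cases j; simp)+
  qed (simp_all add: \<alpha>_def \<beta>_def F_0 zero_A)
qed

text \<open>
  If \<open>q\<close> were alone in its fibre, every slice would be the translate by \<open>q\<close> of the set where \<open>F\<close> takes
  the value \<open>F q\<close>. So all slices would be equal to the slice at \<open>0\<close>, which has four elements and lies
  in a proper subgroup.
\<close>

lemma no_singleton_fibre:
  assumes Q4: "card Q = 4" and gen: "\<And>H. subgrp H \<Longrightarrow> (\<And>s a. (s, a) \<in> A \<Longrightarrow> a \<in> H) \<Longrightarrow> H = UNIV"
    and q: "q \<in> Q"
  shows "\<exists>q'\<in>Q. q' \<noteq> q \<and> F q' = F q"
proof (rule ccontr)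
  assume *: "\<not> ?thesis"
  have sub: "a \<in> slice A 0" if a: "(s, a) \<in> A" for s a
  proof -
    obtain a' q' where a': "(0, a') \<in> A" "q' \<in> Q" "a + q = a' + q'" by (rule cover)
    then have "F q' = F q" using const[OF a q] const[OF a'(1,2)] by simp
    then have "q' = q" using * a'(2) by blast
    then have "a = a'" using a'(3) by simp
    then show ?thesis using a' by (simp add: slice_def)
  qed
  have "card (slice A 0) \<le> 4" using card_slice[of 0] Q4 by simp
  moreover have "0 \<in> slice A 0" using zero_A by (simp add: slice_def)
  ultimately obtain H where "subgrp H" "slice A 0 \<subseteq> H" "H \<noteq> UNIV"
    by (rule small_subset_proper_subgrp)
  then show False using gen[of H] sub by blast
qed

text \<open>
  The zero set of \<open>F\<close> is the direct sum of the slice at \<open>0\<close> and \<open>{0, b}\<close>, so it has eight elements and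
  period \<open>b\<close>. Its complement is the sum of the slice and \<open>{c, d}\<close> and has period \<open>c + d\<close>, hence so has
  the zero set. If \<open>c + d \<noteq> b\<close>, it is a union of two cosets of a group of order four and therefore a
  proper subgroup that contains all slices.
\<close>

lemma not_generating_if_not_subgroup:
  assumes Q: "Q = {0, b, c, d}" and Q4: "card Q = 4" and d: "d \<noteq> b + c"
    and gen: "\<And>H. subgrp H \<Longrightarrow> (\<And>s a. (s, a) \<in> A \<Longrightarrow> a \<in> H) \<Longrightarrow> H = UNIV"
    and F: "F b = 0" "F c \<noteq> 0" "F d = F c"
  shows False
proof -
  let ?V = "{v. F v = 0}"
  let ?K = "span_list [c + d, b]"
  have neq: "b \<noteq> 0" "c \<noteq> 0" "d \<noteq> 0" "b \<noteq> c" "b \<noteq> d" "c \<noteq> d"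
  proof -
    have "card {0, b, c, d} = 4" using Q Q4 by simp
    then show "b \<noteq> 0" "c \<noteq> 0" "d \<noteq> 0" "b \<noteq> c" "b \<noteq> d" "c \<noteq> d"
      by (auto simp: card_insert_if split: if_splits)
  qed
  have Vb: "F (b + v) = 0" if v: "F v = 0" for v
  proof -
    obtain a q where a: "(0, a) \<in> A" "q \<in> Q" "v = a + q" by (rule cover)
    then have "F q = 0" using v const by simp
    then have "q = 0 \<or> q = b" using a(2) Q F by auto
    then have "b + v = a + b \<or> b + v = a + 0" using a(3) by (auto simp: ac_simps)
    then show ?thesis using const[OF a(1), of b] const[OF a(1), of 0] F F_0 Q by (auto simp: add.commute[of b])
  qed
  have Vcd: "F ((c + d) + v) = 0" if v: "F v = 0" for v
  proof -
    obtain a q where a: "(0, a) \<in> A" "q \<in> Q" "(c + d) + v = a + q" by (rule cover)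
    have "q \<noteq> c"
    proof
      assume "q = c"
      have "v = (c + d) + ((c + d) + v)" by (simp only: bit4_add_left_self)
      also have "\<dots> = a + d" unfolding a(3) \<open>q = c\<close> by (simp add: ac_simps)
      finally have "v = a + d" .
      then show False using v const[OF a(1), of d] Q F by simp
    qed
    moreover have "q \<noteq> d"
    proof
      assume "q = d"
      have "v = (c + d) + ((c + d) + v)" by (simp only: bit4_add_left_self)
      also have "\<dots> = a + c" unfolding a(3) \<open>q = d\<close> by (simp add: ac_simps)
      finally have "v = a + c" .
      then show False using v const[OF a(1), of c] Q F by simp
    qed
    ultimately have "q = 0 \<or> q = b" using a(2) Q by blast
    then show ?thesis unfolding a(3) using const[OF a(1,2)] F F_0 by auto
  qed
  have inv: "k + x \<in> ?V" if x: "x \<in> ?V" and kK: "k \<in> ?K" for x k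
  proof -
    obtain i j where k: "k = i \<odot> b + j \<odot> (c + d)" using in_span_listD(3)[OF kK] by blast
    have "F (j \<odot> (c + d) + x) = 0" using x Vcd by (cases j) simp_all
    then have "F (i \<odot> b + (j \<odot> (c + d) + x)) = 0" using Vb by (cases i) simp_all
    then show ?thesis by (simp add: k add.assoc)
  qed
  have "c + d \<notin> span_list [b]"
  proof
    assume "c + d \<in> span_list [b]"
    then obtain i where "c + d = i \<odot> b" using in_span_listD(2) by blast
    then have "c + d = 0 \<or> c + d = b" by (cases i) simp_all
    moreover have "d = c + (c + d)" by simp
    ultimately have "d = c \<or> d = b + c" by (metis add.commute add_0_right)
    then show False using neq d by simp
  qed
  then have "independent_list [c + d, b]"
    using independent_list_Cons[OF independent_list_Cons[OF independent_Nil]] neq by simp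
  then have K4: "card ?K = 4" by (simp add: independent_list_def)
  have "?V \<subseteq> (\<lambda>(a, q). a + q) ` (slice A 0 \<times> {0, b})"
  proof
    fix v assume v: "v \<in> ?V"
    obtain a q where a: "(0, a) \<in> A" "q \<in> Q" "v = a + q" by (rule cover)
    then have "F q = 0" using v const by simp
    then have "q \<in> {0, b}" using a(2) Q F by auto
    then show "v \<in> (\<lambda>(a, q). a + q) ` (slice A 0 \<times> {0, b})"
      using a by (intro image_eqI[of _ _ "(a, q)"]) (simp_all add: slice_def)
  qed
  then have "card ?V \<le> card (slice A 0 \<times> {0, b})"
    by (meson card_image_le card_mono finite le_trans)
  also have "\<dots> = 8" using card_slice[of 0] Q4 neq by (simp add: card_cartesian_product)
  finally have "card ?V \<le> 2 * card ?K" using K4 by simp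
  then have "subgrp ?V"
    using inv F_0 by (intro subgrp_if_union_of_two_cosets[OF subgrp_span_list]) simp_all
  moreover have "a \<in> ?V" if "(s, a) \<in> A" for s a using F_slice[OF that] by simp
  ultimately have "?V = UNIV" using gen by blast
  then show False using F by blast
qed

text \<open>
  Fibres with one element being excluded, either \<open>F\<close> vanishes on \<open>Q\<close> or both fibres have two elements.
  In the first case it matters whether \<open>Q\<close> is a subgroup.
\<close>

lemma listed_if_card_4:
  assumes Q4: "card Q = 4" and gen: "\<And>H. subgrp H \<Longrightarrow> (\<And>s a. (s, a) \<in> A \<Longrightarrow> a \<in> H) \<Longrightarrow> H = UNIV"
  shows "listed A B"
proof -
  have part: "\<exists>q'\<in>Q. q' \<noteq> q \<and> F q' = F q" if "q \<in> Q" for q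
    using no_singleton_fibre[OF Q4 _ that] gen by blast
  obtain b where b: "b \<in> Q" "b \<noteq> 0" "F b = 0" using part[OF zero_Q] F_0 by auto
  have "card (Q - {0, b}) = 2" using Q4 b zero_Q by (simp add: card_Diff_subset)
  then obtain c d where cd: "Q - {0, b} = {c, d}" "c \<noteq> d" unfolding card_2_iff by blast
  then have Q: "Q = {0, b, c, d}" and neq: "c \<noteq> 0" "d \<noteq> 0" "b \<noteq> c" "b \<noteq> d"
    using b zero_Q by blast+
  have "F c = 0 \<longleftrightarrow> F d = 0" and Fdc: "F c \<noteq> 0 \<Longrightarrow> F d = F c"
    using part[of c] part[of d] b F_0 unfolding Q by auto
  show ?thesis
  proof (cases "F c = 0")
    case True
    then have F0: "F q = 0" if "q \<in> Q" for q
      using that b F_0 \<open>F c = 0 \<longleftrightarrow> F d = 0\<close> unfolding Q by auto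
    show ?thesis
    proof (cases "d = b + c")
      case True
      then show ?thesis using listed_12[of b c] Q b neq F0 by simp
    next
      case False
      then show ?thesis using listed_7[OF Q b(2) neq(1,2,3,4) cd(2)] F0 by blast
    qed
  next
    case False
    then have Fd: "F d = F c" using Fdc by simp
    have "d = b + c"
      using not_generating_if_not_subgroup[OF Q Q4 _ _ b(3) False Fd] gen by blast
    then show ?thesis using listed_10[of b c] Q b neq False Fd by simp
  qed
qed

section \<open>The classification\<close>

lemma card_Q_cases: "card Q \<in> {1, 2, 4, 8, 16}"
proof -
  have "card Q dvd 16" by (metis card_slice dvd_triv_right)
  also have "(16 :: nat) = 2 ^ 4" by simp
  finally have "card Q dvd 2 ^ 4" .
  then obtain i where "i \<le> 4" "card Q = 2 ^ i"
    using divides_primepow_nat[of 2] two_is_prime_nat by blast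
  moreover from this(1) have "i \<in> {0, 1, 2, 3, 4}" by auto
  ultimately show ?thesis by auto
qed

text \<open>
  For \<open>card Q \<ge> 8\<close> the slices lie in the group \<open>stab\<close>, which must then be all of \<open>V\<close>.
\<close>

theorem listed_if_generating:
  assumes gen: "\<And>H. subgrp H \<Longrightarrow> (\<And>s a. (s, a) \<in> A \<Longrightarrow> a \<in> H) \<Longrightarrow> H = UNIV" and proper: "A \<noteq> UNIV"
  shows "listed A B"
  using card_Q_cases
proof (elim insertE emptyE)
  assume "card Q = 1"
  then have Q: "Q = {0}" using zero_Q by (auto simp: card_1_singleton_iff)
  have "(s, v) \<in> A" for s v
  proof -
    obtain a q where "(s, a) \<in> A" "q \<in> Q" "v = a + q" by (rule cover)
    then show ?thesis using Q by simp
  qed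
  then show ?thesis using proper by auto
next
  assume "card Q = 2"
  then obtain b where "Q = {0, b}" "b \<noteq> 0" using zero_Q unfolding card_2_iff by blast
  then show ?thesis by (rule listed_20_24)
next
  assume "card Q = 4"
  then show ?thesis using listed_if_card_4 gen by blast
next
  assume Q: "card Q = 8"
  then have "stab = UNIV" using gen[OF subgrp_stab] slice_subset_stab by blast
  then show ?thesis using listed_2_to_5 Q by blast
next
  assume "card Q = 16"
  then have Q: "Q = UNIV" by (simp add: card_eq_UNIV_imp_eq_UNIV)
  then have "stab = UNIV" using gen[OF subgrp_stab] slice_subset_stab_if_Q_UNIV by blast
  then show ?thesis using listed_1 Q by blast
qed

text \<open>
  A set \<open>Q\<close> with at most four elements, one of them zero, lies in a proper subgroup.
\<close>

theorem listed_if_graph_generating: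
  assumes gen: "\<And>H. subgrp H \<Longrightarrow> Q \<subseteq> H \<Longrightarrow> H = UNIV" and nz: "q \<in> Q" "F q \<noteq> 0"
  shows "listed B A"
proof -
  have M: "stab \<noteq> UNIV" using F_eq_0_if_stab_UNIV nz by blast
  have "\<not> card Q \<le> 4"
  proof
    assume "card Q \<le> 4"
    then obtain H where "subgrp H" "Q \<subseteq> H" "H \<noteq> UNIV"
      using zero_Q by (rule small_subset_proper_subgrp)
    then show False using gen by blast
  qed
  then consider "card Q = 8" | "card Q = 16" using card_Q_cases by auto
  then show ?thesis
  proof cases
    case 1
    then show ?thesis using listed_13_to_18 M gen by blast
  next
    case 2
    then have Q: "Q = UNIV" by (simp add: card_eq_UNIV_imp_eq_UNIV)
    then show ?thesis using listed_25_to_28 M by blast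
  qed
qed

end

lemma group_closure_subset:
  assumes "S \<subseteq> K" "0 \<in> K" "\<And>x y. x \<in> K \<Longrightarrow> y \<in> K \<Longrightarrow> x - y \<in> K"
  shows "group_closure S \<subseteq> K"
proof
  fix x assume "x \<in> group_closure S"
  then show "x \<in> K" by induction (use assms in auto)
qed

lemma generating_snd:
  fixes S :: "('a::ab_group_add \<times> bit4) set"
  assumes "group_closure S = UNIV" "subgrp H" "\<And>s a. (s, a) \<in> S \<Longrightarrow> a \<in> H"
  shows "H = UNIV"
proof -
  have "group_closure S \<subseteq> UNIV \<times> H"
  proof (rule group_closure_subset)
    show "S \<subseteq> UNIV \<times> H"
    proof
      fix z assume "z \<in> S"
      then show "z \<in> UNIV \<times> H" using assms(3)[of "fst z" "snd z"] by (simp add: mem_Times_iff)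
    qed
    show "0 \<in> UNIV \<times> H" using subgrp_zero[OF assms(2)] by (simp add: mem_Times_iff)
    show "x - y \<in> UNIV \<times> H" if "x \<in> UNIV \<times> H" "y \<in> UNIV \<times> H" for x y
      using that subgrp_add[OF assms(2)] by (simp add: mem_Times_iff)
  qed
  then show ?thesis using assms(1) by blast
qed

lemma generating_fst:
  fixes S :: "('a::{ab_group_add,zero_neq_one} \<times> bit4) set"
  assumes "group_closure S = UNIV"
  obtains s a where "(s, a) \<in> S" "s \<noteq> 0"
proof -
  have "\<not> S \<subseteq> {0} \<times> UNIV"
  proof
    assume "S \<subseteq> {0} \<times> UNIV"
    then have "group_closure S \<subseteq> {0} \<times> UNIV"
      by (rule group_closure_subset) (simp_all add: mem_Times_iff)
    then have "(1, 0) \<in> {0 :: 'a} \<times> (UNIV :: bit4 set)" using assms by blast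
    then show False by simp
  qed
  then obtain z where "z \<in> S" "z \<notin> {0} \<times> UNIV" by blast
  then show ?thesis using that[of "fst z" "snd z"] by (simp add: mem_Times_iff)
qed

theorem theorem5p12:
  fixes S C :: "('p::prime_card mod_ring \<times> bit \<times> bit \<times> bit \<times> bit) set"
  assumes "odd CARD('p)"
    and "S \<subset> UNIV - {0}"
    and "group_closure S = UNIV"
    and "0 \<in> C"
  shows "perfect_code (cayley_digraph S) C \<longleftrightarrow>
    (\<exists>e2 e3 e4 e5.
       group_closure {e2, e3, e4, e5} = {0} \<times> UNIV \<and>
       listed_pair (int CARD('p)) (1, 0, 0, 0, 0) e2 e3 e4 e5 (insert 0 S) C)"
proof
  assume "\<exists>e2 e3 e4 e5.
       group_closure {e2, e3, e4, e5} = {0} \<times> UNIV \<and>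
       listed_pair (int CARD('p)) (1, 0, 0, 0, 0) e2 e3 e4 e5 (insert 0 S) C"
  then show "perfect_code (cayley_digraph S) C"
    unfolding group_closure_basis perfect_code_iff_factorization
    using factorization_if_listed_pair by blast
next
  let ?A = "insert 0 S" and ?p = "CARD('p)"
  assume "perfect_code (cayley_digraph S) C"
  then have fac: "factorization ?A C" by (simp add: perfect_code_iff_factorization)
  have p: "prime ?p" by (rule prime_card)
  have card: "card ?A * card C = ?p * 2 ^ 4"
    using factorization_card[OF fac] by simp
  have pow: "\<exists>n. m = 2 ^ n" if "m dvd ?p * 2 ^ 4" "\<not> ?p dvd m" for m
  proof -
    have "coprime m ?p" using that(2) p by (metis coprime_commute prime_imp_coprime)
    then have "m dvd 2 ^ 4" using that(1) coprime_dvd_mult_right_iff by blast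
    then show ?thesis using divides_primepow_nat[of 2 m 4] two_is_prime_nat by blast
  qed
  have "listed ?A C"
  proof (cases "?p dvd card C")
    case False
    then obtain n where "card C = 2 ^ n" using pow[of "card C"] card by (metis dvd_triv_right)
    then obtain Q F where nf: "normal_form ?A Q F" and C: "C = (\<lambda>q. (F q, q)) ` Q"
      using ex_normal_form[OF assms(1) fac _ _ assms(4)] by blast
    have "?A \<noteq> UNIV" using assms(2) by blast
    moreover have "H = UNIV" if "subgrp H" "\<And>s a. (s, a) \<in> ?A \<Longrightarrow> a \<in> H" for H
      using generating_snd[OF assms(3) that(1)] that(2) by blast
    ultimately show ?thesis
      unfolding C using normal_form.listed_if_generating[OF nf] by blast
  next
    case True
    \<comment> \<open>Otherwise \<open>p\<^sup>2\<close> would divide \<open>16p\<close>.\<close>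
    have "\<not> ?p dvd card ?A"
    proof
      assume "?p dvd card ?A"
      then have "?p * ?p dvd ?p * 2 ^ 4" using True unfolding card[symmetric] by (rule mult_dvd_mono)
      then have "?p dvd 2 ^ 4" using p by (simp add: prime_gt_0_nat)
      then have "?p dvd 2" using p prime_dvd_power_nat by blast
      then have "?p = 2" using p two_is_prime_nat primes_dvd_imp_eq by blast
      then show False using assms(1) by simp
    qed
    then obtain n where n: "card ?A = 2 ^ n" using pow[of "card ?A"] card by (metis dvd_triv_left)
    have "factorization C ?A" using fac factorization_commute by blast
    then obtain Q F where nf: "normal_form C Q F" and A: "?A = (\<lambda>q. (F q, q)) ` Q"
      using ex_normal_form[OF assms(1) _ n assms(4)] by blast
    have "H = UNIV" if H: "subgrp H" "Q \<subseteq> H" for H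
    proof (rule generating_snd[OF assms(3) H(1)])
      fix s a assume "(s, a) \<in> S"
      then have "(s, a) \<in> (\<lambda>q. (F q, q)) ` Q" using A by blast
      then show "a \<in> H" using H(2) by blast
    qed
    moreover obtain s a where "(s, a) \<in> S" "s \<noteq> 0" using generating_fst[OF assms(3)] .
    then have "(s, a) \<in> (\<lambda>q. (F q, q)) ` Q" using A by blast
    then have "a \<in> Q" "F a \<noteq> 0" using \<open>s \<noteq> 0\<close> by auto
    ultimately show ?thesis
      unfolding A using normal_form.listed_if_graph_generating[OF nf] by blast
  qed
  then show "\<exists>e2 e3 e4 e5.
       group_closure {e2, e3, e4, e5} = {0} \<times> UNIV \<and>
       listed_pair (int CARD('p)) (1, 0, 0, 0, 0) e2 e3 e4 e5 ?A C"
    unfolding listed_def group_closure_basis by blast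
qed

end
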